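(* Fix an integer $r\ge 3$ and a sufficiently small $\eta>0$ (in terms of $r$). Then, there is $\varepsilon=\varepsilon(r,\eta)>0$ such that, for every sufficiently large $n$ and every tree $T$ on $n$ vertices with maximum degree $\Delta\le\varepsilon n$, every $\varepsilon$-balanced $\eta$-standard colouring of the edges of $K_n$ in $r$ colours contains a copy of $T$ where colour $1$ is given to at least $\frac{\eta^2}{10^6r^3}\,n$ more edges than any other colour.
   Context: Colours are $1,\dots,r$; $[2,r]=\{2,\dots,r\}$. An $r$-edge-colouring of a graph $G$ is $\varepsilon$-balanced if, for each colour, the proportion of edges of $G$ having that colour lies in $[1/r-\varepsilon,1/r+\varepsilon]$. For $\eta>0$, an $r$-edge-colouring of a graph $G$ on $n$ vertices is $\eta$-standard if, for every partition $V_1,V_2$ of its vertex set with $|V_1|-|V_2|\in\{0,1\}$ and every integer $i\in[2,r]$, $G[V_1]$ contains at least $\eta n^2$ edges with colour different from $1$ or $G[V_2]$ contains at least $\eta n^2$ edges with colour different from $i$. A copy of $T$ is a subgraph isomorphic to $T$. *)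

theory Defs
  imports Complex_Main
begin

text \<open>
  An undirected graph is a vertex set together with a set of edges, each edge being a two-element
  set of vertices; see \<open>simple_graph\<close> for well-formedness.
\<close>

record 'a ugraph =
  uverts :: "'a set"
  uedges :: "'a set set"

definition simple_graph :: "'a ugraph \<Rightarrow> bool" where
  "simple_graph G \<longleftrightarrow>
     finite (uverts G) \<and> (\<forall>e\<in>uedges G. e \<subseteq> uverts G \<and> card e = 2)"

definition complete_ugraph :: "'a set \<Rightarrow> 'a ugraph" where
  "complete_ugraph V = \<lparr>uverts = V, uedges = {e. e \<subseteq> V \<and> card e = 2}\<rparr>"

definition induced_ugraph :: "'a ugraph \<Rightarrow> 'a set \<Rightarrow> 'a ugraph" where
  "induced_ugraph G U = \<lparr>uverts = U, uedges = {e \<in> uedges G. e \<subseteq> U}\<rparr>"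

definition graph_degree :: "'a ugraph \<Rightarrow> 'a \<Rightarrow> nat" where
  "graph_degree G v = card {e \<in> uedges G. v \<in> e}"

text \<open>Meaningful only for finite graphs with at least one vertex.\<close>

definition max_graph_degree :: "'a ugraph \<Rightarrow> nat" where
  "max_graph_degree G = Max (graph_degree G ` uverts G)"

definition connected_ugraph :: "'a ugraph \<Rightarrow> bool" where
  "connected_ugraph G \<longleftrightarrow> uverts G \<noteq> {} \<and>
     (\<forall>u\<in>uverts G. \<forall>v\<in>uverts G. (u, v) \<in> {(x, y). {x, y} \<in> uedges G}\<^sup>*)"

definition ugraph_cycle :: "'a ugraph \<Rightarrow> 'a list \<Rightarrow> bool" where
  "ugraph_cycle G xs \<longleftrightarrow> length xs \<ge> 3 \<and> distinct xs \<and>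
     (\<forall>i<length xs. {xs ! i, xs ! (Suc i mod length xs)} \<in> uedges G)"

definition tree_ugraph :: "'a ugraph \<Rightarrow> bool" where
  "tree_ugraph T \<longleftrightarrow>
     simple_graph T \<and> connected_ugraph T \<and> (\<nexists>xs. ugraph_cycle T xs)"

definition isomorphic_ugraph :: "'a ugraph \<Rightarrow> 'b ugraph \<Rightarrow> bool" where
  "isomorphic_ugraph G H \<longleftrightarrow> (\<exists>f. bij_betw f (uverts G) (uverts H) \<and>
     (\<forall>u\<in>uverts G. \<forall>v\<in>uverts G. {u, v} \<in> uedges G \<longleftrightarrow> {f u, f v} \<in> uedges H))"

definition subgraph_of :: "'a ugraph \<Rightarrow> 'a ugraph \<Rightarrow> bool" where
  "subgraph_of H G \<longleftrightarrow>
     simple_graph H \<and> uverts H \<subseteq> uverts G \<and> uedges H \<subseteq> uedges G"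

definition copy_in :: "'b ugraph \<Rightarrow> 'a ugraph \<Rightarrow> 'a ugraph \<Rightarrow> bool" where
  "copy_in T G H \<longleftrightarrow> subgraph_of H G \<and> isomorphic_ugraph T H"

text \<open>
  The colours are \<open>1, \<dots>, r\<close>. A colouring is a function on all sets of vertices of which only the
  values on edges matter.
\<close>

definition edge_colouring :: "nat \<Rightarrow> 'a ugraph \<Rightarrow> ('a set \<Rightarrow> nat) \<Rightarrow> bool" where
  "edge_colouring r G c \<longleftrightarrow> (\<forall>e\<in>uedges G. c e \<in> {1..r})"

definition colour_count :: "'a ugraph \<Rightarrow> ('a set \<Rightarrow> nat) \<Rightarrow> nat \<Rightarrow> nat" where
  "colour_count G c i = card {e \<in> uedges G. c e = i}"

definition balanced_colouring ::
    "real \<Rightarrow> nat \<Rightarrow> 'a ugraph \<Rightarrow> ('a set \<Rightarrow> nat) \<Rightarrow> bool" where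
  "balanced_colouring \<epsilon> r G c \<longleftrightarrow> edge_colouring r G c \<and>
     (\<forall>i\<in>{1..r}. real (colour_count G c i) / real (card (uedges G))
        \<in> {1 / real r - \<epsilon> .. 1 / real r + \<epsilon>})"

definition standard_colouring ::
    "real \<Rightarrow> nat \<Rightarrow> 'a ugraph \<Rightarrow> ('a set \<Rightarrow> nat) \<Rightarrow> bool" where
  "standard_colouring \<eta> r G c \<longleftrightarrow> edge_colouring r G c \<and>
     (\<forall>V1 V2. V1 \<union> V2 = uverts G \<and> V1 \<inter> V2 = {} \<and>
        int (card V1) - int (card V2) \<in> {0, 1} \<longrightarrow>
        (\<forall>i\<in>{2..r}.
           real (card {e \<in> uedges (induced_ugraph G V1). c e \<noteq> 1})
             \<ge> \<eta> * (real (card (uverts G)))\<^sup>2 \<or>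
           real (card {e \<in> uedges (induced_ugraph G V2). c e \<noteq> i})
             \<ge> \<eta> * (real (card (uverts G)))\<^sup>2))"

end

theory Submission
  imports Defs "HOL-Combinatorics.Permutations"
begin

text \<open>
  Let \<open>h\<^sub>i(e) = [c e = 1] - [c e = i]\<close>. Choose linearly many pairs of vertices of \<open>T\<close> of equal
  degree \<open>k \<in> {1, 2}\<close>, independent and with disjoint neighbourhoods, and embed \<open>T\<close> by a random
  bijection. Exchanging the images \<open>a, d\<close> of one pair changes \<open>\<Sum>\<^sub>e h\<^sub>i(e)\<close> by \<open>k\<close> alternating sums
  \<open>h\<^sub>i(dz) - h\<^sub>i(az) + h\<^sub>i(az') - h\<^sub>i(dz')\<close>, and the exchanges of different pairs do not interact.

  If such an alternating sum vanishes for almost all quadruples, then \<open>2 h\<^sub>i(xy) = q(x) + q(y)\<close> for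
  almost all pairs with \<open>q\<close> integer-valued of constant parity. By balance \<open>q\<close> must be odd, and the
  classes \<open>q > 0\<close> and \<open>q < 0\<close> are almost cliques of colours \<open>1\<close> and \<open>i\<close> of almost equal size,
  contradicting standardness. So a positive proportion of the exchanges is profitable for each
  \<open>h\<^sub>i\<close>, and likewise for \<open>[c e = 1]\<close>.

  To beat all colours at once, choose the set of exchanges minimising a quadratic penalty. Its gradient
  is a weight vector \<open>w\<close> on the colours, and it suffices that for every \<open>w\<close> the exchanges gain linearly
  much of \<open>\<Sum>\<^sub>i w\<^sub>i h\<^sub>i\<close>. If one colour \<open>j\<close> carries most of the weight, the exchanges profitable for
  \<open>h\<^sub>j\<close> do this; otherwise those profitable for \<open>[c e = 1]\<close> do. Only finitely many events are involved,
  so second moments suffice to find one embedding that is typical for all of them.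
\<close>

section \<open>Random permutations\<close>

text \<open>The weight vector \<open>w\<close> is known only after the embedding is fixed, and
  infinitely many \<open>w\<close> may occur. One embedding still suffices because the exchanges
  used for \<open>w\<close> are always those profitable for a single colour \<open>j\<close>. So
  only \<open>2 * r\<close> counts, the colours of the embedded edges and the profitable exchanges
  for each \<open>j\<close>, need to be close to their means; what follows is deterministic.

  The square in \<open>\<eta>\<^sup>2\<close> comes from pairs of degree 2. A pair of leaves needs
  one profitable quadruple, and these have density at least \<open>\<eta> / 100\<close>; a pair of
  degree 2 needs two of them sharing \<open>a, d\<close>, and Cauchy-Schwarz guarantees only density
  \<open>(\<eta> / 100)\<^sup>2 / 2\<close>. Paths show that leaves alone are not enough. With
  \<open>n / 40\<close> pairs this gives about \<open>\<eta>\<^sup>2 / 800000 * n\<close> useful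
  exchanges, each worth a fifth of the total weight, and \<open>\<gamma>\<close> and
  \<open>\<epsilon>\<close> are small against that.

  The degree bound enters through the variance: the number of pairs of edges, or of exchanges, that
  share a vertex is at most a multiple of \<open>\<Delta> * n\<close>, hence of
  \<open>\<epsilon> * n\<^sup>2\<close>.\<close>

definition dist_lists :: "nat \<Rightarrow> nat \<Rightarrow> nat list set" where
  "dist_lists n s = {ys. length ys = s \<and> distinct ys \<and> set ys \<subseteq> {..<n}}"

lemma finite_dist_lists [simp]: "finite (dist_lists n s)"
  by (rule finite_subset[OF _ finite_lists_length_eq[of "{..<n}" s]]) (auto simp: dist_lists_def)

lemma extend_to_permutation:
  assumes "xs \<in> dist_lists n s" "ys \<in> dist_lists n s"
  obtains p where "p permutes {..<n}" "map p xs = ys"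
proof -
  have len: "length xs = length ys" and d: "distinct xs" "distinct ys"
    and sub: "set xs \<subseteq> {..<n}" "set ys \<subseteq> {..<n}"
    using assms by (auto simp: dist_lists_def)
  have "card ({..<n} - set xs) = card ({..<n} - set ys)"
    using len d sub by (simp add: card_Diff_subset distinct_card)
  then obtain h where h: "bij_betw h ({..<n} - set xs) ({..<n} - set ys)"
    by (metis finite_Diff finite_lessThan finite_same_card_bij)
  define f where "f x = ys ! (THE i. i < length xs \<and> xs ! i = x)" for x
  have f: "f (xs ! i) = ys ! i" if "i < length xs" for i
    unfolding f_def using that d(1) nth_eq_iff_index_eq[OF d(1)]
    by (subst the_equality[of _ i]) auto
  have mf: "map f xs = ys"
    using len f by (simp add: list_eq_iff_nth_eq)
  have "inj_on f (set xs)"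
    using mf d(2) by (metis distinct_map)
  then have bf: "bij_betw f (set xs) (set ys)"
    using mf by (metis bij_betw_imageI list.set_map)
  define p where "p x = (if x \<in> {..<n} then (if x \<in> set xs then f x else h x) else x)" for x
  have "bij_betw p (set xs) (set ys)"
    using bf sub by (subst bij_betw_cong[of _ _ f]) (auto simp: p_def)
  moreover have "bij_betw p ({..<n} - set xs) ({..<n} - set ys)"
    using h by (subst bij_betw_cong[of _ _ h]) (auto simp: p_def)
  ultimately have "bij_betw p (set xs \<union> ({..<n} - set xs)) (set ys \<union> ({..<n} - set ys))"
    by (rule bij_betw_combine) auto
  moreover have "set xs \<union> ({..<n} - set xs) = {..<n}" "set ys \<union> ({..<n} - set ys) = {..<n}"
    using sub by auto
  ultimately have "bij_betw p {..<n} {..<n}" by simp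
  then have "p permutes {..<n}"
    by (rule bij_imp_permutes) (auto simp: p_def)
  moreover have "map p xs = map f xs"
    using sub by (auto simp: p_def)
  ultimately show ?thesis using that mf by metis
qed

text \<open>If \<open>p0\<close> is one such permutation, the others are exactly
  \<open>p0 \<circ> q\<close> with \<open>q\<close> a permutation of the \<open>n - s\<close> points
  outside \<open>xs\<close>.\<close>

lemma card_permutations_extending:
  assumes xs: "xs \<in> dist_lists n s" and ys: "ys \<in> dist_lists n s"
  shows "card {p. p permutes {..<n} \<and> map p xs = ys} = fact (n - s)"
proof -
  obtain p0 where p0: "p0 permutes {..<n}" "map p0 xs = ys"
    using extend_to_permutation[OF assms] .
  have xs': "set xs \<subseteq> {..<n}" "card (set xs) = s"
    using xs by (auto simp: dist_lists_def distinct_card)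
  have "{p. p permutes {..<n} \<and> map p xs = ys} = (\<lambda>q. p0 \<circ> q) ` {q. q permutes ({..<n} - set xs)}"
  proof (intro set_eqI iffI)
    fix p assume "p \<in> {p. p permutes {..<n} \<and> map p xs = ys}"
    then have p: "p permutes {..<n}" "map p xs = map p0 xs"
      using p0(2) by auto
    have "inv p0 \<circ> p permutes {..<n}"
      using p(1) p0(1) by (simp add: permutes_compose permutes_inv)
    moreover have "(inv p0 \<circ> p) x = x" if "x \<in> {..<n} - ({..<n} - set xs)" for x
      using that p(2) p0(1) by (auto simp: permutes_inverses(2))
    ultimately have "inv p0 \<circ> p permutes ({..<n} - set xs)"
      by (rule permutes_superset)
    moreover have "p = p0 \<circ> (inv p0 \<circ> p)"
      using p0(1) by (simp add: fun_eq_iff permutes_inverses(1))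
    ultimately show "p \<in> (\<lambda>q. p0 \<circ> q) ` {q. q permutes ({..<n} - set xs)}" by blast
  next
    fix p assume "p \<in> (\<lambda>q. p0 \<circ> q) ` {q. q permutes ({..<n} - set xs)}"
    then obtain q where q: "q permutes ({..<n} - set xs)" "p = p0 \<circ> q" by auto
    have "q permutes {..<n}" using q(1) by (rule permutes_subset) auto
    then have "p permutes {..<n}" using p0(1) q(2) by (simp add: permutes_compose)
    moreover have "map p xs = ys"
      using q p0(2) by (auto simp: permutes_not_in)
    ultimately show "p \<in> {p. p permutes {..<n} \<and> map p xs = ys}" by auto
  qed
  moreover have "inj_on (\<lambda>q. p0 \<circ> q) {q. q permutes ({..<n} - set xs)}"
    using permutes_inj[OF p0(1)] by (auto intro!: inj_onI simp: fun_eq_iff inj_eq)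
  ultimately have "card {p. p permutes {..<n} \<and> map p xs = ys} = card {q. q permutes ({..<n} - set xs)}"
    by (simp add: card_image)
  also have "\<dots> = fact (n - s)"
    using xs' by (intro card_permutations) (auto simp: card_Diff_subset)
  finally show ?thesis .
qed

section \<open>Means and variances over uniformly random permutations\<close>

lemma permutes_map_dist_lists:
  assumes "p permutes {..<n}" "xs \<in> dist_lists n s"
  shows "map p xs \<in> dist_lists n s"
  using assms permutes_in_image[OF assms(1)] permutes_inj_on[OF assms(1)]
  by (auto simp: dist_lists_def distinct_map)

text \<open>The image of a fixed distinct list under a uniform permutation is uniform, because every
  target list has the same number of extensions.\<close>

lemma sum_over_permutations:
  fixes F :: "nat list \<Rightarrow> real"
  assumes xs: "xs \<in> dist_lists n s"
  shows "(\<Sum>p | p permutes {..<n}. F (map p xs)) = fact (n - s) * (\<Sum>ys\<in>dist_lists n s. F ys)"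
proof -
  have "(\<Sum>p | p permutes {..<n}. F (map p xs))
      = (\<Sum>ys\<in>dist_lists n s. \<Sum>p | p \<in> {p. p permutes {..<n}} \<and> map p xs = ys. F (map p xs))"
    using permutes_map_dist_lists[OF _ xs] by (intro sum.group[symmetric]) (auto simp: finite_permutations)
  also have "\<dots> = (\<Sum>ys\<in>dist_lists n s. fact (n - s) * F ys)"
    using card_permutations_extending[OF xs] by (intro sum.cong refl) simp
  finally show ?thesis by (simp add: sum_distrib_left)
qed

lemma card_dist_lists:
  assumes "s \<le> n"
  shows "real (card (dist_lists n s)) * fact (n - s) = fact n"
proof -
  have "[0..<s] \<in> dist_lists n s" using assms by (auto simp: dist_lists_def)
  from sum_over_permutations[OF this, of "\<lambda>_. 1"] show ?thesis
    by (simp add: card_permutations mult.commute)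
qed

lemma card_dist_lists_pos: "s \<le> n \<Longrightarrow> card (dist_lists n s) > 0"
  using card_dist_lists[of s n] by (metis fact_nonzero mult_zero_left of_nat_0 gr0I)

lemma mean_over_permutations:
  fixes F :: "nat list \<Rightarrow> real"
  assumes xs: "xs \<in> dist_lists n s" and "s \<le> n"
  shows "(\<Sum>p | p permutes {..<n}. F (map p xs))
      = fact n * ((\<Sum>ys\<in>dist_lists n s. F ys) / card (dist_lists n s))"
  using sum_over_permutations[OF xs, of F] card_dist_lists_pos[OF assms(2)]
  by (simp add: card_dist_lists[OF assms(2), symmetric])

text \<open>The image of \<open>xs @ ys\<close> is uniform among distinct lists of length
  \<open>2 * s\<close>. Dropping the condition that its two halves be disjoint only adds nonnegative
  terms and makes the sum factor; the price is the denominator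
  \<open>card (dist_lists n (2 * s))\<close> instead of a square.\<close>

lemma mean_product_over_permutations:
  fixes F F' :: "nat list \<Rightarrow> real"
  assumes xs: "xs \<in> dist_lists n s" and ys: "ys \<in> dist_lists n s"
    and disj: "set xs \<inter> set ys = {}" and s: "2 * s \<le> n"
    and F: "\<And>zs. F zs \<ge> 0" and F': "\<And>zs. F' zs \<ge> 0"
  shows "(\<Sum>p | p permutes {..<n}. F (map p xs) * F' (map p ys))
      \<le> fact n * ((\<Sum>zs\<in>dist_lists n s. F zs) * (\<Sum>zs\<in>dist_lists n s. F' zs) / card (dist_lists n (2 * s)))"
proof -
  let ?A = "dist_lists n s"
  have xy: "xs @ ys \<in> dist_lists n (2 * s)"
    using xs ys disj by (auto simp: dist_lists_def)
  have len: "length xs = s" using xs by (auto simp: dist_lists_def)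
  have "(\<Sum>p | p permutes {..<n}. F (map p xs) * F' (map p ys))
      = (\<Sum>p | p permutes {..<n}. (\<lambda>zs. F (take s zs) * F' (drop s zs)) (map p (xs @ ys)))"
    using len by simp
  also have "\<dots> = fact n * ((\<Sum>zs\<in>dist_lists n (2 * s). F (take s zs) * F' (drop s zs)) / card (dist_lists n (2 * s)))"
    by (rule mean_over_permutations[OF xy s])
  also have "(\<Sum>zs\<in>dist_lists n (2 * s). F (take s zs) * F' (drop s zs))
      = (\<Sum>(u, v)\<in>(\<lambda>zs. (take s zs, drop s zs)) ` dist_lists n (2 * s). F u * F' v)"
    by (subst sum.reindex) (auto simp: inj_on_def, metis append_take_drop_id)
  also have "\<dots> \<le> (\<Sum>(u, v)\<in>?A \<times> ?A. F u * F' v)"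
    by (rule sum_mono2; (simp add: finite_cartesian_product)?)
      (auto simp: dist_lists_def F F' dest: in_set_takeD in_set_dropD)
  also have "\<dots> = (\<Sum>zs\<in>?A. F zs) * (\<Sum>zs\<in>?A. F' zs)"
    by (simp add: sum_product sum.cartesian_product)
  finally show ?thesis by (simp add: divide_right_mono mult_left_mono)
qed

text \<open>Expand the second moment over pairs of indices. Overlapping lists, at most
  \<open>K\<close> pairs, are bounded trivially by 1 each; disjoint lists are independent up to the
  factor \<open>\<kappa>\<close>, which tends to 1 as \<open>n\<close> grows.\<close>

lemma variance_over_permutations:
  fixes L :: "'j \<Rightarrow> nat list" and Ev :: "nat list set"
  assumes J: "finite J" and L: "\<And>j. j \<in> J \<Longrightarrow> L j \<in> dist_lists n s" and s: "2 * s \<le> n"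
    and K: "real (card {(j, j'). j \<in> J \<and> j' \<in> J \<and> set (L j) \<inter> set (L j') \<noteq> {}}) \<le> K"
  defines "\<mu> \<equiv> real (card J) * (card (Ev \<inter> dist_lists n s) / card (dist_lists n s))"
  defines "\<kappa> \<equiv> real (card (dist_lists n s)) ^ 2 / card (dist_lists n (2 * s))"
  shows "(\<Sum>p | p permutes {..<n}. (real (card {j \<in> J. map p (L j) \<in> Ev}) - \<mu>)\<^sup>2)
      \<le> fact n * (K + (\<kappa> - 1) * \<mu>\<^sup>2)"
proof -
  let ?P = "{p. p permutes {..<n}}" and ?D = "dist_lists n s"
  define B where "B ys = (of_bool (ys \<in> Ev) :: real)" for ys
  define M where "M p = (\<Sum>j\<in>J. B (map p (L j)))" for p
  define \<theta> where "\<theta> = real (card (Ev \<inter> ?D)) / card ?D"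
  have Mc: "real (card {j \<in> J. map p (L j) \<in> Ev}) = M p" for p
    using J by (simp add: M_def B_def sum.If_cases of_bool_def Int_def)
  have B: "0 \<le> B ys" "B ys \<le> 1" for ys by (auto simp: B_def)
  have SB: "(\<Sum>ys\<in>?D. B ys) = card (Ev \<inter> ?D)"
    by (simp add: B_def of_bool_def sum.If_cases Int_def conj_commute)
  have Dpos: "real (card ?D) > 0" using card_dist_lists_pos[of s n] s by simp
  have mu: "\<mu> = card J * \<theta>" by (simp add: \<mu>_def \<theta>_def)
  have P: "real (card ?P) = fact n" by (simp add: card_permutations)
  have "(\<Sum>p\<in>?P. M p) = (\<Sum>j\<in>J. \<Sum>p\<in>?P. B (map p (L j)))"
    unfolding M_def by (rule sum.swap)
  also have "\<dots> = (\<Sum>j\<in>J. fact n * \<theta>)"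
    using L s by (intro sum.cong refl) (simp add: mean_over_permutations[where s = s] SB \<theta>_def)
  finally have first: "(\<Sum>p\<in>?P. M p) = fact n * \<mu>" by (simp add: mu)
  define Q where "Q = {(j, j'). j \<in> J \<and> j' \<in> J \<and> set (L j) \<inter> set (L j') \<noteq> {}}"
  have Q: "Q \<subseteq> J \<times> J" by (auto simp: Q_def)
  have "(\<Sum>p\<in>?P. (M p)\<^sup>2) = (\<Sum>p\<in>?P. \<Sum>(j, j')\<in>J \<times> J. B (map p (L j)) * B (map p (L j')))"
    by (simp add: M_def power2_eq_square sum_product sum.cartesian_product)
  also have "\<dots> = (\<Sum>(j, j')\<in>J \<times> J. \<Sum>p\<in>?P. B (map p (L j)) * B (map p (L j')))"
    by (subst sum.swap) (simp add: case_prod_beta)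
  also have "\<dots> \<le> (\<Sum>x\<in>J \<times> J. (if x \<in> Q then fact n else 0) + fact n * (\<kappa> * \<theta>\<^sup>2))"
  proof (rule sum_mono, clarify)
    fix j j' assume j: "j \<in> J" "j' \<in> J"
    have \<kappa>0: "\<kappa> \<ge> 0" by (simp add: \<kappa>_def)
    show "(\<Sum>p\<in>?P. B (map p (L j)) * B (map p (L j')))
        \<le> (if (j, j') \<in> Q then fact n else 0) + fact n * (\<kappa> * \<theta>\<^sup>2)"
    proof (cases "(j, j') \<in> Q")
      case True
      have "(\<Sum>p\<in>?P. B (map p (L j)) * B (map p (L j'))) \<le> (\<Sum>p\<in>?P. 1)"
        using B by (intro sum_mono mult_le_one) auto
      also have "\<dots> = fact n" using P by simp
      finally have "(\<Sum>p\<in>?P. B (map p (L j)) * B (map p (L j'))) \<le> fact n" .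
      moreover have "0 \<le> fact n * (\<kappa> * \<theta>\<^sup>2)" using \<kappa>0 by simp
      ultimately show ?thesis using True by simp
    next
      case False
      then have "set (L j) \<inter> set (L j') = {}" using j by (auto simp: Q_def)
      from mean_product_over_permutations[where F = B and F' = B, OF L[OF j(1)] L[OF j(2)] this s B(1) B(1)]
      have "(\<Sum>p\<in>?P. B (map p (L j)) * B (map p (L j')))
        \<le> fact n * (real (card (Ev \<inter> ?D)) * real (card (Ev \<inter> ?D)) / card (dist_lists n (2 * s)))"
        by (simp add: SB)
      also have "real (card (Ev \<inter> ?D)) * real (card (Ev \<inter> ?D)) / card (dist_lists n (2 * s)) = \<kappa> * \<theta>\<^sup>2"
        using Dpos by (simp add: \<kappa>_def \<theta>_def power2_eq_square field_simps)
      finally show ?thesis using False by simp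
    qed
  qed
  also have "\<dots> = fact n * real (card Q) + (real (card J))\<^sup>2 * (fact n * (\<kappa> * \<theta>\<^sup>2))"
    using J Q by (simp add: sum.distrib sum.If_cases card_cartesian_product power2_eq_square Int_absorb1)
  also have "\<dots> \<le> fact n * K + fact n * \<kappa> * \<mu>\<^sup>2"
    using K by (simp add: Q_def mu power_mult_distrib)
  finally have second: "(\<Sum>p\<in>?P. (M p)\<^sup>2) \<le> fact n * K + fact n * \<kappa> * \<mu>\<^sup>2" .
  have "(\<Sum>p\<in>?P. (M p - \<mu>)\<^sup>2) = (\<Sum>p\<in>?P. (M p)\<^sup>2) - 2 * \<mu> * (\<Sum>p\<in>?P. M p) + fact n * \<mu>\<^sup>2"
    using P by (simp add: power2_diff sum.distrib sum_subtractf sum_distrib_left sum_distrib_right mult_ac)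
  also have "\<dots> \<le> fact n * (K + (\<kappa> - 1) * \<mu>\<^sup>2)"
    using second first by (simp add: algebra_simps power2_eq_square)
  finally show ?thesis by (simp add: Mc)
qed

section \<open>Improving all coordinates by switches\<close>

text \<open>A second-order Taylor bound: the derivative of \<open>(max 0 u)\<^sup>2\<close> is
  \<open>2 * max 0 u\<close>, which is Lipschitz with constant 2.\<close>

lemma pos_part_square_shift:
  fixes u g :: real
  shows "(max 0 (u - g))\<^sup>2 \<le> (max 0 u)\<^sup>2 - 2 * g * max 0 u + g\<^sup>2"
proof (cases "u \<ge> 0")
  case True
  have "(max 0 (u - g))\<^sup>2 \<le> (u - g)\<^sup>2" by (simp add: max_def)
  then show ?thesis using True by (simp add: power2_diff algebra_simps)
next
  case False
  then have "max 0 (u - g) \<le> \<bar>g\<bar>" by auto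
  then have "(max 0 (u - g))\<^sup>2 \<le> \<bar>g\<bar>\<^sup>2" by (intro power_mono) auto
  then show ?thesis using False by simp
qed

text \<open>A discrete minimax argument. In \<open>gain\<close> the best set of exchanges may depend
  on \<open>w\<close>; the conclusion asks for one set good in every coordinate. The minimiser of
  the penalty is almost the best set for its own gradient, so applying \<open>gain\<close> to that
  gradient alone is enough. The condition \<open>big\<close> absorbs the second-order costs of all
  toggles.\<close>

lemma switching_all_coordinates:
  fixes X0 :: "'i \<Rightarrow> real" and G :: "'j \<Rightarrow> 'i \<Rightarrow> real"
  assumes I: "finite I" and J: "finite J" and D: "D > 0"
    and G: "\<And>j i. j \<in> J \<Longrightarrow> i \<in> I \<Longrightarrow> \<bar>G j i\<bar> \<le> B"
    and gain: "\<And>w. (\<And>i. i \<in> I \<Longrightarrow> w i \<ge> 0) \<Longrightarrow>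
      2 * D * (\<Sum>i\<in>I. w i) \<le> (\<Sum>i\<in>I. w i * X0 i) + (\<Sum>j\<in>J. max 0 (\<Sum>i\<in>I. w i * G j i))"
    and big: "2 * real (card J) * real (card I) * B\<^sup>2 < D\<^sup>2"
  shows "\<exists>S\<subseteq>J. \<forall>i\<in>I. X0 i + (\<Sum>j\<in>S. G j i) \<ge> D"
proof (rule ccontr)
  assume neg: "\<not> ?thesis"
  define X where "X S i = X0 i + (\<Sum>j\<in>S. G j i)" for S i
  \<comment> \<open>Midway between the target \<open>D\<close> and the available
    \<open>2 * D\<close>: a coordinate below \<open>D\<close> then has weight at least
    \<open>D / 2\<close>, while the available gain still exceeds \<open>Y * W\<close> by
    \<open>D * W / 2\<close>.\<close>
  define Y where "Y = 3 * D / 2"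
  define \<Phi> where "\<Phi> S = (\<Sum>i\<in>I. (max 0 (Y - X S i))\<^sup>2)" for S
  define S where "S = arg_min_on \<Phi> (Pow J)"
  have S: "S \<subseteq> J" and Smin: "\<And>S'. S' \<subseteq> J \<Longrightarrow> \<Phi> S \<le> \<Phi> S'"
    using arg_min_if_finite(1)[of "Pow J" \<Phi>] arg_min_least[of "Pow J" _ \<Phi>] J by (auto simp: S_def)
  \<comment> \<open>Up to a factor \<open>-2\<close>, \<open>w\<close> is the gradient of the penalty at \<open>X S\<close>. By minimality no toggle gains
    more than a constant in direction \<open>w\<close>, whereas \<open>gain\<close> forces a linear gain.\<close>
  define w where "w i = max 0 (Y - X S i)" for i
  define W where "W = (\<Sum>i\<in>I. w i)"
  define g where "g j = (\<Sum>i\<in>I. w i * G j i)" for j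
  \<comment> \<open>Twice \<open>b\<close> bounds the quadratic cost of one toggle, summed over the
    coordinates.\<close>
  define b where "b = real (card I) * B\<^sup>2 / 2"
  have step: "s * g j \<le> b"
    if "S' \<subseteq> J" "\<And>i. i \<in> I \<Longrightarrow> X S' i = X S i + s * G j i" "j \<in> J" "\<bar>s\<bar> = 1" for s S' j
  proof -
    have "\<Phi> S' = (\<Sum>i\<in>I. (max 0 ((Y - X S i) - s * G j i))\<^sup>2)"
      using that(2) by (auto simp: \<Phi>_def algebra_simps intro!: sum.cong)
    also have "\<dots> \<le> (\<Sum>i\<in>I. (max 0 (Y - X S i))\<^sup>2 - 2 * (s * G j i) * max 0 (Y - X S i) + (s * G j i)\<^sup>2)"
      by (intro sum_mono pos_part_square_shift)
    also have "\<dots> \<le> (\<Sum>i\<in>I. (max 0 (Y - X S i))\<^sup>2 - 2 * s * (w i * G j i) + B\<^sup>2)"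
    proof (rule sum_mono)
      fix i assume "i \<in> I"
      then have "\<bar>s * G j i\<bar> \<le> B" using G[OF that(3)] that(4) by (simp add: abs_mult)
      then have "(s * G j i)\<^sup>2 \<le> B\<^sup>2" by (metis abs_ge_zero power2_abs power_mono)
      then show "(max 0 (Y - X S i))\<^sup>2 - 2 * (s * G j i) * max 0 (Y - X S i) + (s * G j i)\<^sup>2
          \<le> (max 0 (Y - X S i))\<^sup>2 - 2 * s * (w i * G j i) + B\<^sup>2"
        by (simp add: w_def mult_ac)
    qed
    also have "\<dots> = \<Phi> S - 2 * s * g j + 2 * b"
      by (simp add: \<Phi>_def g_def b_def sum.distrib sum_subtractf sum_distrib_left)
    finally show ?thesis using Smin[OF that(1)] by simp
  qed
  have fS: "finite S" using S J finite_subset by auto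
  have inS: "- g j \<le> b" if "j \<in> S" for j
    using step[of "S - {j}" "-1" j] that S fS by (auto simp: X_def sum_diff1)
  have notinS: "g j \<le> b" if "j \<in> J - S" for j
    using step[of "insert j S" 1 j] that S fS by (auto simp: X_def)
  have b0: "b \<ge> 0" by (simp add: b_def)
  \<comment> \<open>Compare \<open>S\<close> with the greedy set of all \<open>j\<close> with
    \<open>g j > 0\<close>: a chosen index loses at most \<open>b\<close>, an omitted one misses at
    most \<open>b\<close>.\<close>
  have "(\<Sum>j\<in>J. max 0 (g j)) - (\<Sum>j\<in>S. g j) = (\<Sum>j\<in>J. max 0 (g j) - (if j \<in> S then g j else 0))"
    using J S by (simp add: sum_subtractf sum.If_cases Int_absorb1)
  also have "\<dots> \<le> (\<Sum>j\<in>J. b)"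
    using inS notinS b0 by (intro sum_mono) (force simp: max_def)
  finally have A: "(\<Sum>j\<in>J. max 0 (g j)) \<le> (\<Sum>j\<in>S. g j) + card J * b" by simp
  have B: "(\<Sum>i\<in>I. w i * X S i) = (\<Sum>i\<in>I. w i * X0 i) + (\<Sum>j\<in>S. g j)"
    by (simp add: X_def g_def distrib_left sum.distrib sum_distrib_left sum.swap[of _ I S])
  have "(\<Sum>i\<in>I. w i * X S i) \<le> (\<Sum>i\<in>I. w i * Y)"
  proof (rule sum_mono)
    fix i
    show "w i * X S i \<le> w i * Y"
    proof (cases "X S i \<le> Y")
      case True
      then show ?thesis by (rule mult_left_mono) (simp add: w_def)
    next
      case False
      then show ?thesis by (simp add: w_def)
    qed
  qed
  also have "\<dots> = Y * W" by (simp add: W_def sum_distrib_left mult.commute)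
  finally have C: "(\<Sum>i\<in>I. w i * X S i) \<le> Y * W" .
  have "2 * D * W \<le> (\<Sum>i\<in>I. w i * X0 i) + (\<Sum>j\<in>J. max 0 (g j))"
    unfolding W_def g_def by (rule gain) (simp add: w_def)
  then have "2 * D * W \<le> Y * W + card J * b" using A B C by linarith
  then have E: "D * W \<le> 2 * (card J * b)" by (simp add: Y_def)
  have "\<not> (\<forall>i\<in>I. X0 i + (\<Sum>j\<in>S. G j i) \<ge> D)" using neg S by blast
  then obtain i where "i \<in> I" "\<not> X S i \<ge> D" unfolding X_def by blast
  then have i: "i \<in> I" "X S i < D" by simp_all
  have "D / 2 \<le> w i" using i D by (simp add: w_def Y_def)
  also have "\<dots> \<le> W" unfolding W_def by (rule member_le_sum) (auto simp: I i w_def)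
  finally have "D * (D / 2) \<le> D * W" using D by simp
  with E have "D\<^sup>2 \<le> 2 * real (card J) * real (card I) * B\<^sup>2"
    by (simp add: b_def power2_eq_square field_simps)
  with big show False by simp
qed

section \<open>Alternating sums\<close>

text \<open>The mixed second difference of \<open>h\<close> on \<open>{a, d}\<close> and
  \<open>{z, z'}\<close>. It vanishes identically exactly when \<open>h\<close> is a function of the
  first argument plus a function of the second.\<close>

definition alternating :: "('a \<Rightarrow> 'a \<Rightarrow> int) \<Rightarrow> 'a \<Rightarrow> 'a \<Rightarrow> 'a \<Rightarrow> 'a \<Rightarrow> int" where
  "alternating h a d z z' = h d z - h a z + h a z' - h d z'"

lemma exists_le_average:
  fixes f :: "'a \<Rightarrow> real" and c :: real
  assumes "finite A" "A \<noteq> {}" "(\<Sum>x\<in>A. f x) \<le> c * card A"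
  shows "\<exists>x\<in>A. f x \<le> c"
proof (rule ccontr)
  assume "\<not> ?thesis"
  then have "(\<Sum>x\<in>A. c) < (\<Sum>x\<in>A. f x)"
    using assms by (intro sum_strict_mono) auto
  with assms show False by (simp add: mult.commute)
qed

text \<open>By averaging, some \<open>a\<close> and \<open>z'\<close> leave few bad pairs
  \<open>(d, z)\<close>, and for the good ones \<open>h d z = h d z' + (h a z - h a z')\<close> is a
  sum \<open>A d + B z\<close>. A second average finds \<open>d0\<close> with few bad pairs in both
  its row and its column; symmetry through \<open>d0\<close> identifies \<open>B\<close> with
  \<open>A\<close> up to a constant. The bad pairs of the first step cost \<open>\<beta>\<close> and
  those of \<open>d0\<close> cost \<open>2 * \<beta>\<close>.\<close>

lemma additive_approximation:
  fixes h :: "nat \<Rightarrow> nat \<Rightarrow> int" and \<beta> :: real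
  assumes n: "n > 0" and sym: "\<And>x y. h x y = h y x"
    and bad: "card {(a, d, z, z'). a < n \<and> d < n \<and> z < n \<and> z' < n \<and> alternating h a d z z' \<noteq> 0}
      \<le> \<beta> * real n ^ 4"
  obtains q b where "\<And>x. odd (q x :: int) = b"
    "card {(x, y). x < n \<and> y < n \<and> 2 * h x y \<noteq> q x + q y} \<le> 3 * \<beta> * (real n)\<^sup>2"
proof -
  let ?N = "{..<n}"
  define R where "R = (\<lambda>(a, z'). {(d, z). d < n \<and> z < n \<and> alternating h a d z z' \<noteq> 0})"
  have finR: "finite (R u)" for u
    by (rule finite_subset[of _ "?N \<times> ?N"]) (auto simp: R_def split: prod.splits)
  have "card (Sigma (?N \<times> ?N) R)
      = card ((\<lambda>((a, z'), (d, z)). (a, d, z, z')) ` Sigma (?N \<times> ?N) R)"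
    by (rule card_image[symmetric]) (auto simp: inj_on_def)
  also have "(\<lambda>((a, z'), (d, z)). (a, d, z, z')) ` Sigma (?N \<times> ?N) R
      = {(a, d, z, z'). a < n \<and> d < n \<and> z < n \<and> z' < n \<and> alternating h a d z z' \<noteq> 0}"
    by (auto simp: R_def image_iff)
  finally have "real (card (Sigma (?N \<times> ?N) R)) \<le> \<beta> * real n ^ 4" using bad by simp
  then have "(\<Sum>u\<in>?N \<times> ?N. real (card (R u))) \<le> \<beta> * (real n)\<^sup>2 * card (?N \<times> ?N)"
    using finR by (simp add: card_SigmaI card_cartesian_product power2_eq_square power4_eq_xxxx mult_ac)
  from exists_le_average[OF _ _ this] n obtain a z'
    where az: "a < n" "z' < n" and Raz: "card (R (a, z')) \<le> \<beta> * (real n)\<^sup>2"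
    by auto
  define R1 where "R1 = R (a, z')"
  define A where "A d = h d z'" for d
  define B where "B z = h a z - h a z'" for z
  have AB: "h d z = A d + B z" if "d < n" "z < n" "(d, z) \<notin> R1" for d z
    using that by (auto simp: R1_def R_def A_def B_def alternating_def)
  have R1N: "R1 \<subseteq> ?N \<times> ?N" by (auto simp: R1_def R_def)
  have finR1: "finite R1" using finR by (simp add: R1_def)
  have row: "(\<Sum>d\<in>?N. real (card {z \<in> ?N. (d, z) \<in> R1})) = card R1"
  proof -
    have "Sigma ?N (\<lambda>d. {z \<in> ?N. (d, z) \<in> R1}) = R1" using R1N by auto
    then show ?thesis using card_SigmaI[of ?N "\<lambda>d. {z \<in> ?N. (d, z) \<in> R1}"] by (simp flip: of_nat_sum)
  qed
  have col: "(\<Sum>d\<in>?N. real (card {z \<in> ?N. (z, d) \<in> R1})) = card R1"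
  proof -
    have "card (Sigma ?N (\<lambda>d. {z \<in> ?N. (z, d) \<in> R1})) = card (prod.swap ` Sigma ?N (\<lambda>d. {z \<in> ?N. (z, d) \<in> R1}))"
      by (simp add: card_image)
    also have "prod.swap ` Sigma ?N (\<lambda>d. {z \<in> ?N. (z, d) \<in> R1}) = R1" using R1N by (auto simp: image_iff)
    finally show ?thesis using card_SigmaI[of ?N "\<lambda>d. {z \<in> ?N. (z, d) \<in> R1}"] by (simp flip: of_nat_sum)
  qed
  have "(\<Sum>d\<in>?N. real (card {z \<in> ?N. (d, z) \<in> R1}) + card {z \<in> ?N. (z, d) \<in> R1}) \<le> (2 * \<beta> * real n) * card ?N"
    using row col Raz by (simp add: sum.distrib R1_def power2_eq_square)
  from exists_le_average[OF _ _ this] n obtain d0 where d0: "d0 < n"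
    and d0c: "real (card {z \<in> ?N. (d0, z) \<in> R1}) + card {z \<in> ?N. (z, d0) \<in> R1} \<le> 2 * \<beta> * real n"
    by auto
  define Z where "Z = {z \<in> ?N. (d0, z) \<in> R1} \<union> {z \<in> ?N. (z, d0) \<in> R1}"
  have "card Z \<le> card {z \<in> ?N. (d0, z) \<in> R1} + card {z \<in> ?N. (z, d0) \<in> R1}"
    unfolding Z_def by (rule card_Un_le)
  then have Zc: "card Z \<le> 2 * \<beta> * real n" using d0c by linarith
  \<comment> \<open>Symmetry of \<open>h\<close> makes \<open>B - A\<close> almost constant.\<close>
  define K where "K = B d0 - A d0"
  have BA: "B z = A z + K" if "z < n" "z \<notin> Z" for z
    using AB[of d0 z] AB[of z d0] sym[of d0 z] that d0 by (auto simp: Z_def K_def)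
  \<comment> \<open>Doubling replaces the shift \<open>K / 2\<close> by an integer, and all values
    of \<open>q\<close> inherit the parity of \<open>K\<close>.\<close>
  define q where "q x = 2 * A x + K" for x
  have "{(x, y). x < n \<and> y < n \<and> 2 * h x y \<noteq> q x + q y} \<subseteq> R1 \<union> ?N \<times> Z"
    using AB BA by (force simp: q_def)
  then have "card {(x, y). x < n \<and> y < n \<and> 2 * h x y \<noteq> q x + q y} \<le> card (R1 \<union> ?N \<times> Z)"
    using finR1 by (intro card_mono) (auto simp: Z_def)
  also have "\<dots> \<le> card R1 + n * card Z"
    using card_Un_le[of R1 "?N \<times> Z"] by (simp add: card_cartesian_product)
  also have "real \<dots> \<le> \<beta> * (real n)\<^sup>2 + real n * (2 * \<beta> * real n)"
    using Raz Zc by (auto simp: R1_def intro!: add_mono mult_left_mono)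
  also have "\<dots> = 3 * \<beta> * (real n)\<^sup>2" by (simp add: power2_eq_square)
  finally have "card {(x, y). x < n \<and> y < n \<and> 2 * h x y \<noteq> q x + q y} \<le> 3 * \<beta> * (real n)\<^sup>2" by simp
  moreover have "odd (q x) = odd K" for x by (simp add: q_def)
  ultimately show ?thesis using that by blast
qed

text \<open>Since \<open>2 * h x y\<close> lies between -2 and 2, two vertices with
  \<open>q \<ge> 1\<close> almost always have \<open>h = 1\<close>, and two with
  \<open>q \<le> -1\<close> almost always have \<open>h = -1\<close>. Even parity contradicts
  \<open>low\<close>. The bounds \<open>pos\<close> and \<open>neg\<close> stop either class from
  being nearly everything. Between the classes \<open>h\<close> is almost always 0, so the sum of
  \<open>h\<close> is close to the difference of the squared class sizes.\<close>

lemma two_clique_structure: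
  fixes h :: "nat \<Rightarrow> nat \<Rightarrow> int" and \<beta> \<tau> :: real
  assumes n: "n > 0" and sym: "\<And>x y. h x y = h y x" and range: "\<And>x y. h x y \<in> {-1, 0, 1}"
    and bad: "card {(a, d, z, z'). a < n \<and> d < n \<and> z < n \<and> z' < n \<and> alternating h a d z z' \<noteq> 0}
      \<le> \<beta> * real n ^ 4"
    and pos: "card {(x, y). x < n \<and> y < n \<and> h x y = 1} \<le> (real n)\<^sup>2 / 2"
    and neg: "card {(x, y). x < n \<and> y < n \<and> h x y = -1} \<le> (real n)\<^sup>2 / 2"
    and low: "\<tau> * (real n)\<^sup>2 \<le> card {(x, y). x < n \<and> y < n \<and> h x y = 1}"
    and lam: "0 < \<tau>" "\<tau> \<le> 1" and beta: "3 * \<beta> < \<tau>\<^sup>2 / 16"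
  obtains V1 V2 where "V1 \<union> V2 = {..<n}" "V1 \<inter> V2 = {}" "real n \<le> 4 * card V1" "real n \<le> 4 * card V2"
    "card {(x, y). x \<in> V1 \<and> y \<in> V1 \<and> h x y \<noteq> 1} \<le> 3 * \<beta> * (real n)\<^sup>2"
    "card {(x, y). x \<in> V2 \<and> y \<in> V2 \<and> h x y \<noteq> -1} \<le> 3 * \<beta> * (real n)\<^sup>2"
    "\<bar>real (card V1) - card V2\<bar> * n \<le> \<bar>\<Sum>x<n. \<Sum>y<n. h x y\<bar> + 30 * \<beta> * (real n)\<^sup>2"
proof -
  let ?N = "{..<n}"
  obtain q b where qb: "\<And>x. odd (q x :: int) = b"
    and qbad: "card {(x, y). x < n \<and> y < n \<and> 2 * h x y \<noteq> q x + q y} \<le> 3 * \<beta> * (real n)\<^sup>2"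
    by (rule additive_approximation[OF n sym bad]) (rule that)
  define X where "X = {(x, y). x < n \<and> y < n \<and> 2 * h x y \<noteq> q x + q y}"
  have finX: "finite X" by (rule finite_subset[of _ "?N \<times> ?N"]) (auto simp: X_def)
  have Xc: "card X \<le> 3 * \<beta> * (real n)\<^sup>2" using qbad by (simp add: X_def)
  have hb: "-1 \<le> h x y" "h x y \<le> 1" for x y using range[of x y] by auto
  have n2: "(real n)\<^sup>2 > 0" using n by simp
  have lam2: "\<tau>\<^sup>2 \<le> \<tau>" using lam by (simp add: power2_eq_square mult_left_le)
  have Xc16: "card X < \<tau> / 16 * (real n)\<^sup>2"
    using Xc beta lam2 mult_strict_right_mono[OF _ n2, of "3 * \<beta>" "\<tau> / 16"] by linarith
  have Xc16': "card X < (real n)\<^sup>2 / 16"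
    using Xc16 mult_right_mono[OF lam(2) less_imp_le[OF n2]] by simp
  have sub: "real (card A * card B) \<le> card X" if "A \<times> B \<subseteq> X" for A B
    using card_mono[OF finX that] by (simp add: card_cartesian_product flip: of_nat_mult)
  show ?thesis
  proof (cases b)
    case False
    \<comment> \<open>In the even case \<open>h x y = 1\<close> on a good pair means
      \<open>q x + q y = 2\<close>, so one endpoint lies in \<open>P\<close>. But two members of
      \<open>P\<close> would need \<open>h \<ge> 2\<close>, so \<open>P\<close> is small and value 1
      is too rare.\<close>
    define P where "P = {x \<in> ?N. q x \<ge> 2}"
    have ev: "even (q x)" for x using qb False by auto
    have "P \<times> P \<subseteq> X"
    proof clarify
      fix x y assume "x \<in> P" "y \<in> P"
      then show "(x, y) \<in> X" using hb(2)[of x y] by (auto simp: P_def X_def)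
    qed
    then have "(real (card P))\<^sup>2 \<le> card X" using sub[of P P] by (simp add: power2_eq_square)
    also have "\<dots> < (\<tau> / 4 * real n)\<^sup>2"
      using Xc mult_strict_right_mono[OF beta n2] by (simp add: power_mult_distrib power_divide)
    finally have "(real (card P))\<^sup>2 < (\<tau> / 4 * real n)\<^sup>2" .
    then have Pc: "card P < \<tau> / 4 * real n"
      by (rule power_less_imp_less_base) (use lam in simp)
    have "{(x, y). x < n \<and> y < n \<and> h x y = 1} \<subseteq> X \<union> (P \<times> ?N \<union> ?N \<times> P)"
    proof (rule subsetI, rule ccontr)
      fix u assume u: "u \<in> {(x, y). x < n \<and> y < n \<and> h x y = 1}" "u \<notin> X \<union> (P \<times> ?N \<union> ?N \<times> P)"
      obtain x y where xy: "u = (x, y)" by fastforce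
      have lt: "x < n" "y < n" "h x y = 1" using u xy by auto
      then have "q x < 2" "q y < 2" using u(2) xy unfolding P_def by force+
      then have "q x \<le> 0" "q y \<le> 0" using ev[of x] ev[of y] by presburger+
      then have "(x, y) \<in> X" using lt unfolding X_def by simp
      then show False using u(2) xy by blast
    qed
    then have "card {(x, y). x < n \<and> y < n \<and> h x y = 1} \<le> card (X \<union> (P \<times> ?N \<union> ?N \<times> P))"
      using finX by (intro card_mono) (auto simp: P_def)
    also have "\<dots> \<le> card X + (card P * n + n * card P)"
      using card_Un_le[of X "P \<times> ?N \<union> ?N \<times> P"] card_Un_le[of "P \<times> ?N" "?N \<times> P"]
      by (simp add: card_cartesian_product)
    finally have "card {(x, y). x < n \<and> y < n \<and> h x y = 1} \<le> card X + 2 * (real (card P) * n)"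
      by (simp add: algebra_simps flip: of_nat_mult of_nat_add)
    also have "\<dots> \<le> \<tau> / 16 * (real n)\<^sup>2 + 2 * (\<tau> / 4 * real n * n)"
      using Xc16 Pc by (intro add_mono mult_left_mono mult_right_mono) auto
    also have "\<dots> < \<tau> * (real n)\<^sup>2" using n2 lam by (simp add: power2_eq_square)
    finally show ?thesis using low by simp
  next
    case True
    then have od: "odd (q x)" for x using qb by auto
    then have q0: "q x \<noteq> 0" for x by (metis dvd_0_right)
    define V1 where "V1 = {x \<in> ?N. q x \<ge> 1}"
    define V2 where "V2 = {x \<in> ?N. q x \<le> -1}"
    \<comment> \<open>Vertices with \<open>q\<close> beyond 1 in absolute value. Any pair of one of
      them with a vertex of its own class is bad, so they are few; away from them a cross pair has
      \<open>q x + q y = 0\<close>.\<close>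
    define R1 where "R1 = {x \<in> ?N. q x \<ge> 2}"
    define R2 where "R2 = {x \<in> ?N. q x \<le> -2}"
    note Vdefs = V1_def V2_def R1_def R2_def
    have fin: "finite V1" "finite V2" "finite R1" "finite R2" by (auto simp: Vdefs)
    have "q x \<ge> 1 \<or> q x \<le> -1" for x using q0[of x] by linarith
    then have un: "V1 \<union> V2 = ?N" by (auto simp: Vdefs)
    have dj: "V1 \<inter> V2 = {}" by (auto simp: Vdefs)
    have cV: "real (card V1) + card V2 = n"
      using card_Un_disjoint[OF fin(1,2) dj] un by simp
    have i1: "h x y = 1 \<or> (x, y) \<in> X" if "x \<in> V1" "y \<in> V1" for x y
      using that hb[of x y] by (auto simp: Vdefs X_def)
    have i2: "h x y = -1 \<or> (x, y) \<in> X" if "x \<in> V2" "y \<in> V2" for x y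
      using that hb[of x y] by (auto simp: Vdefs X_def)
    have i3: "R1 \<times> V1 \<subseteq> X"
    proof clarify
      fix x y assume "x \<in> R1" "y \<in> V1"
      then show "(x, y) \<in> X" using hb(2)[of x y] by (auto simp: Vdefs X_def)
    qed
    have i4: "R2 \<times> V2 \<subseteq> X"
    proof clarify
      fix x y assume "x \<in> R2" "y \<in> V2"
      then show "(x, y) \<in> X" using hb(1)[of x y] by (auto simp: Vdefs X_def)
    qed
    have c1: "card {(x, y). x \<in> V1 \<and> y \<in> V1 \<and> h x y \<noteq> 1} \<le> card X"
      using i1 by (intro card_mono finX) auto
    have c2: "card {(x, y). x \<in> V2 \<and> y \<in> V2 \<and> h x y \<noteq> -1} \<le> card X"
      using i2 by (intro card_mono finX) auto
    \<comment> \<open>The threshold comes from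
      \<open>1 / 16 + 1 / 2 = (3 / 4)\<^sup>2\<close>.\<close>
    have small: "card V < 3 / 4 * real n"
      if "V \<times> V \<subseteq> X \<union> U" "finite U" "card U \<le> (real n)\<^sup>2 / 2" for V :: "nat set" and U
    proof -
      have "real (card V * card V) \<le> card (X \<union> U)"
        using card_mono[OF _ that(1)] finX that(2) by (simp add: card_cartesian_product del: of_nat_mult)
      also have "\<dots> \<le> real (card X) + card U" using card_Un_le[of X U] by linarith
      also have "\<dots> < (3 / 4 * real n)\<^sup>2"
        using Xc16' that(3) by (simp add: power2_eq_square)
      finally have "(real (card V))\<^sup>2 < (3 / 4 * real n)\<^sup>2" by (simp add: power2_eq_square)
      then show ?thesis by (rule power_less_imp_less_base) simp
    qed
    have s1: "card V1 < 3 / 4 * real n"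
      by (rule small[OF _ _ pos]) (use i1 in \<open>auto simp: Vdefs intro: finite_subset[of _ "?N \<times> ?N"]\<close>)
    have s2: "card V2 < 3 / 4 * real n"
      by (rule small[OF _ _ neg]) (use i2 in \<open>auto simp: Vdefs intro: finite_subset[of _ "?N \<times> ?N"]\<close>)
    have l1: "real n \<le> 4 * card V1" and l2: "real n \<le> 4 * card V2" using s1 s2 cV by auto
    have r: "card R * real n \<le> 4 * card X" if "R \<times> V \<subseteq> X" "real n \<le> 4 * card V" for R V :: "nat set"
    proof -
      have "card R * real n \<le> card R * (4 * real (card V))" using that by (intro mult_left_mono) auto
      also have "\<dots> \<le> 4 * card X" using sub[OF that(1)] by simp
      finally show ?thesis .
    qed
    have r1: "card R1 * real n \<le> 4 * card X" and r2: "card R2 * real n \<le> 4 * card X"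
      using r[OF i3 l1] r[OF i4 l2] by auto
    define S where "S A B = (\<Sum>(x, y)\<in>A \<times> B. h x y)" for A B
    have tot: "(\<Sum>x<n. \<Sum>y<n. h x y) = S V1 V1 + S V2 V2 + (S V1 V2 + S V2 V1)"
    proof -
      have "(\<Sum>x<n. \<Sum>y<n. h x y) = (\<Sum>x\<in>V1 \<union> V2. \<Sum>y\<in>V1 \<union> V2. h x y)" by (simp add: un)
      then show ?thesis using fin dj
        by (simp add: sum.union_disjoint S_def sum.cartesian_product[symmetric] sum.distrib algebra_simps)
    qed
    have near: "\<bar>S A B - k * int (card A * card B)\<bar> \<le> 2 * card Y"
      if "finite A" "finite B" "\<And>x y. x \<in> A \<Longrightarrow> y \<in> B \<Longrightarrow> h x y = k \<or> (x, y) \<in> Y" "finite Y" "\<bar>k\<bar> \<le> 1"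
      for A B Y k
    proof -
      have "S A B - k * int (card A * card B) = (\<Sum>(x, y)\<in>A \<times> B. h x y - k)"
        by (simp add: S_def case_prod_beta sum_subtractf card_cartesian_product)
      also have "\<bar>\<dots>\<bar> \<le> (\<Sum>(x, y)\<in>A \<times> B. \<bar>h x y - k\<bar>)"
        by (simp add: case_prod_beta sum_abs)
      also have "\<dots> \<le> (\<Sum>u\<in>A \<times> B. if u \<in> Y then 2 else 0)"
      proof (rule sum_mono, clarify)
        fix x y assume "x \<in> A" "y \<in> B"
        with that(3)[of x y] hb[of x y] that(5)
        show "\<bar>h x y - k\<bar> \<le> (if (x, y) \<in> Y then 2 else 0)" by auto
      qed
      also have "\<dots> = 2 * int (card ((A \<times> B) \<inter> Y))"
        using that(1,2) by (simp add: sum.If_cases)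
      also have "\<dots> \<le> 2 * card Y" using that(4) by (auto intro: card_mono)
      finally show ?thesis .
    qed
    have n1: "\<bar>S V1 V1 - int (card V1 * card V1)\<bar> \<le> 2 * card (X \<inter> V1 \<times> V1)"
      using near[of V1 V1 1 "X \<inter> V1 \<times> V1"] i1 fin finX by simp
    have n2': "\<bar>S V2 V2 + int (card V2 * card V2)\<bar> \<le> 2 * card (X \<inter> V2 \<times> V2)"
      using near[of V2 V2 "-1" "X \<inter> V2 \<times> V2"] i2 fin finX by simp
    have n3: "\<bar>\<Sum>(x, y)\<in>V1 \<times> V2 \<union> V2 \<times> V1. h x y\<bar>
        \<le> card (X \<inter> (V1 \<times> V2 \<union> V2 \<times> V1)) + 2 * (card R1 * card V2 + card R2 * card V1)"
    proof -
      let ?C = "V1 \<times> V2 \<union> V2 \<times> V1" let ?Y = "(R1 \<times> V2 \<union> V2 \<times> R1) \<union> (R2 \<times> V1 \<union> V1 \<times> R2)"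
      have "\<bar>\<Sum>(x, y)\<in>?C. h x y\<bar> \<le> (\<Sum>(x, y)\<in>?C. \<bar>h x y\<bar>)"
        by (simp add: case_prod_beta sum_abs)
      also have "\<dots> \<le> (\<Sum>u\<in>?C. if u \<in> X \<union> ?Y then 1 else 0)"
      proof (rule sum_mono)
        fix u assume u: "u \<in> ?C"
        obtain x y where xy: "u = (x, y)" by fastforce
        have "h x y = 0" if "(x, y) \<notin> X \<union> ?Y"
        proof -
          from u xy consider "x \<in> V1" "y \<in> V2" | "x \<in> V2" "y \<in> V1" by auto
          then have "q x + q y = 0"
          proof cases
            case 1
            with that have "q x = 1" "q y = -1" by (auto simp: Vdefs)
            then show ?thesis by simp
          next
            case 2
            with that have "q x = -1" "q y = 1" by (auto simp: Vdefs)
            then show ?thesis by simp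
          qed
          moreover have "x < n" "y < n" using u xy by (auto simp: Vdefs)
          ultimately show ?thesis using that by (auto simp: X_def)
        qed
        with xy hb[of x y] show "(case u of (x, y) \<Rightarrow> \<bar>h x y\<bar>) \<le> (if u \<in> X \<union> ?Y then 1 else 0)"
          by auto
      qed
      also have "\<dots> = int (card (?C \<inter> (X \<union> ?Y)))"
        using fin by (simp add: sum.If_cases del: Un_iff)
      also have "card (?C \<inter> (X \<union> ?Y)) \<le> card (X \<inter> ?C \<union> ?Y)"
        using fin finX by (intro card_mono) auto
      also have "\<dots> \<le> card (X \<inter> ?C) + card ?Y" by (rule card_Un_le)
      also have "card ?Y \<le> 2 * (card R1 * card V2 + card R2 * card V1)"
        using card_Un_le[of "R1 \<times> V2 \<union> V2 \<times> R1" "R2 \<times> V1 \<union> V1 \<times> R2"]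
          card_Un_le[of "R1 \<times> V2" "V2 \<times> R1"] card_Un_le[of "R2 \<times> V1" "V1 \<times> R2"]
        by (simp add: card_cartesian_product algebra_simps)
      finally show ?thesis by simp
    qed
    have cross: "S V1 V2 + S V2 V1 = (\<Sum>(x, y)\<in>V1 \<times> V2 \<union> V2 \<times> V1. h x y)"
      unfolding S_def using fin dj by (subst sum.union_disjoint) auto
    have split: "card (X \<inter> V1 \<times> V1) + card (X \<inter> V2 \<times> V2) + card (X \<inter> (V1 \<times> V2 \<union> V2 \<times> V1)) \<le> card X"
    proof -
      have "card (X \<inter> V1 \<times> V1 \<union> X \<inter> V2 \<times> V2) = card (X \<inter> V1 \<times> V1) + card (X \<inter> V2 \<times> V2)"
        using finX dj by (intro card_Un_disjoint) auto
      moreover have "card ((X \<inter> V1 \<times> V1 \<union> X \<inter> V2 \<times> V2) \<union> X \<inter> (V1 \<times> V2 \<union> V2 \<times> V1))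
          = card (X \<inter> V1 \<times> V1 \<union> X \<inter> V2 \<times> V2) + card (X \<inter> (V1 \<times> V2 \<union> V2 \<times> V1))"
        using finX dj by (intro card_Un_disjoint) auto
      moreover have "card ((X \<inter> V1 \<times> V1 \<union> X \<inter> V2 \<times> V2) \<union> X \<inter> (V1 \<times> V2 \<union> V2 \<times> V1)) \<le> card X"
        using finX by (intro card_mono) auto
      ultimately show ?thesis by linarith
    qed
    have rv: "real (card R1 * card V2 + card R2 * card V1) \<le> 4 * card X"
    proof -
      have "real (card R1 * card V2 + card R2 * card V1) * real n
          = (card R1 * real n) * card V2 + (card R2 * real n) * card V1" by (simp add: algebra_simps)
      also have "\<dots> \<le> (4 * real (card X)) * card V2 + (4 * real (card X)) * card V1"
        using r1 r2 by (intro add_mono mult_right_mono) auto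
      also have "\<dots> = 4 * real (card X) * (real (card V1) + card V2)" by (simp add: algebra_simps)
      finally show ?thesis using n cV by simp
    qed
    \<comment> \<open>As the sizes add up to \<open>n\<close>, the difference times \<open>n\<close>
      is the difference of squares. Bad pairs cost \<open>2 * card X\<close> and large values of
      \<open>q\<close> cost \<open>8 * card X\<close>; with \<open>card X\<close> at most
      \<open>3 * \<beta> * n\<^sup>2\<close> this is
      \<open>30 * \<beta> * n\<^sup>2\<close>.\<close>
    have "\<bar>real (card V1) - card V2\<bar> * n = \<bar>(real (card V1) - card V2) * (real (card V1) + card V2)\<bar>"
      using cV by (simp add: abs_mult)
    also have "\<dots> = \<bar>real (card V1 * card V1) - real (card V2 * card V2)\<bar>"
      by (simp add: algebra_simps)
    also have "\<dots> = of_int \<bar>int (card V1 * card V1) - int (card V2 * card V2)\<bar>" by simp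
    also have "\<bar>int (card V1 * card V1) - int (card V2 * card V2)\<bar>
        \<le> \<bar>\<Sum>x<n. \<Sum>y<n. h x y\<bar> + 2 * card X + 2 * int (card R1 * card V2 + card R2 * card V1)"
      using n1 n2' n3 tot cross split by linarith
    also have "real_of_int (\<bar>\<Sum>x<n. \<Sum>y<n. h x y\<bar> + 2 * card X + 2 * int (card R1 * card V2 + card R2 * card V1))
        = real_of_int \<bar>\<Sum>x<n. \<Sum>y<n. h x y\<bar> + 2 * card X + 2 * real (card R1 * card V2 + card R2 * card V1)"
      by simp
    also have "\<dots> \<le> real_of_int \<bar>\<Sum>x<n. \<Sum>y<n. h x y\<bar> + 10 * card X"
      using rv by simp
    also have "\<dots> \<le> \<bar>\<Sum>x<n. \<Sum>y<n. h x y\<bar> + 30 * \<beta> * (real n)\<^sup>2" using Xc by simp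
    finally have "\<bar>real (card V1) - card V2\<bar> * n \<le> \<bar>\<Sum>x<n. \<Sum>y<n. h x y\<bar> + 30 * \<beta> * (real n)\<^sup>2" by simp
    then show ?thesis
      using that[of V1 V2] un dj l1 l2 c1 c2 Xc by linarith
  qed
qed

section \<open>Profitable quadruples in a standard colouring\<close>

text \<open>For \<open>i = 1\<close> this is the plain indicator of colour \<open>1\<close>, not \<open>0\<close>.\<close>

definition colour_diff :: "('a set \<Rightarrow> nat) \<Rightarrow> nat \<Rightarrow> 'a \<Rightarrow> 'a \<Rightarrow> int" where
  "colour_diff c i x y = of_bool (c {x, y} = 1) - of_bool (i \<noteq> 1 \<and> c {x, y} = i)"

lemma colour_diff_commute: "colour_diff c i x y = colour_diff c i y x"
  by (simp add: colour_diff_def insert_commute)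

section \<open>Counting coloured pairs and quadruples\<close>

lemma card_ordered_pairs:
  assumes "finite E" "\<And>e. e \<in> E \<Longrightarrow> card e = 2"
  shows "card {(x, y). x \<noteq> y \<and> {x, y} \<in> E} = 2 * card E"
proof -
  have two: "card {(x, y). x \<noteq> y \<and> {x, y} = e} = 2 \<and> finite {(x, y). x \<noteq> y \<and> {x, y} = e}"
    if e: "e \<in> E" for e
  proof -
    obtain u v where uv: "e = {u, v}" "u \<noteq> v" using assms(2)[OF e] by (auto simp: card_2_iff)
    have "{(x, y). x \<noteq> y \<and> {x, y} = e} = {(u, v), (v, u)}"
      using uv by (auto simp: doubleton_eq_iff)
    then show ?thesis using uv by simp
  qed
  have "{(x, y). x \<noteq> y \<and> {x, y} \<in> E} = (\<Union>e\<in>E. {(x, y). x \<noteq> y \<and> {x, y} = e})" by auto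
  also have "card \<dots> = (\<Sum>e\<in>E. card {(x, y). x \<noteq> y \<and> {x, y} = e})"
    using assms(1) two by (intro card_UN_disjoint) auto
  also have "\<dots> = 2 * card E" using two by simp
  finally show ?thesis .
qed

lemma card_complete_ugraph_edges:
  "real (card (uedges (complete_ugraph {..<n}))) = real n * (real n - 1) / 2"
proof -
  have "card (uedges (complete_ugraph {..<n})) = n * (n - 1) div 2"
    by (simp add: complete_ugraph_def n_subsets choose_two)
  moreover have "even (n * (n - 1))" by auto
  ultimately show ?thesis by (cases n) (auto simp: real_of_nat_div algebra_simps)
qed

text \<open>The slack \<open>n\<close> pays for the diagonal, where \<open>{x, x}\<close> is no edge
  and its colour is arbitrary.\<close>

lemma card_coloured_pairs:
  fixes c :: "nat set \<Rightarrow> nat" and i n :: nat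
  defines "N \<equiv> colour_count (complete_ugraph {..<n}) c i"
  shows "2 * N \<le> card {(x, y). x < n \<and> y < n \<and> c {x, y} = i}"
    and "card {(x, y). x < n \<and> y < n \<and> c {x, y} = i} \<le> 2 * N + n"
proof -
  define E where "E = {e. e \<subseteq> {..<n} \<and> card e = 2 \<and> c e = i}"
  have N: "N = card E" by (simp add: N_def E_def colour_count_def complete_ugraph_def conj_assoc)
  have "finite E" by (rule finite_subset[of _ "Pow {..<n}"]) (auto simp: E_def)
  then have "card {(x, y). x \<noteq> y \<and> {x, y} \<in> E} = 2 * N"
    unfolding N by (rule card_ordered_pairs) (simp add: E_def)
  also have "{(x, y). x \<noteq> y \<and> {x, y} \<in> E} = {(x, y). x < n \<and> y < n \<and> x \<noteq> y \<and> c {x, y} = i}"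
    by (auto simp: E_def card_2_iff doubleton_eq_iff)
  finally have off: "card {(x, y). x < n \<and> y < n \<and> x \<noteq> y \<and> c {x, y} = i} = 2 * N" .
  have fin: "finite {(x, y). x < n \<and> y < n \<and> P x y}" for P
    by (rule finite_subset[of _ "{..<n} \<times> {..<n}"]) auto
  show "2 * N \<le> card {(x, y). x < n \<and> y < n \<and> c {x, y} = i}"
    unfolding off[symmetric] by (intro card_mono fin) auto
  have "card {(x, y). x < n \<and> y < n \<and> c {x, y} = i}
      \<le> card ({(x, y). x < n \<and> y < n \<and> x \<noteq> y \<and> c {x, y} = i} \<union> (\<lambda>x. (x, x)) ` {..<n})"
    using fin by (intro card_mono finite_UnI) auto
  also have "\<dots> \<le> 2 * N + card ((\<lambda>x. (x, x)) ` {..<n})"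
    using card_Un_le[of "{(x, y). x < n \<and> y < n \<and> x \<noteq> y \<and> c {x, y} = i}" "(\<lambda>x. (x, x)) ` {..<n}"]
    by (simp add: off)
  also have "\<dots> \<le> 2 * N + n"
    using card_image_le[of "{..<n}" "\<lambda>x. (x, x)"] by simp
  finally show "card {(x, y). x < n \<and> y < n \<and> c {x, y} = i} \<le> 2 * N + n" .
qed

lemma card_coloured_pairs_balanced:
  assumes bal: "balanced_colouring \<epsilon> r (complete_ugraph {..<n}) c" and i: "i \<in> {1..r}" and n: "n \<ge> 2"
  shows "(1 / real r - \<epsilon>) * (real n * (real n - 1)) \<le> card {(x, y). x < n \<and> y < n \<and> c {x, y} = i}"
    and "card {(x, y). x < n \<and> y < n \<and> c {x, y} = i} \<le> (1 / real r + \<epsilon>) * (real n * (real n - 1)) + n"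
proof -
  define N where "N = real (colour_count (complete_ugraph {..<n}) c i)"
  have pos: "real n * (real n - 1) / 2 > 0" using n by simp
  have "N / (real n * (real n - 1) / 2) \<in> {1 / real r - \<epsilon> .. 1 / real r + \<epsilon>}"
    using bal i unfolding balanced_colouring_def N_def card_complete_ugraph_edges[symmetric] by blast
  then have "(1 / real r - \<epsilon>) * (real n * (real n - 1) / 2) \<le> N"
    "N \<le> (1 / real r + \<epsilon>) * (real n * (real n - 1) / 2)"
    using pos by (simp_all only: atLeastAtMost_iff pos_le_divide_eq pos_divide_le_eq)
  then have "(1 / real r - \<epsilon>) * (real n * (real n - 1)) \<le> 2 * N"
    "2 * N \<le> (1 / real r + \<epsilon>) * (real n * (real n - 1))"
    by simp_all
  moreover have "2 * N \<le> card {(x, y). x < n \<and> y < n \<and> c {x, y} = i}"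
    "card {(x, y). x < n \<and> y < n \<and> c {x, y} = i} \<le> 2 * N + n"
    using of_nat_mono[OF card_coloured_pairs(1)[where c = c and i = i and n = n], where 'a = real]
      of_nat_mono[OF card_coloured_pairs(2)[where c = c and i = i and n = n], where 'a = real] by (simp_all add: N_def)
  ultimately show "(1 / real r - \<epsilon>) * (real n * (real n - 1)) \<le> card {(x, y). x < n \<and> y < n \<and> c {x, y} = i}"
    and "card {(x, y). x < n \<and> y < n \<and> c {x, y} = i} \<le> (1 / real r + \<epsilon>) * (real n * (real n - 1)) + n"
    by linarith+
qed

text \<open>A nonzero alternating sum forces \<open>a \<noteq> d\<close> and
  \<open>z \<noteq> z'\<close>. So some coincidence is one of the four between \<open>{a, d}\<close>
  and \<open>{z, z'}\<close>, each leaving three free coordinates.\<close>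

lemma card_degenerate_quadruples:
  fixes h :: "nat \<Rightarrow> nat \<Rightarrow> int"
  shows "card {(a, d, z, z'). a < n \<and> d < n \<and> z < n \<and> z' < n \<and> \<not> distinct [a, d, z, z']
    \<and> alternating h a d z z' \<noteq> 0} \<le> 4 * n ^ 3"
proof -
  let ?T = "{..<n} \<times> {..<n} \<times> {..<n}"
  define f1 where "f1 = (\<lambda>(u :: nat, v :: nat, w :: nat). (u, v, u, w))"
  define f2 where "f2 = (\<lambda>(u :: nat, v :: nat, w :: nat). (u, v, w, u))"
  define f3 where "f3 = (\<lambda>(u :: nat, v :: nat, w :: nat). (u, v, v, w))"
  define f4 where "f4 = (\<lambda>(u :: nat, v :: nat, w :: nat). (u, v, w, v))"
  have "{(a, d, z, z'). a < n \<and> d < n \<and> z < n \<and> z' < n \<and> \<not> distinct [a, d, z, z']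
    \<and> alternating h a d z z' \<noteq> 0} \<subseteq> (f1 ` ?T \<union> f2 ` ?T) \<union> (f3 ` ?T \<union> f4 ` ?T)"
  proof (rule subsetI)
    fix t assume t: "t \<in> {(a, d, z, z'). a < n \<and> d < n \<and> z < n \<and> z' < n \<and> \<not> distinct [a, d, z, z']
      \<and> alternating h a d z z' \<noteq> 0}"
    obtain a d z z' where e: "t = (a, d, z, z')" by (metis prod_cases4)
    have lt: "a < n" "d < n" "z < n" "z' < n" and nd: "\<not> distinct [a, d, z, z']"
      and nz: "alternating h a d z z' \<noteq> 0" using t e by auto
    have "a \<noteq> d" "z \<noteq> z'" using nz by (auto simp: alternating_def)
    then consider "z = a" | "z' = a" | "z = d" | "z' = d" using nd by auto
    then have "t \<in> f1 ` ?T \<or> t \<in> f2 ` ?T \<or> t \<in> f3 ` ?T \<or> t \<in> f4 ` ?T"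
    proof cases
      case 1
      then have "t = f1 (a, d, z')" by (simp add: f1_def e)
      then show ?thesis using lt by blast
    next
      case 2
      then have "t = f2 (a, d, z)" by (simp add: f2_def e)
      then show ?thesis using lt by blast
    next
      case 3
      then have "t = f3 (a, d, z')" by (simp add: f3_def e)
      then show ?thesis using lt by blast
    next
      case 4
      then have "t = f4 (a, d, z)" by (simp add: f4_def e)
      then show ?thesis using lt by blast
    qed
    then show "t \<in> (f1 ` ?T \<union> f2 ` ?T) \<union> (f3 ` ?T \<union> f4 ` ?T)" by blast
  qed
  then have "card {(a, d, z, z'). a < n \<and> d < n \<and> z < n \<and> z' < n \<and> \<not> distinct [a, d, z, z']
    \<and> alternating h a d z z' \<noteq> 0} \<le> card ((f1 ` ?T \<union> f2 ` ?T) \<union> (f3 ` ?T \<union> f4 ` ?T))"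
    by (intro card_mono) auto
  also have "\<dots> \<le> (card (f1 ` ?T) + card (f2 ` ?T)) + (card (f3 ` ?T) + card (f4 ` ?T))"
    by (intro order.trans[OF card_Un_le] add_mono card_Un_le)
  also have "\<dots> \<le> (n ^ 3 + n ^ 3) + (n ^ 3 + n ^ 3)"
  proof -
    have "card (f ` ?T) \<le> n ^ 3" for f :: "nat \<times> nat \<times> nat \<Rightarrow> nat \<times> nat \<times> nat \<times> nat"
      using card_image_le[of ?T f] by (simp add: card_cartesian_product power3_eq_cube)
    then show ?thesis by (intro add_mono)
  qed
  finally show ?thesis by simp
qed

text \<open>Exchanging \<open>a\<close> and \<open>d\<close> negates the alternating sum, so
  negative quadruples are matched with positive ones.\<close>

lemma card_nonzero_quadruples:
  fixes h :: "nat \<Rightarrow> nat \<Rightarrow> int" and n :: nat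
  defines "P \<equiv> {(a, d, z, z'). a < n \<and> d < n \<and> z < n \<and> z' < n \<and> distinct [a, d, z, z']
    \<and> alternating h a d z z' \<ge> 1}"
  shows "card {(a, d, z, z'). a < n \<and> d < n \<and> z < n \<and> z' < n \<and> alternating h a d z z' \<noteq> 0}
    \<le> 2 * card P + 4 * n ^ 3"
proof -
  define f where "f = (\<lambda>(a, d, z, z'). (d, a, z, z') :: nat \<times> nat \<times> nat \<times> nat)"
  define D where "D = {(a, d, z, z'). a < n \<and> d < n \<and> z < n \<and> z' < n \<and> \<not> distinct [a, d, z, z']
    \<and> alternating h a d z z' \<noteq> 0}"
  have fin: "finite P" "finite D"
    by (rule finite_subset[of _ "{..<n} \<times> {..<n} \<times> {..<n} \<times> {..<n}"]; auto simp: P_def D_def)+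
  have "{(a, d, z, z'). a < n \<and> d < n \<and> z < n \<and> z' < n \<and> alternating h a d z z' \<noteq> 0} \<subseteq> P \<union> f ` P \<union> D"
  proof (rule subsetI)
    fix u assume u: "u \<in> {(a, d, z, z'). a < n \<and> d < n \<and> z < n \<and> z' < n \<and> alternating h a d z z' \<noteq> 0}"
    obtain a d z z' where e: "u = (a, d, z, z')" by (metis prod_cases4)
    have lt: "a < n" "d < n" "z < n" "z' < n" "alternating h a d z z' \<noteq> 0" using u e by auto
    have neg: "alternating h d a z z' = - alternating h a d z z'" by (simp add: alternating_def)
    consider "\<not> distinct [a, d, z, z']" | "distinct [a, d, z, z']" "alternating h a d z z' \<ge> 1"
      | "distinct [d, a, z, z']" "alternating h d a z z' \<ge> 1"
      using lt(5) neg by fastforce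
    then show "u \<in> P \<union> f ` P \<union> D"
    proof cases
      case 1 then show ?thesis using lt e by (auto simp: D_def)
    next
      case 2 then show ?thesis using lt e by (auto simp: P_def)
    next
      case 3
      then have "(d, a, z, z') \<in> P" using lt by (auto simp: P_def)
      moreover have "u = f (d, a, z, z')" by (simp add: f_def e)
      ultimately show ?thesis by blast
    qed
  qed
  then have "card {(a, d, z, z'). a < n \<and> d < n \<and> z < n \<and> z' < n \<and> alternating h a d z z' \<noteq> 0}
      \<le> card (P \<union> f ` P \<union> D)"
    using fin by (intro card_mono) auto
  also have "\<dots> \<le> card P + card P + card D"
    using card_Un_le[of "P \<union> f ` P" D] card_Un_le[of P "f ` P"] card_image_le[OF fin(1), of f] by linarith
  also have "card D \<le> 4 * n ^ 3" unfolding D_def by (rule card_degenerate_quadruples)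
  finally show ?thesis by simp
qed

text \<open>Carries the bound from a nearly monochromatic set \<open>A\<close> to a set
  \<open>A'\<close> of the exact size that standardness asks for: every new edge has an endpoint in
  \<open>A' - A\<close>.\<close>

lemma card_coloured_edges_le:
  fixes c :: "nat set \<Rightarrow> nat"
  assumes A': "A' \<subseteq> {..<n}" and fin: "finite A"
    and bad: "\<And>x y. x \<in> A \<Longrightarrow> y \<in> A \<Longrightarrow> c {x, y} \<noteq> i \<Longrightarrow> (x, y) \<in> Q" and Q: "finite Q"
  shows "card {e \<in> uedges (induced_ugraph (complete_ugraph {..<n}) A'). c e \<noteq> i}
      \<le> card Q + card (A' - A) * n"
proof -
  have finA: "finite (A' - A)" using A' finite_subset by blast
  have "{e \<in> uedges (induced_ugraph (complete_ugraph {..<n}) A'). c e \<noteq> i}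
      \<subseteq> (\<lambda>(x, y). {x, y}) ` (Q \<union> (A' - A) \<times> {..<n})"
  proof
    fix e assume "e \<in> {e \<in> uedges (induced_ugraph (complete_ugraph {..<n}) A'). c e \<noteq> i}"
    then obtain x y where e: "e = {x, y}" "x \<in> A'" "y \<in> A'" "c {x, y} \<noteq> i"
      by (auto simp: induced_ugraph_def complete_ugraph_def card_2_iff)
    then have lt: "x < n" "y < n" using A' by auto
    consider "x \<in> A" "y \<in> A" | "x \<notin> A" | "y \<notin> A" by blast
    then have "(x, y) \<in> Q \<union> (A' - A) \<times> {..<n} \<or> (y, x) \<in> Q \<union> (A' - A) \<times> {..<n}"
      by cases (use e lt bad in auto)
    then show "e \<in> (\<lambda>(x, y). {x, y}) ` (Q \<union> (A' - A) \<times> {..<n})"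
      using e(1) by (auto simp: image_iff insert_commute)
  qed
  then have "card {e \<in> uedges (induced_ugraph (complete_ugraph {..<n}) A'). c e \<noteq> i}
      \<le> card (Q \<union> (A' - A) \<times> {..<n})"
    using Q finA by (intro surj_card_le) auto
  also have "\<dots> \<le> card Q + card (A' - A) * n"
    using card_Un_le[of Q "(A' - A) \<times> {..<n}"] by (simp add: card_cartesian_product)
  finally show ?thesis .
qed

text \<open>Too few profitable quadruples make \<open>h\<close> almost additive and produce the two
  near-cliques. Their sizes are almost equal by balance, so moving few vertices gives an exactly
  balanced partition that violates standardness.\<close>

lemma many_positive_quadruples:
  fixes c :: "nat set \<Rightarrow> nat" and \<eta> \<epsilon> :: real
  assumes r: "r \<ge> 3" and i: "i \<in> {1..r}"
    and eta: "0 < \<eta>" "\<eta> \<le> 1 / (100 * (real r)\<^sup>2)" and eps: "0 < \<epsilon>" "\<epsilon> \<le> \<eta> / 1000" and n: "6000 \<le> \<eta> * n"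
    and bal: "balanced_colouring \<epsilon> r (complete_ugraph {..<n}) c"
    and std: "standard_colouring \<eta> r (complete_ugraph {..<n}) c"
  shows "\<eta> / 100 * real n ^ 4 \<le> card {(a, d, z, z'). a < n \<and> d < n \<and> z < n \<and> z' < n
    \<and> distinct [a, d, z, z'] \<and> alternating (colour_diff c i) a d z z' \<ge> 1}"
proof (rule ccontr)
  define P where "P = {(a, d, z, z'). a < n \<and> d < n \<and> z < n \<and> z' < n
    \<and> distinct [a, d, z, z'] \<and> alternating (colour_diff c i) a d z z' \<ge> 1}"
  define h where "h = colour_diff c i"
  assume "\<not> ?thesis"
  then have P: "card P < \<eta> / 100 * real n ^ 4" by (simp add: P_def)
  have r9: "(real r)\<^sup>2 \<ge> 9" using r power_mono[of 3 "real r" 2] by simp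
  have "\<eta> * 900 \<le> 1"
  proof -
    have "1 / (100 * (real r)\<^sup>2) \<le> 1 / 900" using r9 r by (intro divide_left_mono) auto
    then show ?thesis using eta by simp
  qed
  then have eta1: "\<eta> \<le> 1 / 900" by simp
  have "6000 * 1 \<le> \<eta> * n" using n by simp
  also have "\<dots> \<le> 1 / 900 * n" using eta1 by (intro mult_right_mono) auto
  finally have nbig: "real n \<ge> 5400000" by simp
  then have n0: "n > 0" "n \<ge> 2" by auto
  have n1: "real n \<le> \<eta> / 6000 * (real n)\<^sup>2"
    using mult_right_mono[OF n, of "real n"] by (simp add: power2_eq_square)
  have n2pos: "(real n)\<^sup>2 > 0" using n0 by simp
  have en: "\<eta> * (real n)\<^sup>2 \<ge> 0" using eta by simp
  \<comment> \<open>Positive quadruples and their reversals contribute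
    \<open>2 * \<eta> / 100\<close>, degenerate ones at most \<open>4 * \<eta> / 6000\<close>;
    together they stay below \<open>\<eta> / 48\<close>.\<close>
  define \<beta> where "\<beta> = \<eta> / 48"
  have "card {(a, d, z, z'). a < n \<and> d < n \<and> z < n \<and> z' < n \<and> alternating h a d z z' \<noteq> 0}
      \<le> 2 * card P + 4 * real n ^ 3"
    using of_nat_mono[OF card_nonzero_quadruples[of n h], where 'a = real] by (simp add: h_def P_def)
  also have "\<dots> \<le> \<beta> * real n ^ 4"
  proof -
    have "real n ^ 3 \<le> \<eta> / 6000 * real n ^ 4"
      using mult_right_mono[OF n1, of "(real n)\<^sup>2"] by (simp add: power_numeral_reduce mult_ac)
    moreover have "\<eta> * real n ^ 4 \<ge> 0" using eta by simp
    ultimately show ?thesis using P by (simp add: \<beta>_def)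
  qed
  finally have bad: "card {(a, d, z, z'). a < n \<and> d < n \<and> z < n \<and> z' < n \<and> alternating h a d z z' \<noteq> 0}
      \<le> \<beta> * real n ^ 4" .
  define O' where "O' j = card {(x, y). x < n \<and> y < n \<and> c {x, y} = j}" for j
  have nn: "real n * (real n - 1) \<le> (real n)\<^sup>2" "real n * (real n - 1) \<ge> 0" using n0 by (simp_all add: power2_eq_square algebra_simps)
  have nn': "real n * (real n - 1) \<ge> 9 / 10 * (real n)\<^sup>2"
  proof -
    have "10 * real n \<le> real n * real n" using nbig by (intro mult_right_mono) auto
    then show ?thesis by (simp add: power2_eq_square algebra_simps)
  qed
  have eps3: "\<epsilon> \<le> 1 / 900000" using eps eta1 by simp
  have rr: "1 / real r \<le> 1 / 3" using r by (intro divide_left_mono) auto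
  have Oup: "O' j \<le> (real n)\<^sup>2 / 2" if "j \<in> {1..r}" for j
  proof -
    have "O' j \<le> (1 / real r + \<epsilon>) * (real n * (real n - 1)) + n"
      using card_coloured_pairs_balanced(2)[OF bal that n0(2)] by (simp add: O'_def)
    also have "\<dots> \<le> (1 / 3 + 1 / 900000) * (real n)\<^sup>2 + \<eta> / 6000 * (real n)\<^sup>2"
      using rr eps3 nn eps(1) n1 by (intro add_mono mult_mono) auto
    also have "\<dots> \<le> (1 / 3 + 1 / 900000 + 1 / 6000) * (real n)\<^sup>2"
      using eta1 n2pos by (simp add: distrib_right)
    also have "\<dots> \<le> (real n)\<^sup>2 / 2" by simp
    finally show ?thesis .
  qed
  have Olow: "1 / (2 * real r) * (real n)\<^sup>2 \<le> O' 1"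
  proof -
    have "\<epsilon> \<le> 1 / (10 * real r)"
    proof -
      have "\<epsilon> \<le> \<eta>" using eps eta by simp
      also note eta(2)
      also have "1 / (100 * (real r)\<^sup>2) \<le> 1 / (10 * real r)"
        using r by (intro divide_left_mono) (auto simp: power2_eq_square)
      finally show ?thesis .
    qed
    then have lo: "9 / 10 * (1 / real r) \<le> 1 / real r - \<epsilon>" by (simp add: field_simps)
    have "0 \<le> 9 / 10 * (1 / real r)" by simp
    with lo have lo0: "0 \<le> 1 / real r - \<epsilon>" by linarith
    have "(9 / 10 * (1 / real r)) * (9 / 10 * (real n)\<^sup>2) \<le> (1 / real r - \<epsilon>) * (real n * (real n - 1))"
      by (rule mult_mono[OF lo nn' lo0]) simp
    also have "\<dots> \<le> O' 1"
      using card_coloured_pairs_balanced(1)[OF bal _ n0(2), of 1] r by (simp add: O'_def)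
    finally have "81 / 100 * ((real n)\<^sup>2 / real r) \<le> O' 1" by simp
    moreover have "(real n)\<^sup>2 / real r \<ge> 0" by simp
    ultimately show ?thesis by simp
  qed
  have hpos: "{(x, y). x < n \<and> y < n \<and> h x y = 1} = {(x, y). x < n \<and> y < n \<and> c {x, y} = 1}"
    by (auto simp: h_def colour_diff_def of_bool_def split: if_splits)
  have hneg: "{(x, y). x < n \<and> y < n \<and> h x y = -1}
      = (if i = 1 then {} else {(x, y). x < n \<and> y < n \<and> c {x, y} = i})"
    by (auto simp: h_def colour_diff_def of_bool_def split: if_splits)
  have sum_h: "(\<Sum>x<n. \<Sum>y<n. h x y) = int (O' 1) - (if i = 1 then 0 else int (O' i))"
  proof -
    have cnt: "(\<Sum>x<n. \<Sum>y<n. of_bool (c {x, y} = j)) = int (O' j)" for j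
    proof -
      have "(\<Sum>x<n. \<Sum>y<n. of_bool (c {x, y} = j)) = (\<Sum>u\<in>{..<n} \<times> {..<n}. if c {fst u, snd u} = j then 1 else (0::int))"
        by (simp add: sum.cartesian_product of_bool_def case_prod_beta)
      also have "\<dots> = int (card (({..<n} \<times> {..<n}) \<inter> {u. c {fst u, snd u} = j}))"
        by (simp add: sum.If_cases)
      also have "({..<n} \<times> {..<n}) \<inter> {u. c {fst u, snd u} = j} = {(x, y). x < n \<and> y < n \<and> c {x, y} = j}"
        by auto
      finally show ?thesis by (simp add: O'_def)
    qed
    show ?thesis
    proof (cases "i = 1")
      case True
      then have "h = (\<lambda>x y. of_bool (c {x, y} = 1))"
        by (simp add: fun_eq_iff h_def colour_diff_def)
      then show ?thesis using True by (simp only: cnt if_True) simp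
    next
      case False
      then have "h = (\<lambda>x y. of_bool (c {x, y} = 1) - of_bool (c {x, y} = i))"
        by (simp add: fun_eq_iff h_def colour_diff_def)
      then show ?thesis using False by (simp only: sum_subtractf cnt if_False)
    qed
  qed
  define \<tau> where "\<tau> = 1 / (2 * real r)"
  have rpos: "real r > 0" using r by simp
  \<comment> \<open>With \<open>\<tau> = 1 / (2 * r)\<close>, a lower bound for the density of
    colour 1, this amounts to \<open>\<eta> < 1 / (4 * r\<^sup>2)\<close>.\<close>
  have beta: "3 * \<beta> < \<tau>\<^sup>2 / 16"
  proof -
    have "3 * \<beta> \<le> (1 / (100 * (real r)\<^sup>2)) / 16" using eta by (simp add: \<beta>_def)
    also have "\<dots> < \<tau>\<^sup>2 / 16" using rpos by (simp add: \<tau>_def power_divide power_mult_distrib divide_strict_left_mono)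
    finally show ?thesis .
  qed
  obtain V1 V2 where V: "V1 \<union> V2 = {..<n}" "V1 \<inter> V2 = {}" "real n \<le> 4 * card V1" "real n \<le> 4 * card V2"
    and b1: "card {(x, y). x \<in> V1 \<and> y \<in> V1 \<and> h x y \<noteq> 1} \<le> 3 * \<beta> * (real n)\<^sup>2"
    and b2: "card {(x, y). x \<in> V2 \<and> y \<in> V2 \<and> h x y \<noteq> -1} \<le> 3 * \<beta> * (real n)\<^sup>2"
    and diff: "\<bar>real (card V1) - card V2\<bar> * n \<le> \<bar>\<Sum>x<n. \<Sum>y<n. h x y\<bar> + 30 * \<beta> * (real n)\<^sup>2"
  proof (rule two_clique_structure[OF n0(1) _ _ bad _ _ _ _ _ beta])
    show "h x y = h y x" for x y by (simp add: h_def colour_diff_commute)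
    show "h x y \<in> {-1, 0, 1}" for x y by (simp add: h_def colour_diff_def)
    show "card {(x, y). x < n \<and> y < n \<and> h x y = 1} \<le> (real n)\<^sup>2 / 2"
      using Oup[of 1] r by (simp add: hpos O'_def)
    show "card {(x, y). x < n \<and> y < n \<and> h x y = -1} \<le> (real n)\<^sup>2 / 2"
      unfolding hneg using Oup[OF i] by (simp add: O'_def)
    show "\<tau> * (real n)\<^sup>2 \<le> card {(x, y). x < n \<and> y < n \<and> h x y = 1}"
      using Olow by (simp add: hpos O'_def \<tau>_def)
    show "0 < \<tau>" "\<tau> \<le> 1" using r by (auto simp: \<tau>_def)
  qed (rule that)
  have finV: "finite V1" "finite V2" using V(1) by (metis finite_Un finite_lessThan)+
  have cV: "card V1 + card V2 = n" using card_Un_disjoint[OF finV V(2)] V(1) by simp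
  have finQ: "finite {(x, y). x \<in> A \<and> y \<in> A \<and> R x y}" if "finite A" for A :: "nat set" and R
    by (rule finite_subset[of _ "A \<times> A"]) (use that in auto)
  have small: "3 * \<beta> < 1 / 16"
    using eta1 by (simp add: \<beta>_def)
  \<comment> \<open>For \<open>i = 1\<close> the function \<open>h\<close> never takes the value -1,
    so every pair in \<open>V2\<close> would be exceptional although \<open>V2\<close> has at least
    \<open>n / 4\<close> vertices.\<close>
  have i1: "i \<noteq> 1"
  proof
    assume "i = 1"
    then have "{(x, y). x \<in> V2 \<and> y \<in> V2 \<and> h x y \<noteq> -1} = V2 \<times> V2"
      by (auto simp: h_def colour_diff_def)
    then have "(real (card V2))\<^sup>2 \<le> 3 * \<beta> * (real n)\<^sup>2" using b2 by (simp add: card_cartesian_product power2_eq_square)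
    also have "\<dots> < 1 / 16 * (real n)\<^sup>2" using mult_strict_right_mono[OF small n2pos] .
    also have "\<dots> = (real n / 4)\<^sup>2" by (simp add: power_divide)
    finally have "real (card V2) < real n / 4" by (rule power_less_imp_less_base) simp
    then show False using V(4) by simp
  qed
  have ir: "i \<in> {2..r}" using i i1 by auto
  have diff': "\<bar>real (card V1) - card V2\<bar> \<le> 7 / 10 * \<eta> * n"
  proof -
    have "\<bar>real (O' 1) - real (O' i)\<bar> \<le> 2 * \<epsilon> * (real n * (real n - 1)) + n"
      using card_coloured_pairs_balanced[OF bal i n0(2)] card_coloured_pairs_balanced[OF bal _ n0(2), of 1] r
      by (simp add: O'_def algebra_simps abs_le_iff)
    also have "\<dots> \<le> 2 * (\<eta> / 1000) * (real n)\<^sup>2 + \<eta> / 6000 * (real n)\<^sup>2"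
      using eps nn n1 eta by (intro add_mono mult_mono) auto
    finally have "\<bar>real (O' 1) - real (O' i)\<bar> \<le> \<eta> / 400 * (real n)\<^sup>2"
      using en by simp
    moreover have "real_of_int \<bar>\<Sum>x<n. \<Sum>y<n. h x y\<bar> = \<bar>real (O' 1) - real (O' i)\<bar>"
      using i1 by (simp add: sum_h)
    ultimately have "\<bar>real (card V1) - card V2\<bar> * n \<le> \<eta> / 400 * (real n)\<^sup>2 + 30 * \<beta> * (real n)\<^sup>2"
      using diff by linarith
    also have "\<dots> \<le> (7 / 10 * \<eta> * n) * n"
      using en by (simp add: \<beta>_def power2_eq_square)
    finally show ?thesis using n0 by simp
  qed
  \<comment> \<open>The larger half, so that the sizes differ by 0 or 1 in the order prescribed by
    standardness. Choosing \<open>U1\<close> nested with \<open>V1\<close> means that vertices move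
    in one direction only.\<close>
  define k where "k = (n + 1) div 2"
  have k: "2 * k \<ge> n" "2 * k \<le> n + 1" by (auto simp: k_def)
  obtain U1 where U1: "U1 \<subseteq> {..<n}" "card U1 = k" "U1 \<subseteq> V1 \<or> V1 \<subseteq> U1"
  proof (cases "k \<le> card V1")
    case True
    then obtain U where "U \<subseteq> V1" "card U = k" using obtain_subset_with_card_n by metis
    then show ?thesis using that[of U] V(1) by auto
  next
    case False
    then have "card V1 \<le> k" "k \<le> card {..<n}" using k by auto
    moreover have "V1 \<subseteq> {..<n}" using V(1) by auto
    ultimately obtain U where "V1 \<subseteq> U" "U \<subseteq> {..<n}" "card U = k"
      using exists_subset_between[of V1 k "{..<n}"] by auto
    then show ?thesis using that[of U] by auto
  qed
  define U2 where "U2 = {..<n} - U1"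
  have finU: "finite U1" "finite U2" using U1(1) finite_subset by (auto simp: U2_def)
  have cU2: "card U2 = n - k" using U1 finU by (simp add: U2_def card_Diff_subset)
  have sU: "U2 \<subseteq> {..<n}" by (auto simp: U2_def)
  have ex1: "real (card (U1 - V1)) \<le> 7 / 10 * \<eta> * n + 1"
    using U1(3)
  proof
    assume "U1 \<subseteq> V1"
    then have "U1 - V1 = {}" by blast
    then have "real (card (U1 - V1)) = 0" by (simp only: card.empty of_nat_0)
    then show ?thesis using eta by simp
  next
    assume "V1 \<subseteq> U1"
    then have "card (U1 - V1) = k - card V1" "card V1 \<le> k"
      using finV finU U1 card_mono[of U1 V1] by (auto simp: card_Diff_subset)
    then show ?thesis using diff' k cV by linarith
  qed
  have ex2: "real (card (U2 - V2)) \<le> 7 / 10 * \<eta> * n + 1"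
    using U1(3)
  proof
    assume "V1 \<subseteq> U1"
    then have "U2 - V2 = {}" using V by (auto simp: U2_def)
    then have "real (card (U2 - V2)) = 0" by (simp only: card.empty of_nat_0)
    then show ?thesis using eta by simp
  next
    assume "U1 \<subseteq> V1"
    then have "V2 \<subseteq> U2" using V by (auto simp: U2_def)
    then have "card (U2 - V2) = n - k - card V2" "card V2 \<le> n - k"
      using finV finU cU2 card_mono[of U2 V2] by (auto simp: card_Diff_subset)
    then show ?thesis using diff' k cV by linarith
  qed
  \<comment> \<open>Budget in units of \<open>\<eta> * n\<^sup>2\<close>: \<open>1 / 16\<close> for
    exceptional pairs, \<open>7 / 10\<close> for edges at moved vertices and \<open>1 / 6000\<close>
    for rounding, which is less than 1 in total.\<close>
  have final: "real (card Q + card W * n) < \<eta> * (real n)\<^sup>2"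
    if "card Q \<le> 3 * \<beta> * (real n)\<^sup>2" "real (card W) \<le> 7 / 10 * \<eta> * n + 1" for Q :: "(nat \<times> nat) set" and W :: "nat set"
  proof -
    have "real (card W * n) \<le> (7 / 10 * \<eta> * n + 1) * n" using that(2) by (simp add: mult_right_mono)
    also have "\<dots> \<le> (7 / 10 * \<eta> + \<eta> / 6000) * (real n)\<^sup>2" using n1 by (simp add: power2_eq_square algebra_simps)
    finally have "real (card Q + card W * n) \<le> (3 * \<beta> + (7 / 10 * \<eta> + \<eta> / 6000)) * (real n)\<^sup>2"
      using that(1) by (simp add: distrib_right)
    also have "\<dots> < \<eta> * (real n)\<^sup>2"
      using eta n2pos by (intro mult_strict_right_mono) (auto simp: \<beta>_def)
    finally show ?thesis .
  qed
  define Q1 where "Q1 = {(x, y). x \<in> V1 \<and> y \<in> V1 \<and> h x y \<noteq> 1}"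
  define Q2 where "Q2 = {(x, y). x \<in> V2 \<and> y \<in> V2 \<and> h x y \<noteq> -1}"
  have "card {e \<in> uedges (induced_ugraph (complete_ugraph {..<n}) U1). c e \<noteq> 1} \<le> card Q1 + card (U1 - V1) * n"
    by (rule card_coloured_edges_le[OF U1(1) finV(1)])
      (auto simp: Q1_def h_def colour_diff_def of_bool_def finQ finV split: if_splits)
  then have "card {e \<in> uedges (induced_ugraph (complete_ugraph {..<n}) U1). c e \<noteq> 1} < \<eta> * (real n)\<^sup>2"
    using final[OF b1 ex1] unfolding Q1_def by linarith
  moreover have "card {e \<in> uedges (induced_ugraph (complete_ugraph {..<n}) U2). c e \<noteq> i} \<le> card Q2 + card (U2 - V2) * n"
    by (rule card_coloured_edges_le[OF sU finV(2)])
      (auto simp: Q2_def h_def colour_diff_def of_bool_def finQ finV split: if_splits)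
  then have "card {e \<in> uedges (induced_ugraph (complete_ugraph {..<n}) U2). c e \<noteq> i} < \<eta> * (real n)\<^sup>2"
    using final[OF b2 ex2] unfolding Q2_def by linarith
  moreover have "U1 \<union> U2 = uverts (complete_ugraph {..<n})" "U1 \<inter> U2 = {}"
    using U1(1) by (auto simp: U2_def complete_ugraph_def)
  moreover have "int (card U1) - int (card U2) \<in> {0, 1}" using U1(2) cU2 k by auto
  ultimately show False
    using std[unfolded standard_colouring_def, THEN conjunct2, rule_format, of U1 U2 i] ir
    by (simp add: complete_ugraph_def)
qed

section \<open>Trees\<close>

definition neighbours :: "'a set set \<Rightarrow> 'a \<Rightarrow> 'a set" where
  "neighbours E v = {u. {v, u} \<in> E}"

lemma neighbours_sym: "u \<in> neighbours E v \<longleftrightarrow> v \<in> neighbours E u"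
  by (simp add: neighbours_def insert_commute)

lemma neighbours_simple:
  assumes "simple_graph G"
  shows "neighbours (uedges G) v \<subseteq> uverts G" "v \<notin> neighbours (uedges G) v"
    "finite (neighbours (uedges G) v)" "finite (uedges G)"
proof -
  have fin: "finite (uverts G)" and all: "\<forall>e\<in>uedges G. e \<subseteq> uverts G \<and> card e = 2"
    using assms unfolding simple_graph_def by blast+
  have edge: "e \<subseteq> uverts G" "card e = 2" if "e \<in> uedges G" for e
    using all that by blast+
  show sub: "neighbours (uedges G) v \<subseteq> uverts G"
  proof
    fix u assume "u \<in> neighbours (uedges G) v"
    then have "{v, u} \<in> uedges G" by (simp only: neighbours_def mem_Collect_eq)
    from edge(1)[OF this] show "u \<in> uverts G" by blast
  qed
  show "v \<notin> neighbours (uedges G) v"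
  proof
    assume "v \<in> neighbours (uedges G) v"
    then have "{v, v} \<in> uedges G" by (simp only: neighbours_def mem_Collect_eq)
    from edge(2)[OF this] show False by simp
  qed
  show "finite (neighbours (uedges G) v)"
    by (rule finite_subset[OF sub fin])
  have "uedges G \<subseteq> Pow (uverts G)" using edge(1) by blast
  then show "finite (uedges G)"
    by (rule finite_subset) (simp add: fin)
qed

lemma star_eq_image_neighbours:
  assumes "simple_graph G"
  shows "{e \<in> uedges G. v \<in> e} = (\<lambda>u. {v, u}) ` neighbours (uedges G) v"
proof
  show "{e \<in> uedges G. v \<in> e} \<subseteq> (\<lambda>u. {v, u}) ` neighbours (uedges G) v"
  proof
    fix e assume e: "e \<in> {e \<in> uedges G. v \<in> e}"
    then obtain a b where "e = {a, b}" using assms by (auto simp: simple_graph_def card_2_iff)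
    with e obtain u where "e = {v, u}" by auto
    then show "e \<in> (\<lambda>u. {v, u}) ` neighbours (uedges G) v" using e by (auto simp: neighbours_def)
  qed
qed (auto simp: neighbours_def)

lemma inj_on_doubleton: "inj_on (\<lambda>u. {v, u}) A"
  by (auto simp: inj_on_def doubleton_eq_iff)

lemma graph_degree_eq_card_neighbours:
  "simple_graph G \<Longrightarrow> graph_degree G v = card (neighbours (uedges G) v)"
  by (simp add: graph_degree_def star_eq_image_neighbours card_image inj_on_doubleton)

text \<open>Take a longest path. All neighbours of its first vertex lie on it, and one of them other
  than the second vertex closes an initial segment to a cycle.\<close>

lemma cycle_if_min_degree_two:
  assumes G: "simple_graph G" and ne: "uverts G \<noteq> {}"
    and deg: "\<And>v. v \<in> uverts G \<Longrightarrow> card (neighbours (uedges G) v) \<ge> 2"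
  shows "\<exists>xs. ugraph_cycle G xs"
proof -
  let ?N = "neighbours (uedges G)"
  define path where "path xs \<longleftrightarrow> xs \<noteq> [] \<and> distinct xs \<and> set xs \<subseteq> uverts G \<and>
    (\<forall>i. Suc i < length xs \<longrightarrow> {xs ! i, xs ! Suc i} \<in> uedges G)" for xs
  have fin: "finite (uverts G)" using G by (simp add: simple_graph_def)
  obtain v0 where "v0 \<in> uverts G" using ne by auto
  then have "path [v0]" by (simp add: path_def)
  moreover have "\<forall>xs. path xs \<longrightarrow> length xs < Suc (card (uverts G))"
    unfolding path_def using fin by (metis card_mono distinct_card le_imp_less_Suc)
  ultimately obtain xs where xs: "path xs" and longest: "\<And>ys. path ys \<Longrightarrow> length ys \<le> length xs"
    using ex_has_greatest_nat[of path "[v0]" length] by blast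
  define v where "v = xs ! 0"
  have lx: "0 < length xs" using xs by (simp add: path_def)
  have v: "v \<in> uverts G" using xs lx by (auto simp: path_def v_def)
  have nb: "u \<in> set xs" if u: "u \<in> ?N v" for u
  proof (rule ccontr)
    assume nu: "u \<notin> set xs"
    have "path (u # xs)"
      unfolding path_def
    proof (intro conjI allI impI)
      show "set (u # xs) \<subseteq> uverts G" using xs u neighbours_simple(1)[OF G] by (auto simp: path_def)
      fix i assume i: "Suc i < length (u # xs)"
      show "{(u # xs) ! i, (u # xs) ! Suc i} \<in> uedges G"
      proof (cases i)
        case 0
        then show ?thesis using u by (simp add: neighbours_def v_def insert_commute)
      next
        case (Suc j)
        then show ?thesis using xs i by (simp add: path_def)
      qed
    qed (use xs nu in \<open>auto simp: path_def\<close>)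
    from longest[OF this] show False by simp
  qed
  have "\<exists>u\<in>?N v. u \<noteq> xs ! 1"
  proof (rule ccontr)
    assume "\<not> ?thesis"
    then have "?N v \<subseteq> {xs ! 1}" by auto
    from card_mono[OF _ this] deg[OF v] show False by simp
  qed
  then obtain u where u: "u \<in> ?N v" "u \<noteq> xs ! 1" by blast
  obtain j where j: "j < length xs" "xs ! j = u" using nb[OF u(1)] by (auto simp: in_set_conv_nth)
  have "j \<noteq> 0"
  proof
    assume "j = 0"
    then have "u = v" using j by (simp add: v_def)
    then show False using u(1) neighbours_simple(2)[OF G] by blast
  qed
  moreover have "j \<noteq> 1" using u(2) j by auto
  ultimately have j2: "j \<ge> 2" by simp
  define ys where "ys = take (Suc j) xs"
  have ly: "length ys = Suc j" using j by (simp add: ys_def)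
  have "ugraph_cycle G ys"
    unfolding ugraph_cycle_def
  proof (intro conjI allI impI)
    show "3 \<le> length ys" using ly j2 by simp
    show "distinct ys" using xs by (simp add: path_def ys_def)
    fix i assume i: "i < length ys"
    show "{ys ! i, ys ! (Suc i mod length ys)} \<in> uedges G"
    proof (cases "i = j")
      case True
      then show ?thesis using u(1) j ly by (simp add: ys_def neighbours_def v_def insert_commute)
    next
      case False
      then have "Suc i < length ys" using i ly by simp
      then show ?thesis using xs j ly by (auto simp: ys_def path_def)
    qed
  qed
  then show ?thesis by blast
qed

text \<open>Remove a vertex of degree at most 1, which exists by the previous lemma. Stated for
  forests, so the induction need not carry connectedness along.\<close>

lemma acyclic_card_edges_le:
  assumes "simple_graph G" "\<nexists>xs. ugraph_cycle G xs"
  shows "card (uedges G) \<le> card (uverts G)"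
  using assms
proof (induction "card (uverts G)" arbitrary: G rule: less_induct)
  case less
  note G = less.prems(1)
  have fin: "finite (uverts G)" using G by (simp add: simple_graph_def)
  show ?case
  proof (cases "uverts G = {}")
    case True
    then have "uedges G = {}" using G by (force simp: simple_graph_def)
    then show ?thesis by simp
  next
    case False
    have "\<exists>v\<in>uverts G. card (neighbours (uedges G) v) \<le> 1"
    proof (rule ccontr)
      assume "\<not> ?thesis"
      then have "card (neighbours (uedges G) v) \<ge> 2" if "v \<in> uverts G" for v using that by fastforce
      from cycle_if_min_degree_two[OF G False this] less.prems(2) show False by blast
    qed
    then obtain v where v: "v \<in> uverts G" "card (neighbours (uedges G) v) \<le> 1" by blast
    define G' :: "'a ugraph" where "G' = \<lparr>uverts = uverts G - {v}, uedges = {e \<in> uedges G. v \<notin> e}\<rparr>"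
    have "simple_graph G'" using G by (auto simp: simple_graph_def G'_def)
    moreover have "\<nexists>xs. ugraph_cycle G' xs"
      using less.prems(2) by (auto simp: ugraph_cycle_def G'_def)
    moreover have c: "card (uverts G') = card (uverts G) - 1" "card (uverts G) > 0"
      using v fin by (auto simp: G'_def card_gt_0_iff)
    ultimately have "card (uedges G') \<le> card (uverts G) - 1"
      using less.hyps[of G'] by simp
    moreover have "card (uedges G) = card (uedges G') + card {e \<in> uedges G. v \<in> e}"
    proof -
      have "uedges G = uedges G' \<union> {e \<in> uedges G. v \<in> e}" by (auto simp: G'_def)
      moreover have "finite (uedges G')" "uedges G' \<inter> {e \<in> uedges G. v \<in> e} = {}"
        using neighbours_simple(4)[OF G] by (auto simp: G'_def)
      ultimately show ?thesis
        using card_Un_disjoint[of "uedges G'" "{e \<in> uedges G. v \<in> e}"] neighbours_simple(4)[OF G] by simp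
    qed
    moreover have "card {e \<in> uedges G. v \<in> e} \<le> 1"
      using v(2) graph_degree_eq_card_neighbours[OF G, of v] by (simp add: graph_degree_def)
    ultimately show ?thesis using c by linarith
  qed
qed

lemma sum_card_neighbours:
  assumes G: "simple_graph G"
  shows "(\<Sum>v\<in>uverts G. card (neighbours (uedges G) v)) = 2 * card (uedges G)"
proof -
  have "(\<Sum>v\<in>uverts G. card (neighbours (uedges G) v)) = card (Sigma (uverts G) (neighbours (uedges G)))"
    using G neighbours_simple(3)[OF G] by (subst card_SigmaI) (auto simp: simple_graph_def)
  also have "Sigma (uverts G) (neighbours (uedges G)) = {(x, y). x \<noteq> y \<and> {x, y} \<in> uedges G}"
    using G by (force simp: neighbours_def simple_graph_def)
  also have "card \<dots> = 2 * card (uedges G)"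
    using G neighbours_simple(4)[OF G] by (intro card_ordered_pairs) (auto simp: simple_graph_def)
  finally show ?thesis .
qed

section \<open>Vertices of degree 1 or 2 in a tree\<close>

lemma connected_neighbours_nonempty:
  assumes "simple_graph G" "connected_ugraph G" "card (uverts G) \<ge> 2" "v \<in> uverts G"
  shows "card (neighbours (uedges G) v) \<ge> 1"
proof -
  obtain u where u: "u \<in> uverts G" "u \<noteq> v"
  proof -
    have "\<not> uverts G \<subseteq> {v}"
    proof
      assume "uverts G \<subseteq> {v}"
      from card_mono[OF _ this] show False using assms(3) by simp
    qed
    then show ?thesis using that by blast
  qed
  have "(v, u) \<in> {(x, y). {x, y} \<in> uedges G}\<^sup>*"
    using assms(2,4) u(1) by (simp add: connected_ugraph_def)
  then obtain w where "(v, w) \<in> {(x, y). {x, y} \<in> uedges G}"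
    using u(2) by (metis converse_rtranclE)
  then have "{v, w} \<in> uedges G" by simp
  then have "neighbours (uedges G) v \<noteq> {}" by (auto simp: neighbours_def)
  then show ?thesis using neighbours_simple(3)[OF assms(1)] by (simp add: Suc_le_eq card_gt_0_iff)
qed

text \<open>For degree \<open>d \<ge> 1\<close> the deficit \<open>3 - d\<close> is positive only
  for \<open>d = 1\<close>, where it is 2, and \<open>d = 2\<close>, where it is 1. Summed against
  an average degree of at most 2, these deficits must amount to at least \<open>n\<close>.\<close>

lemma tree_many_low_degree:
  assumes T: "tree_ugraph T" and n: "card (uverts T) \<ge> 2"
  shows "\<exists>k\<in>{1, 2}. card (uverts T) \<le> 4 * card {v \<in> uverts T. card (neighbours (uedges T) v) = k}"
proof -
  let ?d = "\<lambda>v. card (neighbours (uedges T) v)" and ?V = "uverts T"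
  have G: "simple_graph T" using T by (simp add: tree_ugraph_def)
  have fin: "finite ?V" using G by (simp add: simple_graph_def)
  have "3 * card ?V = (\<Sum>v\<in>?V. 3)" by simp
  also have "\<dots> \<le> (\<Sum>v\<in>?V. ?d v + 2 * (if ?d v = 1 then 1 else 0) + (if ?d v = 2 then 1 else 0))"
  proof (rule sum_mono)
    fix v assume "v \<in> ?V"
    then have "?d v \<ge> 1" using connected_neighbours_nonempty[OF G _ n] T by (simp add: tree_ugraph_def)
    then show "3 \<le> ?d v + 2 * (if ?d v = 1 then 1 else 0) + (if ?d v = 2 then 1 else 0)" by auto
  qed
  also have "\<dots> = 2 * card (uedges T) + 2 * card {v \<in> ?V. ?d v = 1} + card {v \<in> ?V. ?d v = 2}"
    using fin by (simp add: sum.distrib sum_card_neighbours[OF G] sum.If_cases Int_def flip: sum_distrib_left)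
  also have "card (uedges T) \<le> card ?V"
    using acyclic_card_edges_le[OF G] T by (simp add: tree_ugraph_def)
  finally have "card ?V \<le> 2 * card {v \<in> ?V. ?d v = 1} + card {v \<in> ?V. ?d v = 2}" by simp
  then show ?thesis by force
qed

section \<open>Families of independent exchanges\<close>

definition touched :: "('a \<times> 'a) set \<Rightarrow> 'a set" where
  "touched J = fst ` J \<union> snd ` J"

text \<open>
  Independence of the touched vertices ensures that the exchanges do not interact; disjoint
  neighbourhoods exclude exchanging two leaves with the same parent, which gains nothing.
\<close>

definition switching_family :: "'a set set \<Rightarrow> nat \<Rightarrow> ('a \<times> 'a) set \<Rightarrow> bool" where
  "switching_family E k J \<longleftrightarrow>
    (\<forall>x y. (x, y) \<in> J \<longrightarrow> x \<noteq> y \<and> card (neighbours E x) = k \<and> card (neighbours E y) = k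
      \<and> neighbours E x \<inter> neighbours E y = {}) \<and>
    (\<forall>x y x' y'. (x, y) \<in> J \<longrightarrow> (x', y') \<in> J \<longrightarrow> (x, y) \<noteq> (x', y') \<longrightarrow> {x, y} \<inter> {x', y'} = {}) \<and>
    (\<forall>u\<in>touched J. neighbours E u \<inter> touched J = {})"

lemma switching_familyD:
  assumes "switching_family E k J"
  shows "(x, y) \<in> J \<Longrightarrow> x \<noteq> y \<and> card (neighbours E x) = k \<and> card (neighbours E y) = k
      \<and> neighbours E x \<inter> neighbours E y = {}"
    and "(x, y) \<in> J \<Longrightarrow> (x', y') \<in> J \<Longrightarrow> (x, y) \<noteq> (x', y') \<Longrightarrow> {x, y} \<inter> {x', y'} = {}"
    and "u \<in> touched J \<Longrightarrow> neighbours E u \<inter> touched J = {}"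
proof -
  show "(x, y) \<in> J \<Longrightarrow> x \<noteq> y \<and> card (neighbours E x) = k \<and> card (neighbours E y) = k
      \<and> neighbours E x \<inter> neighbours E y = {}"
    using assms[unfolded switching_family_def, THEN conjunct1] by metis
  show "(x, y) \<in> J \<Longrightarrow> (x', y') \<in> J \<Longrightarrow> (x, y) \<noteq> (x', y') \<Longrightarrow> {x, y} \<inter> {x', y'} = {}"
    by (rule assms[unfolded switching_family_def, THEN conjunct2, THEN conjunct1, rule_format])
  show "u \<in> touched J \<Longrightarrow> neighbours E u \<inter> touched J = {}"
    by (rule assms[unfolded switching_family_def, THEN conjunct2, THEN conjunct2, rule_format])
qed

lemma touchedI: "(x, y) \<in> J \<Longrightarrow> x \<in> touched J" "(x, y) \<in> J \<Longrightarrow> y \<in> touched J"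
  by (force simp: touched_def)+

text \<open>Greedy choice. Each earlier pair blocks its two vertices and at most four neighbours,
  hence \<open>6 * t\<close>. The first new vertex \<open>x\<close> avoids these; the second must
  also avoid \<open>x\<close>, its at most two neighbours and their neighbours, which costs
  \<open>3 + 2 * \<Delta>\<close>. Different pairs may share neighbours.\<close>

lemma switching_family_exists:
  assumes G: "simple_graph G" and k: "k \<le> 2"
    and \<Delta>: "\<And>v. card (neighbours (uedges G) v) \<le> \<Delta>"
    and A: "A = {v \<in> uverts G. card (neighbours (uedges G) v) = k}"
    and t: "6 * t + 2 * \<Delta> \<le> card A + 2"
  shows "\<exists>J. J \<subseteq> A \<times> A \<and> finite J \<and> card J = t \<and> switching_family (uedges G) k J"
  using t
proof (induction t)
  case 0
  show ?case by (rule exI[of _ "{}"]) (simp add: switching_family_def touched_def)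
next
  case (Suc t)
  let ?N = "neighbours (uedges G)"
  obtain J where J: "J \<subseteq> A \<times> A" "finite J" "card J = t" "switching_family (uedges G) k J"
    using Suc by auto
  define I where "I = touched J"
  define U where "U = I \<union> (\<Union>v\<in>I. ?N v)"
  have finN: "finite (?N v)" for v by (rule neighbours_simple(3)[OF G])
  have finI: "finite I" using J(2) by (simp add: I_def touched_def)
  have IA: "I \<subseteq> A" using J(1) by (auto simp: I_def touched_def)
  have cI: "card I \<le> 2 * t"
    using card_Un_le[of "fst ` J" "snd ` J"] card_image_le[OF J(2), of fst] card_image_le[OF J(2), of snd] J(3)
    by (simp add: I_def touched_def)
  have "card (\<Union>v\<in>I. ?N v) \<le> (\<Sum>v\<in>I. card (?N v))" by (rule card_UN_le[OF finI])
  also have "\<dots> \<le> (\<Sum>v\<in>I. 2)" using IA k by (intro sum_mono) (auto simp: A)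
  finally have cU: "card U \<le> 6 * t"
    using cI card_Un_le[of I "\<Union>v\<in>I. ?N v"] by (simp add: U_def)
  have finU: "finite U" using finI finN by (simp add: U_def)
  have "\<not> A \<subseteq> U"
  proof
    assume "A \<subseteq> U"
    from card_mono[OF finU this] show False using cU Suc.prems by simp
  qed
  then obtain x where x: "x \<in> A" "x \<notin> U" by blast
  \<comment> \<open>Second neighbours of \<open>x\<close> are excluded too: this is what keeps the
    neighbourhoods of \<open>x\<close> and \<open>y\<close> disjoint.\<close>
  define W where "W = U \<union> insert x (?N x) \<union> (\<Union>z\<in>?N x. ?N z)"
  have kx: "card (?N x) = k" using x(1) by (simp add: A)
  have "card (\<Union>z\<in>?N x. ?N z) \<le> (\<Sum>z\<in>?N x. card (?N z))" by (rule card_UN_le[OF finN])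
  also have "\<dots> \<le> (\<Sum>z\<in>?N x. \<Delta>)" by (intro sum_mono \<Delta>)
  also have "\<dots> \<le> 2 * \<Delta>" using kx k by simp
  finally have c3: "card (\<Union>z\<in>?N x. ?N z) \<le> 2 * \<Delta>" .
  have c2: "card (insert x (?N x)) \<le> 3"
    using card_insert_le_m1[of 3 "?N x" x] kx k by simp
  have "card W \<le> card (U \<union> insert x (?N x)) + card (\<Union>z\<in>?N x. ?N z)"
    unfolding W_def by (rule card_Un_le)
  also have "\<dots> \<le> (card U + card (insert x (?N x))) + card (\<Union>z\<in>?N x. ?N z)"
    by (intro add_right_mono card_Un_le)
  also have "\<dots> \<le> (6 * t + 3) + 2 * \<Delta>"
    by (intro add_mono cU c2 c3)
  finally have cW: "card W < card A" using Suc.prems by simp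
  have "finite W" using finU finN by (simp add: W_def)
  then have "\<not> A \<subseteq> W" using card_mono[of W A] cW by (meson leD)
  then obtain y where y: "y \<in> A" "y \<notin> W" by blast
  have ky: "card (?N y) = k" using y(1) by (simp add: A)
  have xI: "x \<notin> I" "y \<notin> I" using x y by (auto simp: U_def W_def)
  have nI: "x \<notin> ?N u" "y \<notin> ?N u" if "u \<in> I" for u using x y that by (auto simp: U_def W_def)
  have xy: "x \<noteq> y" "y \<notin> ?N x" "x \<notin> ?N y" using y unfolding W_def using neighbours_sym[of x _ y] by blast+
  have disj: "?N x \<inter> ?N y = {}" using y unfolding W_def by (blast dest: neighbours_sym[THEN iffD1])
  have loop: "u \<notin> ?N u" for u by (rule neighbours_simple(2)[OF G])
  have nI': "?N x \<inter> I = {}" "?N y \<inter> I = {}"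
    using nI by (blast dest: neighbours_sym[THEN iffD1])+
  note JA = switching_familyD(1)[OF J(4)] and JB = switching_familyD(2)[OF J(4)]
  note JC = switching_familyD(3)[OF J(4), folded I_def]
  define J' where "J' = insert (x, y) J"
  have tJ: "touched J' = insert x (insert y I)" by (auto simp: J'_def touched_def I_def)
  have inI: "a \<in> I \<and> b \<in> I" if "(a, b) \<in> J" for a b using that by (force simp: I_def touched_def)
  have "(x, y) \<notin> J" using xI inI by blast
  then have "card J' = Suc t" using J by (simp add: J'_def)
  moreover have "switching_family (uedges G) k J'"
    unfolding switching_family_def
  proof (intro conjI)
    show "\<forall>a b. (a, b) \<in> J' \<longrightarrow> a \<noteq> b \<and> card (?N a) = k \<and> card (?N b) = k \<and> ?N a \<inter> ?N b = {}"
    proof (intro allI impI)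
      fix a b assume "(a, b) \<in> J'"
      then consider "a = x \<and> b = y" | "(a, b) \<in> J" by (auto simp: J'_def)
      then show "a \<noteq> b \<and> card (?N a) = k \<and> card (?N b) = k \<and> ?N a \<inter> ?N b = {}"
      proof cases
        case 1
        then show ?thesis using xy(1) disj kx ky by simp
      next
        case 2
        then show ?thesis by (rule JA)
      qed
    qed
    show "\<forall>a b a' b'. (a, b) \<in> J' \<longrightarrow> (a', b') \<in> J' \<longrightarrow> (a, b) \<noteq> (a', b') \<longrightarrow> {a, b} \<inter> {a', b'} = {}"
    proof (intro allI impI)
      have new: "{a, b} \<inter> {x, y} = {}" if "(a, b) \<in> J" for a b using inI[OF that] xI by auto
      fix a b a' b' assume u: "(a, b) \<in> J'" and v: "(a', b') \<in> J'" and ne: "(a, b) \<noteq> (a', b')"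
      show "{a, b} \<inter> {a', b'} = {}"
      proof (cases "(a, b) \<in> J")
        case True
        show ?thesis
        proof (cases "(a', b') \<in> J")
          case True': True
          show ?thesis by (rule JB[OF True True' ne])
        next
          case False
          then have "a' = x \<and> b' = y" using v by (simp add: J'_def)
          then show ?thesis using new[OF True] by simp
        qed
      next
        case False
        then have e: "a = x \<and> b = y" using u by (simp add: J'_def)
        have "(a', b') \<in> J" using v ne e unfolding J'_def by fastforce
        from new[OF this] show ?thesis using e by (simp add: Int_commute)
      qed
    qed
    show "\<forall>u\<in>touched J'. ?N u \<inter> touched J' = {}"
    proof
      fix u assume "u \<in> touched J'"
      then consider "u = x" | "u = y" | "u \<in> I" using tJ by auto
      then show "?N u \<inter> touched J' = {}"
      proof cases
        case 3
        then show ?thesis using nI[OF 3] JC[OF 3] by (simp add: tJ)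
      next
        case 1
        then show ?thesis using nI'(1) xy(2) loop[of x] unfolding tJ by blast
      next
        case 2
        then show ?thesis using nI'(2) xy(3) loop[of y] unfolding tJ by blast
      qed
    qed
  qed
  moreover have "J' \<subseteq> A \<times> A" "finite J'" using J x y by (auto simp: J'_def)
  ultimately show ?case by blast
qed

lemma tree_switching_family:
  assumes T: "tree_ugraph T" and n: "card (uverts T) = n" "n \<ge> 200"
    and \<Delta>: "\<And>v. card (neighbours (uedges T) v) \<le> \<Delta>" "100 * \<Delta> \<le> n"
  obtains k J where "k \<in> {1, 2}" "J \<subseteq> uverts T \<times> uverts T" "finite J" "n \<le> 40 * card J" "card J \<le> n"
    "switching_family (uedges T) k J"
proof -
  have G: "simple_graph T" using T by (simp add: tree_ugraph_def)
  obtain k where k: "k \<in> {1, 2}"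
    "n \<le> 4 * card {v \<in> uverts T. card (neighbours (uedges T) v) = k}"
    using tree_many_low_degree[OF T] n by auto
  define A where "A = {v \<in> uverts T. card (neighbours (uedges T) v) = k}"
  have k2: "k \<le> 2" using k(1) by auto
  \<comment> \<open>Rounding \<open>n / 40\<close> up gives \<open>n \<le> 40 * card J\<close>. The
    greedy choice fits, since \<open>6 * n / 40 + 2 * n / 100\<close> is below \<open>n / 4\<close>
    by a margin exceeding the additive constant for \<open>n \<ge> 200\<close>.\<close>
  have "6 * Suc (n div 40) + 2 * \<Delta> \<le> card A + 2"
  proof -
    define m where "m = n div 40"
    have "40 * m \<le> n" by (simp add: m_def)
    have arith: "6 * m + 6 + 2 * d \<le> a + 2"
      if "40 * m \<le> x" "x \<le> 4 * a" "100 * d \<le> x" "200 \<le> x" for m x a d :: real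
      using that by argo
    have "6 * real m + 6 + 2 * real \<Delta> \<le> real (card A) + 2"
      using of_nat_mono[OF \<open>40 * m \<le> n\<close>, where 'a = real] of_nat_mono[OF k(2), where 'a = real]
        of_nat_mono[OF \<Delta>(2), where 'a = real] n(2)
      by (intro arith[of _ "real n"]) (simp_all add: A_def)
    then have "real (6 * Suc m + 2 * \<Delta>) \<le> real (card A + 2)" by simp
    then show ?thesis unfolding m_def[symmetric] of_nat_le_iff .
  qed
  from switching_family_exists[OF G k2 \<Delta>(1) A_def this]
  obtain J where J: "J \<subseteq> A \<times> A" "finite J" "card J = Suc (n div 40)" "switching_family (uedges T) k J"
    by blast
  show ?thesis
  proof (rule that[OF k(1) _ J(2) _ _ J(4)])
    show "J \<subseteq> uverts T \<times> uverts T" using J(1) by (auto simp: A_def)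
    show "n \<le> 40 * card J" using J(3) by linarith
    show "card J \<le> n" using J(3) n(2) by linarith
  qed
qed

section \<open>Exchanging images\<close>

lemma sum_edges_split:
  fixes f :: "'a set \<Rightarrow> int"
  assumes G: "simple_graph G" and xy: "x \<noteq> y" "y \<notin> neighbours (uedges G) x"
  shows "(\<Sum>e\<in>uedges G. f e) = (\<Sum>e | e \<in> uedges G \<and> x \<notin> e \<and> y \<notin> e. f e)
    + ((\<Sum>z\<in>neighbours (uedges G) x. f {x, z}) + (\<Sum>z\<in>neighbours (uedges G) y. f {y, z}))"
proof -
  let ?E = "uedges G" let ?N = "neighbours (uedges G)"
  have star: "(\<Sum>e | e \<in> ?E \<and> v \<in> e. f e) = (\<Sum>z\<in>?N v. f {v, z})" for v
    using star_eq_image_neighbours[OF G, of v] by (simp add: sum.reindex inj_on_doubleton)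
  have fin: "finite ?E" by (rule neighbours_simple(4)[OF G])
  have two: "\<not> (x \<in> e \<and> y \<in> e)" if "e \<in> ?E" for e
  proof
    assume *: "x \<in> e \<and> y \<in> e"
    obtain a b where "e = {a, b}" using G \<open>e \<in> ?E\<close> by (auto simp: simple_graph_def card_2_iff)
    then have "e = {x, y}" using * xy(1) by auto
    then show False using that xy(2) by (simp add: neighbours_def)
  qed
  have E: "?E = {e \<in> ?E. x \<notin> e \<and> y \<notin> e} \<union> ({e \<in> ?E. x \<in> e} \<union> {e \<in> ?E. y \<in> e})" by blast
  have "(\<Sum>e\<in>?E. f e) = (\<Sum>e | e \<in> ?E \<and> x \<notin> e \<and> y \<notin> e. f e)
      + (\<Sum>e\<in>{e \<in> ?E. x \<in> e} \<union> {e \<in> ?E. y \<in> e}. f e)"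
    using fin by (subst E, subst sum.union_disjoint) auto
  also have "(\<Sum>e\<in>{e \<in> ?E. x \<in> e} \<union> {e \<in> ?E. y \<in> e}. f e)
      = (\<Sum>e | e \<in> ?E \<and> x \<in> e. f e) + (\<Sum>e | e \<in> ?E \<and> y \<in> e. f e)"
    using fin two by (intro sum.union_disjoint) auto
  finally show ?thesis by (simp add: star)
qed

definition swap_gain :: "('b set \<Rightarrow> int) \<Rightarrow> 'a set set \<Rightarrow> ('a \<Rightarrow> 'b) \<Rightarrow> 'a \<Rightarrow> 'a \<Rightarrow> int" where
  "swap_gain D E \<phi> x y = (\<Sum>z\<in>neighbours E x. D {\<phi> y, \<phi> z} - D {\<phi> x, \<phi> z})
    + (\<Sum>z\<in>neighbours E y. D {\<phi> x, \<phi> z} - D {\<phi> y, \<phi> z})"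

lemma sum_edges_after_swap:
  assumes G: "simple_graph G" and xy: "x \<noteq> y" "y \<notin> neighbours (uedges G) x"
  shows "(\<Sum>e\<in>uedges G. D ((\<phi>(x := \<phi> y, y := \<phi> x)) ` e))
    = (\<Sum>e\<in>uedges G. D (\<phi> ` e)) + swap_gain D (uedges G) \<phi> x y"
proof -
  let ?\<psi> = "\<phi>(x := \<phi> y, y := \<phi> x)" let ?N = "neighbours (uedges G)"
  have yx: "x \<notin> ?N y" using xy(2) neighbours_sym by metis
  have lx: "x \<notin> ?N x" "y \<notin> ?N y" using neighbours_simple(2)[OF G] by auto
  have rest: "(\<Sum>e | e \<in> uedges G \<and> x \<notin> e \<and> y \<notin> e. D (?\<psi> ` e)) = (\<Sum>e | e \<in> uedges G \<and> x \<notin> e \<and> y \<notin> e. D (\<phi> ` e))"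
    by (intro sum.cong refl arg_cong[where f = D] image_cong) auto
  have x: "(\<Sum>z\<in>?N x. D (?\<psi> ` {x, z})) = (\<Sum>z\<in>?N x. D {\<phi> y, \<phi> z})"
    using lx(1) xy by (intro sum.cong refl arg_cong[where f = D]) auto
  have y: "(\<Sum>z\<in>?N y. D (?\<psi> ` {y, z})) = (\<Sum>z\<in>?N y. D {\<phi> x, \<phi> z})"
    using lx(2) yx by (intro sum.cong refl arg_cong[where f = D]) auto
  have e: "D (\<phi> ` {v, z}) = D {\<phi> v, \<phi> z}" for v z by simp
  show ?thesis
    unfolding sum_edges_split[OF G xy, of "\<lambda>e. D (?\<psi> ` e)"] sum_edges_split[OF G xy, of "\<lambda>e. D (\<phi> ` e)"]
      rest x y e swap_gain_def
    by (simp add: sum_subtractf)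
qed

text \<open>Neighbours of touched vertices are never touched, and distinct pairs are disjoint. So
  earlier exchanges change no image that enters the gain of a later one, and all gains can be
  evaluated at the original \<open>\<phi>\<close>. One \<open>\<psi>\<close> serves all
  \<open>D\<close>, hence all colours at once.\<close>

lemma switch_family_subset:
  assumes G: "simple_graph G" and J: "switching_family (uedges G) k J" "J \<subseteq> uverts G \<times> uverts G"
    and S: "finite S" "S \<subseteq> J" and \<phi>: "bij_betw \<phi> (uverts G) B"
  shows "\<exists>\<psi>. bij_betw \<psi> (uverts G) B \<and> (\<forall>v. v \<notin> touched S \<longrightarrow> \<psi> v = \<phi> v) \<and>
    (\<forall>D. (\<Sum>e\<in>uedges G. D (\<psi> ` e)) = (\<Sum>e\<in>uedges G. D (\<phi> ` e)) + (\<Sum>(x, y)\<in>S. swap_gain D (uedges G) \<phi> x y))"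
  using S
proof (induction S rule: finite_induct)
  case empty
  show ?case using \<phi> by (intro exI[of _ \<phi>]) simp
next
  case (insert p S)
  let ?N = "neighbours (uedges G)"
  obtain x y where p: "p = (x, y)" by fastforce
  obtain \<psi> where \<psi>: "bij_betw \<psi> (uverts G) B" "\<And>v. v \<notin> touched S \<Longrightarrow> \<psi> v = \<phi> v"
    "\<And>D. (\<Sum>e\<in>uedges G. D (\<psi> ` e)) = (\<Sum>e\<in>uedges G. D (\<phi> ` e)) + (\<Sum>(x, y)\<in>S. swap_gain D (uedges G) \<phi> x y)"
    using insert by blast
  have pJ: "(x, y) \<in> J" using insert.prems p by simp
  have JA: "x \<noteq> y" using switching_familyD(1)[OF J(1) pJ] by blast
  have JB: "{x, y} \<inter> {a, b} = {}" if "(a, b) \<in> S" for a b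
    using that insert.hyps insert.prems p by (intro switching_familyD(2)[OF J(1) pJ]) auto
  have tS: "touched S \<subseteq> touched J" using insert.prems by (auto simp: touched_def)
  note tx = touchedI[OF pJ]
  have JC: "?N x \<inter> touched J = {}" "?N y \<inter> touched J = {}"
    by (rule switching_familyD(3)[OF J(1)], rule tx)+
  have nxy: "y \<notin> ?N x" using JC tx by blast
  have xS: "x \<notin> touched S" "y \<notin> touched S"
    using JB by (force simp: touched_def)+
  have same: "swap_gain D (uedges G) \<psi> x y = swap_gain D (uedges G) \<phi> x y" for D
  proof -
    have "\<psi> z = \<phi> z" if "z \<in> ?N x \<union> ?N y" for z using that JC tS \<psi>(2) by blast
    then show ?thesis using \<psi>(2)[OF xS(1)] \<psi>(2)[OF xS(2)] by (simp add: swap_gain_def)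
  qed
  define \<chi> where "\<chi> = \<psi>(x := \<psi> y, y := \<psi> x)"
  have xyV: "x \<in> uverts G" "y \<in> uverts G" using pJ J(2) by auto
  have "\<chi> = \<psi> \<circ> Transposition.transpose x y" by (auto simp: \<chi>_def fun_eq_iff Transposition.transpose_def)
  moreover have "bij_betw (Transposition.transpose x y) (uverts G) (uverts G)"
    using xyV by (intro permutes_imp_bij permutes_swap_id)
  ultimately have "bij_betw \<chi> (uverts G) B" using \<psi>(1) by (simp add: bij_betw_trans)
  moreover have "\<chi> v = \<phi> v" if "v \<notin> touched (insert p S)" for v
    using that \<psi>(2)[of v] by (simp add: \<chi>_def p touched_def)
  moreover have "(\<Sum>e\<in>uedges G. D (\<chi> ` e)) = (\<Sum>e\<in>uedges G. D (\<phi> ` e))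
      + (\<Sum>(x, y)\<in>insert p S. swap_gain D (uedges G) \<phi> x y)" for D
  proof -
    have "(\<Sum>(x, y)\<in>insert p S. swap_gain D (uedges G) \<phi> x y)
        = swap_gain D (uedges G) \<phi> x y + (\<Sum>(x, y)\<in>S. swap_gain D (uedges G) \<phi> x y)"
      using insert.hyps by (simp add: p)
    then show ?thesis
      using sum_edges_after_swap[OF G JA nxy, of D \<psi>] \<psi>(3)[of D] same[of D] by (simp add: \<chi>_def)
  qed
  ultimately show ?case by blast
qed

section \<open>Gains as functions of lists of images\<close>

definition neighbour_list :: "nat set set \<Rightarrow> nat \<Rightarrow> nat list" where
  "neighbour_list E v = sorted_list_of_set (neighbours E v)"

text \<open>Collects exactly the vertices whose images determine the gain of an exchange, so that
  the averages over permutations apply to it. Position \<open>2 + l\<close> holds a neighbour of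
  \<open>x\<close> and position \<open>2 + k + l\<close> the neighbour of \<open>y\<close> matched
  with it; any matching would do.\<close>

definition switch_list :: "nat set set \<Rightarrow> nat \<times> nat \<Rightarrow> nat list" where
  "switch_list E = (\<lambda>(x, y). [x, y] @ neighbour_list E x @ neighbour_list E y)"

definition list_gain :: "(nat set \<Rightarrow> nat) \<Rightarrow> nat \<Rightarrow> nat \<Rightarrow> nat list \<Rightarrow> int" where
  "list_gain c k i ys = (\<Sum>l<k. alternating (colour_diff c i) (ys ! 0) (ys ! 1) (ys ! (2 + l)) (ys ! (2 + k + l)))"

text \<open>Equal degrees allow the neighbours of \<open>x\<close> and \<open>y\<close> to be
  matched one to one, each match contributing one alternating sum.\<close>

lemma swap_gain_eq_list_gain:
  assumes G: "simple_graph G" and k: "card (neighbours (uedges G) x) = k" "card (neighbours (uedges G) y) = k"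
    and i: "i \<noteq> 1"
  shows "swap_gain (\<lambda>s. of_bool (c s = 1) - of_bool (c s = i)) (uedges G) \<phi> x y
    = list_gain c k i (map \<phi> (switch_list (uedges G) (x, y)))"
proof -
  let ?N = "neighbours (uedges G)" let ?L = "neighbour_list (uedges G)"
  let ?D = "\<lambda>s. of_bool (c s = 1) - of_bool (c s = i) :: int"
  have D: "?D {a, b} = colour_diff c i a b" for a b using i by (simp add: colour_diff_def)
  have len: "length (?L v) = card (?N v)" and set: "set (?L v) = ?N v" and dist: "distinct (?L v)" for v
    using neighbours_simple(3)[OF G] by (simp_all add: neighbour_list_def)
  have sum: "(\<Sum>z\<in>?N v. f z) = (\<Sum>l<k. f (?L v ! l))" if "card (?N v) = k" for v and f :: "nat \<Rightarrow> int"
  proof -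
    have "bij_betw ((!) (?L v)) {..<k} (?N v)"
      using dist len that set by (intro bij_betw_nth) auto
    from sum.reindex_bij_betw[OF this, of f] show ?thesis by simp
  qed
  have n1: "map \<phi> (switch_list (uedges G) (x, y)) ! (2 + l) = \<phi> (?L x ! l)" if "l < k" for l
    using that len k by (simp add: switch_list_def nth_append)
  have n2: "map \<phi> (switch_list (uedges G) (x, y)) ! (2 + k + l) = \<phi> (?L y ! l)" if "l < k" for l
    using that len k by (simp add: switch_list_def nth_append)
  have "swap_gain ?D (uedges G) \<phi> x y
      = (\<Sum>l<k. alternating (colour_diff c i) (\<phi> x) (\<phi> y) (\<phi> (?L x ! l)) (\<phi> (?L y ! l)))"
    unfolding swap_gain_def sum[OF k(1)] sum[OF k(2)] D alternating_def
    by (simp add: sum.distrib sum_subtractf)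
  also have "\<dots> = list_gain c k i (map \<phi> (switch_list (uedges G) (x, y)))"
    unfolding list_gain_def using n1 n2
    by (intro sum.cong refl) (simp add: switch_list_def)
  finally show ?thesis .
qed

section \<open>Profitable exchanges\<close>

text \<open>Each of the \<open>k\<close> alternating sums is required to be profitable, not just
  their total, because the passage to a weighted combination of colours works one quadruple at a
  time.\<close>

definition good_lists :: "(nat set \<Rightarrow> nat) \<Rightarrow> nat \<Rightarrow> nat \<Rightarrow> nat list set" where
  "good_lists c k i = {ys. \<forall>l<k. alternating (colour_diff c i) (ys ! 0) (ys ! 1) (ys ! (2 + l)) (ys ! (2 + k + l)) \<ge> 1}"

lemma card_good_lists_1:
  assumes P: "\<rho> * real n ^ 4 \<le> card {(a, d, z, z'). a < n \<and> d < n \<and> z < n \<and> z' < n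
    \<and> distinct [a, d, z, z'] \<and> alternating (colour_diff c i) a d z z' \<ge> 1}"
  shows "\<rho> * real n ^ 4 \<le> card (good_lists c 1 i \<inter> dist_lists n 4)"
proof -
  define Q where "Q = {(a, d, z, z'). a < n \<and> d < n \<and> z < n \<and> z' < n
    \<and> distinct [a, d, z, z'] \<and> alternating (colour_diff c i) a d z z' \<ge> 1}"
  have "card Q \<le> card (good_lists c 1 i \<inter> dist_lists n 4)"
  proof (rule card_inj_on_le)
    show "inj_on (\<lambda>(a, d, z, z'). [a, d, z, z']) Q" by (auto simp: inj_on_def)
    show "(\<lambda>(a, d, z, z'). [a, d, z, z']) ` Q \<subseteq> good_lists c 1 i \<inter> dist_lists n 4"
      by (auto simp: Q_def good_lists_def dist_lists_def)
  qed simp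
  then show ?thesis using P unfolding Q_def by linarith
qed

lemma square_sum_le:
  fixes f :: "'a \<Rightarrow> real"
  assumes "finite A"
  shows "(\<Sum>x\<in>A. f x)\<^sup>2 \<le> (\<Sum>x\<in>A. (f x)\<^sup>2) * card A"
proof (cases "A = {}")
  case False
  define N where "N = real (card A)"
  define S where "S = (\<Sum>x\<in>A. f x)"
  have N: "N > 0" using assms False by (simp add: N_def card_gt_0_iff)
  have "0 \<le> (\<Sum>x\<in>A. (f x - S / N)\<^sup>2)" by (intro sum_nonneg) simp
  also have "\<dots> = (\<Sum>x\<in>A. (f x)\<^sup>2) + N * (S / N)\<^sup>2 - (\<Sum>x\<in>A. 2 * f x * (S / N))"
    by (simp add: power2_diff sum.distrib sum_subtractf N_def)
  also have "(\<Sum>x\<in>A. 2 * f x * (S / N)) = 2 * S * (S / N)"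
    by (simp only: S_def sum_distrib_left sum_distrib_right)
  finally have "S\<^sup>2 / N \<le> (\<Sum>x\<in>A. (f x)\<^sup>2)" using N by (simp add: power2_eq_square)
  then show ?thesis using N by (simp add: pos_divide_le_eq S_def N_def)
qed simp

text \<open>The density drops from \<open>\<rho>\<close> to \<open>\<rho>\<^sup>2 / 2\<close>: a
  square from Cauchy-Schwarz, and a half because \<open>8 \<le> \<rho>\<^sup>2 * n\<close> keeps the
  \<open>4 * n ^ 5\<close> degenerate configurations below half of the total.\<close>

lemma card_good_lists_2:
  assumes \<rho>: "0 < \<rho>" and n: "8 \<le> \<rho>\<^sup>2 * n"
    and P: "\<rho> * real n ^ 4 \<le> card {(a, d, z, z'). a < n \<and> d < n \<and> z < n \<and> z' < n
    \<and> distinct [a, d, z, z'] \<and> alternating (colour_diff c i) a d z z' \<ge> 1}"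
  shows "\<rho>\<^sup>2 / 2 * real n ^ 6 \<le> card (good_lists c 2 i \<inter> dist_lists n 6)"
proof -
  let ?N = "{..<n}"
  define h where "h = colour_diff c i"
  define B where "B = (\<lambda>(a, d). {(z, z'). z < n \<and> z' < n \<and> distinct [a, d, z, z'] \<and> alternating h a d z z' \<ge> 1})"
  have finB: "finite (B u)" for u
    by (rule finite_subset[of _ "?N \<times> ?N"]) (auto simp: B_def split: prod.splits)
  have n0: "n > 0" using n by (cases n) auto
  have "card (Sigma (?N \<times> ?N) B) = card ((\<lambda>((a, d), (z, z')). (a, d, z, z')) ` Sigma (?N \<times> ?N) B)"
    by (rule card_image[symmetric]) (auto simp: inj_on_def)
  also have "(\<lambda>((a, d), (z, z')). (a, d, z, z')) ` Sigma (?N \<times> ?N) B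
      = {(a, d, z, z'). a < n \<and> d < n \<and> z < n \<and> z' < n \<and> distinct [a, d, z, z'] \<and> alternating h a d z z' \<ge> 1}"
    by (auto simp: B_def image_iff)
  finally have "\<rho> * real n ^ 4 \<le> card (Sigma (?N \<times> ?N) B)" using P by (simp add: h_def)
  then have S1: "\<rho> * real n ^ 4 \<le> (\<Sum>u\<in>?N \<times> ?N. real (card (B u)))" using finB by simp
  have "(\<rho> * real n ^ 4)\<^sup>2 \<le> (\<Sum>u\<in>?N \<times> ?N. real (card (B u)))\<^sup>2"
    using S1 \<rho> by (intro power_mono) auto
  also have "\<dots> \<le> (\<Sum>u\<in>?N \<times> ?N. (real (card (B u)))\<^sup>2) * card (?N \<times> ?N)"
    by (rule square_sum_le) simp
  also have "real (card (?N \<times> ?N)) = (real n)\<^sup>2" by (simp add: card_cartesian_product power2_eq_square)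
  finally have "(\<rho>\<^sup>2 * real n ^ 6) * (real n)\<^sup>2 \<le> (\<Sum>u\<in>?N \<times> ?N. (real (card (B u)))\<^sup>2) * (real n)\<^sup>2"
    by (simp add: power_mult_distrib mult.assoc flip: power_mult power_add)
  then have S2: "\<rho>\<^sup>2 * real n ^ 6 \<le> (\<Sum>u\<in>?N \<times> ?N. (real (card (B u)))\<^sup>2)"
    using n0 by simp
  define W where "W = Sigma (?N \<times> ?N) (\<lambda>u. B u \<times> B u)"
  have finW: "finite W" using finB by (simp add: W_def)
  have cW: "real (card W) = (\<Sum>u\<in>?N \<times> ?N. (real (card (B u)))\<^sup>2)"
    unfolding W_def using finB by (simp add: card_cartesian_product power2_eq_square)
  \<comment> \<open>Cauchy-Schwarz over \<open>(a, d)\<close> yields pairs of profitable quadruples sharing \<open>(a, d)\<close>; those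
    with a further coincidence are of lower order.\<close>
  define D where "D = {((a, d), ((z1, w1), (z2, w2))). distinct [z1, z2, w1, w2] \<and> ((a, d), ((z1, w1), (z2, w2))) \<in> W}"
  define f1 where "f1 = (\<lambda>(a, d, z, w, v). ((a, d), ((z, w), (z, v))) :: (nat \<times> nat) \<times> (nat \<times> nat) \<times> (nat \<times> nat))"
  define f2 where "f2 = (\<lambda>(a, d, z, w, v). ((a, d), ((z, w), (v, z))) :: (nat \<times> nat) \<times> (nat \<times> nat) \<times> (nat \<times> nat))"
  define f3 where "f3 = (\<lambda>(a, d, z, w, v). ((a, d), ((z, w), (w, v))) :: (nat \<times> nat) \<times> (nat \<times> nat) \<times> (nat \<times> nat))"
  define f4 where "f4 = (\<lambda>(a, d, z, w, v). ((a, d), ((z, w), (v, w))) :: (nat \<times> nat) \<times> (nat \<times> nat) \<times> (nat \<times> nat))"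
  let ?T = "?N \<times> ?N \<times> ?N \<times> ?N \<times> ?N"
  have "W \<subseteq> D \<union> ((f1 ` ?T \<union> f2 ` ?T) \<union> (f3 ` ?T \<union> f4 ` ?T))"
  proof
    fix t assume t: "t \<in> W"
    obtain a d z1 w1 z2 w2 where e: "t = ((a, d), ((z1, w1), (z2, w2)))"
      by (metis surj_pair)
    have lt: "a < n" "d < n" "z1 < n" "w1 < n" "z2 < n" "w2 < n" and ne: "z1 \<noteq> w1" "z2 \<noteq> w2"
      using t by (auto simp: e W_def B_def)
    consider "distinct [z1, z2, w1, w2]" | "z1 = z2" | "z1 = w2" | "w1 = z2" | "w1 = w2"
      using ne by auto
    then show "t \<in> D \<union> ((f1 ` ?T \<union> f2 ` ?T) \<union> (f3 ` ?T \<union> f4 ` ?T))"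
    proof cases
      case 1
      then show ?thesis using t by (simp add: D_def e)
    next
      case 2
      then have "t = f1 (a, d, z1, w1, w2)" by (simp add: f1_def e)
      then show ?thesis using lt by blast
    next
      case 3
      then have "t = f2 (a, d, z1, w1, z2)" by (simp add: f2_def e)
      then show ?thesis using lt by blast
    next
      case 4
      then have "t = f3 (a, d, z1, w1, w2)" by (simp add: f3_def e)
      then show ?thesis using lt by blast
    next
      case 5
      then have "t = f4 (a, d, z1, w1, z2)" by (simp add: f4_def e)
      then show ?thesis using lt by blast
    qed
  qed
  moreover have finD: "finite D" by (rule finite_subset[OF _ finW]) (auto simp: D_def)
  ultimately have "card W \<le> card (D \<union> ((f1 ` ?T \<union> f2 ` ?T) \<union> (f3 ` ?T \<union> f4 ` ?T)))"
    by (intro card_mono) auto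
  also have "\<dots> \<le> card D + ((card (f1 ` ?T) + card (f2 ` ?T)) + (card (f3 ` ?T) + card (f4 ` ?T)))"
    by (intro order.trans[OF card_Un_le] add_mono card_Un_le order.refl)
  also have "\<dots> \<le> card D + ((n ^ 5 + n ^ 5) + (n ^ 5 + n ^ 5))"
  proof -
    have "card (f ` ?T) \<le> n ^ 5" for f :: "nat \<times> nat \<times> nat \<times> nat \<times> nat \<Rightarrow> (nat \<times> nat) \<times> (nat \<times> nat) \<times> (nat \<times> nat)"
      using card_image_le[of ?T f] by (simp add: card_cartesian_product power_numeral_reduce mult_ac)
    then show ?thesis by (intro add_mono order.refl)
  qed
  finally have "card W \<le> card D + 4 * n ^ 5" by simp
  then have cD: "real (card W) \<le> real (card D) + 4 * real n ^ 5"
    using of_nat_mono[where 'a = real] by fastforce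
  have "8 * real n ^ 5 \<le> \<rho>\<^sup>2 * n * real n ^ 5" using n by (intro mult_right_mono) auto
  also have "\<dots> = \<rho>\<^sup>2 * real n ^ 6" by (simp add: power_numeral_reduce mult_ac)
  finally have "\<rho>\<^sup>2 / 2 * real n ^ 6 \<le> card D" using cD cW S2 by simp
  also have "card D \<le> card (good_lists c 2 i \<inter> dist_lists n 6)"
  proof (rule card_inj_on_le)
    show "inj_on (\<lambda>((a, d), ((z1, w1), (z2, w2))). [a, d, z1, z2, w1, w2]) D" by (auto simp: inj_on_def)
    show "(\<lambda>((a, d), ((z1, w1), (z2, w2))). [a, d, z1, z2, w1, w2]) ` D \<subseteq> good_lists c 2 i \<inter> dist_lists n 6"
    proof (rule subsetI, elim imageE)
      fix ys t assume t: "t \<in> D" and ys: "ys = (\<lambda>((a, d), ((z1, w1), (z2, w2))). [a, d, z1, z2, w1, w2]) t"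
      obtain a d z1 w1 z2 w2 where e: "t = ((a, d), ((z1, w1), (z2, w2)))"
        by (metis surj_pair)
      have "ys = [a, d, z1, z2, w1, w2]" by (simp add: ys e)
      moreover have "alternating h a d z1 w1 \<ge> 1" "alternating h a d z2 w2 \<ge> 1"
        "distinct [a, d, z1, z2, w1, w2]" "set [a, d, z1, z2, w1, w2] \<subseteq> ?N"
        using t by (auto simp: e D_def W_def B_def)
      ultimately show "ys \<in> good_lists c 2 i \<inter> dist_lists n 6"
        by (auto simp: good_lists_def dist_lists_def h_def less_2_cases_iff)
    qed
  qed simp
  finally show ?thesis by simp
qed

text \<open>The weighted combination depends only on the colour of an edge: it is \<open>W\<close>
  on colour 1 and \<open>- w x\<close> on any other colour \<open>x\<close>. The colour
  \<open>j\<close> depends on \<open>w\<close> alone, not on the quadruple, so one set of profitable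
  exchanges serves a given \<open>w\<close>.\<close>

lemma weighted_gain:
  fixes w :: "nat \<Rightarrow> real" and c :: "nat set \<Rightarrow> nat"
  assumes w: "\<And>i. i \<in> {2..r} \<Longrightarrow> w i \<ge> 0" and col: "\<And>x y. x < n \<Longrightarrow> y < n \<Longrightarrow> x \<noteq> y \<Longrightarrow> c {x, y} \<in> {1..r}"
    and r: "r \<ge> 1"
  defines "W \<equiv> \<Sum>i\<in>{2..r}. w i"
  shows "\<exists>j\<in>{1..r}. \<forall>a d z z'. a < n \<longrightarrow> d < n \<longrightarrow> z < n \<longrightarrow> z' < n \<longrightarrow> distinct [a, d, z, z'] \<longrightarrow>
    alternating (colour_diff c j) a d z z' \<ge> 1 \<longrightarrow>
    W / 5 \<le> (\<Sum>i\<in>{2..r}. w i * alternating (colour_diff c i) a d z z')"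
proof -
  define g where "g x = (if x = 1 then W else - w x)" for x :: nat
  have W0: "W \<ge> 0" using w by (auto simp: W_def intro: sum_nonneg)
  have g: "(\<Sum>i\<in>{2..r}. w i * colour_diff c i x y) = g (c {x, y})" if "x < n" "y < n" "x \<noteq> y" for x y
  proof (cases "c {x, y} = 1")
    case True
    have "(\<Sum>i\<in>{2..r}. w i * colour_diff c i x y) = (\<Sum>i\<in>{2..r}. w i)"
      by (intro sum.cong refl) (simp add: colour_diff_def True)
    then show ?thesis by (simp add: g_def True W_def)
  next
    case False
    then have c2: "c {x, y} \<in> {2..r}" using col[OF that] by auto
    have "(\<Sum>i\<in>{2..r}. w i * colour_diff c i x y) = (\<Sum>i\<in>{2..r}. if i = c {x, y} then - w i else 0)"
      using False by (intro sum.cong refl) (auto simp: colour_diff_def)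
    also have "\<dots> = - w (c {x, y})" using c2 by simp
    finally show ?thesis using False by (simp add: g_def del: One_nat_def)
  qed
  have alt: "(\<Sum>i\<in>{2..r}. w i * alternating (colour_diff c i) a d z z')
      = g (c {d, z}) - g (c {a, z}) + g (c {a, z'}) - g (c {d, z'})"
    if "a < n" "d < n" "z < n" "z' < n" "distinct [a, d, z, z']" for a d z z'
    using that by (simp add: alternating_def distrib_left right_diff_distrib sum.distrib sum_subtractf g)
  have wW: "w i \<le> W" if "i \<in> {2..r}" for i
    unfolding W_def using w that by (intro member_le_sum) auto
  \<comment> \<open>The threshold \<open>4 / 5\<close> suits both cases. Without a dominant colour
    one non-1 entry can cancel at most \<open>4 / 5 * W\<close> of a net gain \<open>W\<close>. With
    a dominant colour each of four entries differs from \<open>W * h\<close> by at most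
    \<open>W / 5\<close>. Either way \<open>W / 5\<close> remains.\<close>
  show ?thesis
  proof (cases "\<exists>j\<in>{2..r}. w j > 4 / 5 * W")
    case False
    have gb: "g x \<le> 0" "g x \<ge> - (4 / 5 * W)" if "x \<in> {1..r}" "x \<noteq> 1" for x
      using w[of x] False that by (auto simp: g_def not_less)
    have key: "W / 5 \<le> g p1 - g p2 + g p3 - g p4"
      if "p1 \<in> {1..r}" "p2 \<in> {1..r}" "p3 \<in> {1..r}" "p4 \<in> {1..r}"
        "of_bool (p1 = 1) - of_bool (p2 = 1) + of_bool (p3 = 1) - of_bool (p4 = 1) \<ge> (1::int)" for p1 p2 p3 p4
    proof -
      have g1: "g 1 = W" by (simp add: g_def)
      show ?thesis
        using that(5) gb[OF that(1)] gb[OF that(2)] gb[OF that(3)] gb[OF that(4)] W0 g1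
        by (cases "p1 = 1"; cases "p2 = 1"; cases "p3 = 1"; cases "p4 = 1"; simp)
    qed
    show ?thesis
    proof (intro bexI[of _ 1] allI impI)
      fix a d z z' assume lt: "a < n" "d < n" "z < n" "z' < n" and di: "distinct [a, d, z, z']"
        and al: "1 \<le> alternating (colour_diff c 1) a d z z'"
      have "W / 5 \<le> g (c {d, z}) - g (c {a, z}) + g (c {a, z'}) - g (c {d, z'})"
      proof (rule key)
        show "c {d, z} \<in> {1..r}" "c {a, z} \<in> {1..r}" "c {a, z'} \<in> {1..r}" "c {d, z'} \<in> {1..r}"
          using col[OF lt(2,3)] col[OF lt(1,3)] col[OF lt(1,4)] col[OF lt(2,4)] di by simp_all
      qed (use al in \<open>simp add: alternating_def colour_diff_def\<close>)
      then show "W / 5 \<le> (\<Sum>i\<in>{2..r}. w i * alternating (colour_diff c i) a d z z')"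
        using alt[OF lt di] by simp
    qed (use r in auto)
  next
    case True
    then obtain j where j: "j \<in> {2..r}" "w j > 4 / 5 * W" by blast
    define h where "h x = (of_bool (x = 1) - of_bool (x = j) :: int)" for x :: nat
    have others: "w x \<le> W / 5" if "x \<in> {2..r}" "x \<noteq> j" for x
    proof -
      have "w x + w j = (\<Sum>i\<in>{x, j}. w i)" using that by simp
      also have "\<dots> \<le> W" unfolding W_def using w j that by (intro sum_mono2) auto
      finally show ?thesis using j by simp
    qed
    have gh: "g x - W * h x \<le> (if x = j then W / 5 else 0)" "g x - W * h x \<ge> (if x = j then 0 else - (W / 5))"
      if "x \<in> {1..r}" for x
    proof -
      have "x = 1 \<or> x = j \<or> x \<in> {2..r} \<and> x \<noteq> j \<and> x \<noteq> 1" using that by auto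
      then consider "x = 1" | "x = j" | "x \<in> {2..r}" "x \<noteq> j" "x \<noteq> 1" by blast
      then have "g x - W * h x \<le> (if x = j then W / 5 else 0) \<and> g x - W * h x \<ge> (if x = j then 0 else - (W / 5))"
      proof cases
        case 1
        then show ?thesis using j W0 by (auto simp: g_def h_def)
      next
        case 2
        then show ?thesis using j wW[OF j(1)] by (auto simp: g_def h_def)
      next
        case 3
        then show ?thesis using others[OF 3(1,2)] w[OF 3(1)] by (auto simp: g_def h_def)
      qed
      then show "g x - W * h x \<le> (if x = j then W / 5 else 0)" "g x - W * h x \<ge> (if x = j then 0 else - (W / 5))"
        by auto
    qed
    have gh': "g x - W * h x \<le> W / 5" "g x - W * h x \<ge> - (W / 5)" if "x \<in> {1..r}" for x
      using gh[OF that] W0 by (auto split: if_splits)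
    have key: "W / 5 \<le> g p1 - g p2 + g p3 - g p4"
      if p: "p1 \<in> {1..r}" "p2 \<in> {1..r}" "p3 \<in> {1..r}" "p4 \<in> {1..r}"
        and h: "h p1 - h p2 + h p3 - h p4 \<ge> 1" for p1 p2 p3 p4
    proof -
      have "1 \<le> real_of_int (h p1 - h p2 + h p3 - h p4)" using h by linarith
      from mult_left_mono[OF this W0]
      have "W * 1 \<le> W * real_of_int (h p1 - h p2 + h p3 - h p4)" .
      then have "W \<le> W * h p1 - W * h p2 + W * h p3 - W * h p4" by (simp add: algebra_simps)
      then show ?thesis
        using gh'[OF p(1)] gh'[OF p(2)] gh'[OF p(3)] gh'[OF p(4)] by linarith
    qed
    have hj: "colour_diff c j x y = h (c {x, y})" for x y using j by (simp add: colour_diff_def h_def)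
    show ?thesis
    proof (intro bexI[of _ j] allI impI)
      fix a d z z' assume lt: "a < n" "d < n" "z < n" "z' < n" and di: "distinct [a, d, z, z']"
        and al: "1 \<le> alternating (colour_diff c j) a d z z'"
      have "W / 5 \<le> g (c {d, z}) - g (c {a, z}) + g (c {a, z'}) - g (c {d, z'})"
      proof (rule key)
        show "c {d, z} \<in> {1..r}" "c {a, z} \<in> {1..r}" "c {a, z'} \<in> {1..r}" "c {d, z'} \<in> {1..r}"
          using col[OF lt(2,3)] col[OF lt(1,3)] col[OF lt(1,4)] col[OF lt(2,4)] di by simp_all
      qed (use al in \<open>simp add: alternating_def hj\<close>)
      then show "W / 5 \<le> (\<Sum>i\<in>{2..r}. w i * alternating (colour_diff c i) a d z z')"
        using alt[OF lt di] by simp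
    qed (use r j in auto)
  qed
qed

section \<open>Typical embeddings\<close>

lemma card_dist_lists_prod:
  "s \<le> n \<Longrightarrow> real (card (dist_lists n s)) = (\<Prod>i<s. real n - real i)"
proof (induction s)
  case 0
  then show ?case using card_dist_lists[of 0 n] by simp
next
  case (Suc s)
  have "fact (n - s) = (real (n - s)) * fact (n - Suc s)"
    using Suc.prems by (subst fact_reduce) auto
  then have "real (card (dist_lists n (Suc s))) * fact (n - Suc s)
      = ((\<Prod>i<s. real n - real i) * real (n - s)) * fact (n - Suc s)"
    using card_dist_lists[of s n] card_dist_lists[OF Suc.prems] Suc by simp
  then show ?case using Suc.prems by (simp add: of_nat_diff)
qed

lemma card_dist_lists_asymp: "(\<lambda>n. real (card (dist_lists n s)) / real n ^ s) \<longlonglongrightarrow> 1"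
proof -
  have "(\<lambda>n. (real n - real i) / real n) \<longlonglongrightarrow> 1" for i
  proof -
    have "(\<lambda>n. 1 - real i / real n) \<longlonglongrightarrow> 1 - 0"
      by (intro tendsto_diff tendsto_const lim_const_over_n)
    moreover have "eventually (\<lambda>n. 1 - real i / real n = (real n - real i) / real n) sequentially"
      using eventually_gt_at_top[of 0] by eventually_elim (simp add: diff_divide_distrib)
    ultimately show ?thesis by (simp add: Lim_transform_eventually)
  qed
  then have "(\<lambda>n. \<Prod>i<s. (real n - real i) / real n) \<longlonglongrightarrow> (\<Prod>i<s. 1)"
    by (intro tendsto_prod)
  then have "(\<lambda>n. \<Prod>i<s. (real n - real i) / real n) \<longlonglongrightarrow> 1" by simp
  moreover have "eventually (\<lambda>n. (\<Prod>i<s. (real n - real i) / real n) = real (card (dist_lists n s)) / real n ^ s) sequentially"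
    using eventually_ge_at_top[of s] by eventually_elim (simp add: card_dist_lists_prod prod_dividef)
  ultimately show ?thesis by (rule Lim_transform_eventually)
qed

text \<open>This ratio is the factor \<open>\<kappa>\<close> of the variance bound; its limit 1
  expresses that disjoint lists are asymptotically independent.\<close>

lemma dist_lists_ratio_tendsto:
  "(\<lambda>n. real (card (dist_lists n s)) ^ 2 / card (dist_lists n (2 * s))) \<longlonglongrightarrow> 1"
proof -
  have "(\<lambda>n. (real (card (dist_lists n s)) / real n ^ s)\<^sup>2 / (real (card (dist_lists n (2 * s))) / real n ^ (2 * s))) \<longlonglongrightarrow> 1\<^sup>2 / 1"
    by (intro tendsto_intros card_dist_lists_asymp) simp
  then have "(\<lambda>n. (real (card (dist_lists n s)) / real n ^ s)\<^sup>2 / (real (card (dist_lists n (2 * s))) / real n ^ (2 * s))) \<longlonglongrightarrow> 1"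
    by simp
  moreover have "eventually (\<lambda>n. (real (card (dist_lists n s)) / real n ^ s)\<^sup>2 / (real (card (dist_lists n (2 * s))) / real n ^ (2 * s))
      = real (card (dist_lists n s)) ^ 2 / card (dist_lists n (2 * s))) sequentially"
    using eventually_gt_at_top[of 0]
    by eventually_elim (simp add: power_divide mult.commute flip: power_mult)
  ultimately show ?thesis by (rule Lim_transform_eventually)
qed

text \<open>Average the sum of all squared deviations: a permutation not above the mean controls
  every quantity at once.\<close>

lemma simultaneous_concentration:
  fixes M :: "'a \<Rightarrow> (nat \<Rightarrow> nat) \<Rightarrow> real" and C t :: real
  assumes A: "finite A" and t: "t \<ge> 0" and C: "card A * C < t\<^sup>2"
    and var: "\<And>a. a \<in> A \<Longrightarrow> (\<Sum>p | p permutes {..<n}. (M a p - \<mu> a)\<^sup>2) \<le> fact n * C"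
  shows "\<exists>p. p permutes {..<n} \<and> (\<forall>a\<in>A. \<bar>M a p - \<mu> a\<bar> < t)"
proof -
  let ?P = "{p. p permutes {..<n}}"
  have "id \<in> ?P" by (simp add: permutes_id)
  then have P: "real (card ?P) = fact n" "finite ?P" "?P \<noteq> {}"
    by (auto simp: card_permutations finite_permutations simp del: mem_Collect_eq)
  have "(\<Sum>p\<in>?P. \<Sum>a\<in>A. (M a p - \<mu> a)\<^sup>2) = (\<Sum>a\<in>A. \<Sum>p\<in>?P. (M a p - \<mu> a)\<^sup>2)" by (rule sum.swap)
  also have "\<dots> \<le> (\<Sum>a\<in>A. fact n * C)" by (intro sum_mono var)
  also have "\<dots> = (card A * C) * card ?P" using P by simp
  finally obtain p where p: "p permutes {..<n}" "(\<Sum>a\<in>A. (M a p - \<mu> a)\<^sup>2) \<le> card A * C"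
    using exists_le_average[OF P(2,3)] by blast
  have "\<bar>M a p - \<mu> a\<bar> < t" if "a \<in> A" for a
  proof -
    have "(M a p - \<mu> a)\<^sup>2 \<le> (\<Sum>a\<in>A. (M a p - \<mu> a)\<^sup>2)"
      using A that by (intro member_le_sum) auto
    also have "\<dots> < t\<^sup>2" using p(2) C by linarith
    finally have "\<bar>M a p - \<mu> a\<bar>\<^sup>2 < t\<^sup>2" by simp
    then show ?thesis using t by (rule power_less_imp_less_base)
  qed
  then show ?thesis using p(1) by blast
qed

section \<open>Overlaps among edges and among exchange lists\<close>

lemma card_meeting_edges:
  assumes G: "simple_graph G" and \<Delta>: "\<And>v. card (neighbours (uedges G) v) \<le> \<Delta>"
  shows "card {(e, e'). e \<in> uedges G \<and> e' \<in> uedges G \<and> e \<inter> e' \<noteq> {}} \<le> card (uedges G) * (2 * \<Delta>)"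
proof -
  let ?E = "uedges G"
  have finE: "finite ?E" by (rule neighbours_simple(4)[OF G])
  have star: "card {e \<in> ?E. v \<in> e} \<le> \<Delta>" for v
    using \<Delta>[of v] graph_degree_eq_card_neighbours[OF G, of v] by (simp add: graph_degree_def)
  have "{(e, e'). e \<in> ?E \<and> e' \<in> ?E \<and> e \<inter> e' \<noteq> {}} = Sigma ?E (\<lambda>e. {e' \<in> ?E. e \<inter> e' \<noteq> {}})" by auto
  also have "card \<dots> = (\<Sum>e\<in>?E. card {e' \<in> ?E. e \<inter> e' \<noteq> {}})"
    using finE by (intro card_SigmaI) auto
  also have "\<dots> \<le> (\<Sum>e\<in>?E. 2 * \<Delta>)"
  proof (rule sum_mono)
    fix e assume "e \<in> ?E"
    then obtain u v where e: "e = {u, v}" using G by (auto simp: simple_graph_def card_2_iff)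
    have "{e' \<in> ?E. e \<inter> e' \<noteq> {}} \<subseteq> {e' \<in> ?E. u \<in> e'} \<union> {e' \<in> ?E. v \<in> e'}" using e by auto
    then have "card {e' \<in> ?E. e \<inter> e' \<noteq> {}} \<le> card ({e' \<in> ?E. u \<in> e'} \<union> {e' \<in> ?E. v \<in> e'})"
      using finE by (intro card_mono) auto
    also have "\<dots> \<le> card {e' \<in> ?E. u \<in> e'} + card {e' \<in> ?E. v \<in> e'}" by (rule card_Un_le)
    also have "\<dots> \<le> \<Delta> + \<Delta>" by (intro add_mono star)
    finally show "card {e' \<in> ?E. e \<inter> e' \<noteq> {}} \<le> 2 * \<Delta>" by simp
  qed
  finally show ?thesis by simp
qed

lemma set_switch_list:
  assumes "simple_graph G"
  shows "set (switch_list (uedges G) (x, y)) = {x, y} \<union> (neighbours (uedges G) x \<union> neighbours (uedges G) y)"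
  using neighbours_simple(3)[OF assms] by (simp add: switch_list_def neighbour_list_def)

lemma switch_list_distinct:
  assumes G: "simple_graph G" and J: "switching_family (uedges G) k J" and xy: "(x, y) \<in> J"
  shows "distinct (switch_list (uedges G) (x, y))" "length (switch_list (uedges G) (x, y)) = 2 + 2 * k"
proof -
  let ?N = "neighbours (uedges G)"
  have A: "x \<noteq> y" "card (?N x) = k" "card (?N y) = k" "?N x \<inter> ?N y = {}"
    using switching_familyD(1)[OF J xy] by blast+
  have "?N x \<inter> touched J = {}" "?N y \<inter> touched J = {}"
    using switching_familyD(3)[OF J] touchedI[OF xy] by blast+
  then have "x \<notin> ?N x \<union> ?N y" "y \<notin> ?N x \<union> ?N y" using touchedI[OF xy] by blast+
  then show "distinct (switch_list (uedges G) (x, y))" "length (switch_list (uedges G) (x, y)) = 2 + 2 * k"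
    using A neighbours_simple(3)[OF G] by (simp_all add: switch_list_def neighbour_list_def)
qed

lemma switching_family_inj:
  assumes "switching_family E k J"
  shows "inj_on fst J" "inj_on snd J"
proof -
  have "u = v" if "u \<in> J" "v \<in> J" "fst u = fst v \<or> snd u = snd v" for u v
  proof (rule ccontr)
    obtain a b where u: "u = (a, b)" by fastforce
    obtain a' b' where v: "v = (a', b')" by fastforce
    assume "u \<noteq> v"
    then have "{a, b} \<inter> {a', b'} = {}"
      using switching_familyD(2)[OF assms, of a b a' b'] that u v by simp
    then show False using that(3) u v by auto
  qed
  then show "inj_on fst J" "inj_on snd J" by (auto intro!: inj_onI)
qed

text \<open>Lists of different pairs can meet only in an untouched vertex, a neighbour on both
  sides. Each of the at most four neighbours of a pair is adjacent to at most
  \<open>\<Delta>\<close> first and \<open>\<Delta>\<close> second members of other pairs; with the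
  pair itself this gives \<open>8 * \<Delta> + 1 \<le> 9 * \<Delta>\<close>.\<close>

lemma card_meeting_switch_lists:
  assumes G: "simple_graph G" and J: "switching_family (uedges G) k J" and k: "k \<le> 2" and finJ: "finite J"
    and \<Delta>: "\<And>v. card (neighbours (uedges G) v) \<le> \<Delta>" "\<Delta> \<ge> 1"
  shows "card {(j, j'). j \<in> J \<and> j' \<in> J \<and>
    set (switch_list (uedges G) j) \<inter> set (switch_list (uedges G) j') \<noteq> {}} \<le> card J * (9 * \<Delta>)"
proof -
  let ?N = "neighbours (uedges G)" let ?L = "\<lambda>j. set (switch_list (uedges G) j)"
  have finN: "finite (?N v)" for v by (rule neighbours_simple(3)[OF G])
  define F where "F v = {j \<in> J. fst j \<in> ?N v} \<union> {j \<in> J. snd j \<in> ?N v}" for v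
  have cF: "card (F v) \<le> 2 * \<Delta>" for v
  proof -
    have "card {j \<in> J. fst j \<in> ?N v} \<le> card (?N v)" "card {j \<in> J. snd j \<in> ?N v} \<le> card (?N v)"
      by (rule card_inj_on_le[of fst] card_inj_on_le[of snd];
          use switching_family_inj[OF J] finN in \<open>auto intro: inj_on_subset\<close>)+
    then show ?thesis using card_Un_le[of "{j \<in> J. fst j \<in> ?N v}" "{j \<in> J. snd j \<in> ?N v}"] \<Delta>(1)[of v]
      unfolding F_def by linarith
  qed
  have row: "card {j' \<in> J. ?L j \<inter> ?L j' \<noteq> {}} \<le> 9 * \<Delta>" if j: "j \<in> J" for j
  proof -
    obtain x y where xy: "j = (x, y)" by fastforce
    define N where "N = ?N x \<union> ?N y"
    have cN: "card N \<le> 4" "finite N"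
    proof -
      have "card (?N x) = k" "card (?N y) = k" using switching_familyD(1)[OF J j[unfolded xy]] by blast+
      then show "card N \<le> 4" using card_Un_le[of "?N x" "?N y"] k by (simp add: N_def)
      show "finite N" using finN by (simp add: N_def)
    qed
    have "{j' \<in> J. ?L j \<inter> ?L j' \<noteq> {}} \<subseteq> {j} \<union> (\<Union>v\<in>N. F v)"
    proof
      fix j' assume "j' \<in> {j' \<in> J. ?L j \<inter> ?L j' \<noteq> {}}"
      then obtain v where j': "j' \<in> J" and v: "v \<in> ?L j" "v \<in> ?L j'" by auto
      obtain x' y' where xy': "j' = (x', y')" by fastforce
      have t: "{x, y, x', y'} \<subseteq> touched J"
        using touchedI[OF j[unfolded xy]] touchedI[OF j'[unfolded xy']] by blast
      have free: "?N u \<inter> touched J = {}" if "u \<in> touched J" for u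
        by (rule switching_familyD(3)[OF J that])
      show "j' \<in> {j} \<union> (\<Union>v\<in>N. F v)"
      proof (cases "v \<in> N")
        case True
        then have "v \<notin> touched J" using free t unfolding N_def by blast
        then have "v \<in> ?N x' \<union> ?N y'" using v(2) t unfolding xy' set_switch_list[OF G] by blast
        then have "x' \<in> ?N v \<or> y' \<in> ?N v"
          using neighbours_sym[of v _ x'] neighbours_sym[of v _ y'] by blast
        then have "j' \<in> F v" using j' by (auto simp: F_def xy')
        then show ?thesis using True by blast
      next
        case False
        then have vxy: "v \<in> {x, y}" using v(1) unfolding xy N_def set_switch_list[OF G] by blast
        then have "v \<in> touched J" using t by blast
        then have "v \<in> {x', y'}" using v(2) free t unfolding xy' set_switch_list[OF G] by blast
        then have "{x, y} \<inter> {x', y'} \<noteq> {}" using vxy by blast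
        then have "(x, y) = (x', y')"
          using switching_familyD(2)[OF J j[unfolded xy] j'[unfolded xy']] by blast
        then show ?thesis by (simp add: xy xy')
      qed
    qed
    then have "card {j' \<in> J. ?L j \<inter> ?L j' \<noteq> {}} \<le> card ({j} \<union> (\<Union>v\<in>N. F v))"
      using cN finJ by (intro card_mono) (auto simp: F_def)
    also have "\<dots> \<le> card {j} + card (\<Union>v\<in>N. F v)" by (rule card_Un_le)
    also have "card (\<Union>v\<in>N. F v) \<le> (\<Sum>v\<in>N. card (F v))" by (rule card_UN_le[OF cN(2)])
    also have "\<dots> \<le> (\<Sum>v\<in>N. 2 * \<Delta>)" by (intro sum_mono cF)
    also have "\<dots> \<le> 4 * (2 * \<Delta>)" using cN by simp
    finally show ?thesis using \<Delta>(2) by simp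
  qed
  have "{(j, j'). j \<in> J \<and> j' \<in> J \<and> ?L j \<inter> ?L j' \<noteq> {}} = Sigma J (\<lambda>j. {j' \<in> J. ?L j \<inter> ?L j' \<noteq> {}})" by auto
  also have "card \<dots> = (\<Sum>j\<in>J. card {j' \<in> J. ?L j \<inter> ?L j' \<noteq> {}})"
    using finJ by (intro card_SigmaI) auto
  also have "\<dots> \<le> (\<Sum>j\<in>J. 9 * \<Delta>)" by (intro sum_mono row)
  finally show ?thesis by simp
qed

section \<open>An embedding typical for all colours\<close>

lemma colour_density:
  assumes bal: "balanced_colouring \<epsilon> r (complete_ugraph {..<n}) c" and i: "i \<in> {1..r}" and n: "n \<ge> 2"
  shows "real (card ({ys. c (set ys) = i} \<inter> dist_lists n 2)) / card (dist_lists n 2)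
    \<in> {1 / real r - \<epsilon> .. 1 / real r + \<epsilon>}"
proof -
  let ?K = "complete_ugraph {..<n}"
  \<comment> \<open>With a set \<open>C\<close> of colours one count covers both uses:
    \<open>{i}\<close> gives the numerator and \<open>UNIV\<close> the denominator.\<close>
  have cnt: "card ({ys. c (set ys) \<in> C} \<inter> dist_lists n 2) = 2 * card {e \<in> uedges ?K. c e \<in> C}" for C
  proof -
    let ?E = "{e \<in> uedges ?K. c e \<in> C}"
    have "finite ?E"
      by (rule finite_subset[of _ "Pow {..<n}"]) (auto simp: complete_ugraph_def)
    then have "card {(x, y). x \<noteq> y \<and> {x, y} \<in> ?E} = 2 * card ?E"
      by (rule card_ordered_pairs) (simp add: complete_ugraph_def)
    moreover have "card {(x, y). x \<noteq> y \<and> {x, y} \<in> ?E} = card ((\<lambda>(x, y). [x, y]) ` {(x, y). x \<noteq> y \<and> {x, y} \<in> ?E})"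
      by (rule card_image[symmetric]) (auto simp: inj_on_def)
    moreover have "(\<lambda>(x, y). [x, y]) ` {(x, y). x \<noteq> y \<and> {x, y} \<in> ?E} = {ys. c (set ys) \<in> C} \<inter> dist_lists n 2"
    proof (intro set_eqI iffI)
      fix ys assume "ys \<in> {ys. c (set ys) \<in> C} \<inter> dist_lists n 2"
      then have ys: "c (set ys) \<in> C" "length ys = 2" "distinct ys" "set ys \<subseteq> {..<n}" by (auto simp: dist_lists_def)
      then obtain x y where "ys = [x, y]" by (auto simp: length_Suc_conv numeral_2_eq_2)
      with ys show "ys \<in> (\<lambda>(x, y). [x, y]) ` {(x, y). x \<noteq> y \<and> {x, y} \<in> ?E}"
        by (auto simp: complete_ugraph_def intro!: image_eqI[of _ _ "(x, y)"])
    next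
      fix ys assume "ys \<in> (\<lambda>(x, y). [x, y]) ` {(x, y). x \<noteq> y \<and> {x, y} \<in> ?E}"
      then show "ys \<in> {ys. c (set ys) \<in> C} \<inter> dist_lists n 2"
        by (auto simp: complete_ugraph_def dist_lists_def)
    qed
    ultimately show ?thesis by simp
  qed
  have a: "card ({ys. c (set ys) = i} \<inter> dist_lists n 2) = 2 * colour_count ?K c i"
    using cnt[of "{i}"] by (simp add: colour_count_def)
  have b: "card (dist_lists n 2) = 2 * card (uedges ?K)" using cnt[of UNIV] by simp
  have "real (colour_count ?K c i) / real (card (uedges ?K)) \<in> {1 / real r - \<epsilon> .. 1 / real r + \<epsilon>}"
    using bal i unfolding balanced_colouring_def by blast
  then show ?thesis unfolding a b by simp
qed

text \<open>The second-moment bound is applied to two families of lists, the edges and the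
  exchanges. In both at most \<open>9 * \<epsilon> * n\<^sup>2\<close> pairs overlap, so all
  \<open>2 * r\<close> variances are small compared with
  \<open>(\<gamma> * n)\<^sup>2\<close>.\<close>

lemma typical_embedding:
  fixes T :: "nat ugraph" and c :: "nat set \<Rightarrow> nat"
  assumes T: "simple_graph T" and V: "card (uverts T) = n" and E: "card (uedges T) \<le> n"
    and J: "switching_family (uedges T) k J" "J \<subseteq> uverts T \<times> uverts T" "finite J" "card J \<le> n"
    and k: "k \<in> {1, 2}"
    and \<Delta>: "\<And>v. card (neighbours (uedges T) v) \<le> \<Delta>" "\<Delta> \<ge> 1" "real \<Delta> \<le> \<epsilon> * n"
    and \<gamma>: "\<gamma> > 0" and r: "r \<ge> 1" and \<epsilon>: "\<epsilon> = \<gamma>\<^sup>2 / (40 * real r)" and n: "n \<ge> 12"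
    and ratio: "\<And>s. s \<in> {2, 4, 6} \<Longrightarrow>
      real (card (dist_lists n s)) ^ 2 / card (dist_lists n (2 * s)) \<le> 1 + \<gamma>\<^sup>2 / (8 * real r)"
  obtains \<phi> where "bij_betw \<phi> (uverts T) {..<n}"
    "\<And>i. i \<in> {1..r} \<Longrightarrow> \<bar>real (card {e \<in> uedges T. c (\<phi> ` e) = i})
      - card (uedges T) * (card ({ys. c (set ys) = i} \<inter> dist_lists n 2) / card (dist_lists n 2))\<bar> < \<gamma> * n"
    "\<And>i. i \<in> {1..r} \<Longrightarrow> \<bar>real (card {j \<in> J. map \<phi> (switch_list (uedges T) j) \<in> good_lists c k i})
      - card J * (card (good_lists c k i \<inter> dist_lists n (2 + 2 * k)) / card (dist_lists n (2 + 2 * k)))\<bar> < \<gamma> * n"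
proof -
  let ?E = "uedges T" and ?V = "uverts T"
  have finV: "finite ?V" and edge: "\<And>e. e \<in> ?E \<Longrightarrow> e \<subseteq> ?V \<and> card e = 2" using T by (auto simp: simple_graph_def)
  have finE: "finite ?E" by (rule neighbours_simple(4)[OF T])
  \<comment> \<open>The vertices of \<open>T\<close> are arbitrary numbers. A fixed labelling by
    \<open>{..<n}\<close> followed by a random permutation is the random bijection.\<close>
  obtain b where b: "bij_betw b ?V {..<n}"
    using finite_same_card_bij[OF finV, of "{..<n}"] V by auto
  have binj: "inj_on b ?V" and bim: "b ` ?V = {..<n}" using b by (auto simp: bij_betw_def)
  define L1 where "L1 e = map b (sorted_list_of_set e)" for e
  define L2 where "L2 j = map b (switch_list ?E j)" for j
  \<comment> \<open>In units of \<open>\<gamma>\<^sup>2 / r\<close>, overlaps contribute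
    \<open>9 / 40\<close> and the ratio error \<open>1 / 8\<close>, together \<open>7 / 20\<close>.
    Over \<open>2 * r\<close> events the total is \<open>7 / 10\<close> of
    \<open>(\<gamma> * n)\<^sup>2\<close>.\<close>
  define C where "C = (real n)\<^sup>2 * (\<gamma>\<^sup>2 * 7 / (20 * real r))"
  have dist: "map b xs \<in> dist_lists n (length xs)" if "distinct xs" "set xs \<subseteq> ?V" for xs
    using that binj bim by (auto simp: dist_lists_def distinct_map intro: inj_on_subset)
  have L1: "L1 e \<in> dist_lists n 2" if "e \<in> ?E" for e
  proof -
    have "finite e" using edge[OF that] finV finite_subset by blast
    then show ?thesis using dist[of "sorted_list_of_set e"] edge[OF that] by (simp add: L1_def)
  qed
  have sL: "set (switch_list ?E j) \<subseteq> ?V" if "j \<in> J" for j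
  proof -
    obtain x y where xy: "j = (x, y)" by fastforce
    then show ?thesis using that J(2) neighbours_simple(1)[OF T] unfolding xy set_switch_list[OF T] by blast
  qed
  have L2: "L2 j \<in> dist_lists n (2 + 2 * k)" if "j \<in> J" for j
  proof -
    obtain x y where xy: "j = (x, y)" by fastforce
    show ?thesis
      using dist[OF switch_list_distinct(1)[OF T J(1) that[unfolded xy]] sL[OF that, unfolded xy]]
        switch_list_distinct(2)[OF T J(1) that[unfolded xy]] by (simp add: L2_def xy)
  qed
  have meet: "set (map b xs) \<inter> set (map b ys) \<noteq> {} \<longleftrightarrow> set xs \<inter> set ys \<noteq> {}"
    if "set xs \<subseteq> ?V" "set ys \<subseteq> ?V" for xs ys
    using inj_on_image_Int[OF binj that] by (auto simp flip: image_is_empty)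
  have bound: "real m \<le> 9 * \<epsilon> * (real n)\<^sup>2" if "m \<le> N * (9 * \<Delta>)" "N \<le> n" for m N
  proof -
    have "real m \<le> real N * (9 * real \<Delta>)" using of_nat_mono[OF that(1), where 'a = real] by simp
    also have "\<dots> \<le> real n * (9 * (\<epsilon> * n))" using that(2) \<Delta>(3) by (intro mult_mono) auto
    finally show ?thesis by (simp add: power2_eq_square mult_ac)
  qed
  have K1: "real (card {(e, e'). e \<in> ?E \<and> e' \<in> ?E \<and> set (L1 e) \<inter> set (L1 e') \<noteq> {}}) \<le> 9 * \<epsilon> * (real n)\<^sup>2"
  proof -
    have "set (L1 e) \<inter> set (L1 e') \<noteq> {} \<longleftrightarrow> e \<inter> e' \<noteq> {}" if "e \<in> ?E" "e' \<in> ?E" for e e'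
    proof -
      have "finite e" "finite e'" "e \<subseteq> ?V" "e' \<subseteq> ?V" using edge that finV finite_subset by blast+
      then show ?thesis unfolding L1_def by (subst meet) auto
    qed
    then have "{(e, e'). e \<in> ?E \<and> e' \<in> ?E \<and> set (L1 e) \<inter> set (L1 e') \<noteq> {}}
        = {(e, e'). e \<in> ?E \<and> e' \<in> ?E \<and> e \<inter> e' \<noteq> {}}" by blast
    moreover have "card {(e, e'). e \<in> ?E \<and> e' \<in> ?E \<and> e \<inter> e' \<noteq> {}} \<le> card ?E * (9 * \<Delta>)"
      using card_meeting_edges[OF T \<Delta>(1)] by (rule order.trans) simp
    ultimately show ?thesis using bound[OF _ E] by simp
  qed
  have K2: "real (card {(j, j'). j \<in> J \<and> j' \<in> J \<and> set (L2 j) \<inter> set (L2 j') \<noteq> {}}) \<le> 9 * \<epsilon> * (real n)\<^sup>2"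
  proof -
    have "{(j, j'). j \<in> J \<and> j' \<in> J \<and> set (L2 j) \<inter> set (L2 j') \<noteq> {}}
        = {(j, j'). j \<in> J \<and> j' \<in> J \<and> set (switch_list ?E j) \<inter> set (switch_list ?E j') \<noteq> {}}"
      using meet sL unfolding L2_def by blast
    moreover have "k \<le> 2" using k by auto
    ultimately show ?thesis
      using bound[OF card_meeting_switch_lists[OF T J(1) _ J(3) \<Delta>(1,2)] J(4)] by simp
  qed
  have var: "(\<Sum>p | p permutes {..<n}. (real (card {x \<in> X. map p (L x) \<in> Ev})
      - card X * (card (Ev \<inter> dist_lists n s) / card (dist_lists n s)))\<^sup>2) \<le> fact n * C"
    if "finite X" "\<And>x. x \<in> X \<Longrightarrow> L x \<in> dist_lists n s" "s \<in> {2, 4, 6}" "card X \<le> n"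
      "real (card {(x, x'). x \<in> X \<and> x' \<in> X \<and> set (L x) \<inter> set (L x') \<noteq> {}}) \<le> 9 * \<epsilon> * (real n)\<^sup>2"
    for X :: "'z set" and L Ev s
  proof -
    have s: "2 * s \<le> n" using that(3) n by auto
    define \<mu> where "\<mu> = real (card X) * (card (Ev \<inter> dist_lists n s) / card (dist_lists n s))"
    define \<kappa> where "\<kappa> = real (card (dist_lists n s)) ^ 2 / card (dist_lists n (2 * s))"
    have "card (Ev \<inter> dist_lists n s) \<le> card (dist_lists n s)" by (intro card_mono) auto
    then have "real (card (Ev \<inter> dist_lists n s)) / card (dist_lists n s) \<le> 1"
      using card_dist_lists_pos[of s n] s by simp
    then have "\<mu> \<le> real (card X) * 1" unfolding \<mu>_def by (intro mult_left_mono) auto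
    then have \<mu>: "\<mu> \<le> n" "\<mu> \<ge> 0" using that(4) by (auto simp: \<mu>_def)
    then have \<mu>2: "\<mu>\<^sup>2 \<le> (real n)\<^sup>2" by (intro power_mono)
    have "(\<kappa> - 1) * \<mu>\<^sup>2 \<le> (\<gamma>\<^sup>2 / (8 * real r)) * \<mu>\<^sup>2"
      using ratio[OF that(3)] by (intro mult_right_mono) (auto simp: \<kappa>_def)
    also have "\<dots> \<le> (\<gamma>\<^sup>2 / (8 * real r)) * (real n)\<^sup>2" using \<mu>2 by (intro mult_left_mono) auto
    finally have "(\<kappa> - 1) * \<mu>\<^sup>2 \<le> (\<gamma>\<^sup>2 / (8 * real r)) * (real n)\<^sup>2" .
    moreover have "9 * \<epsilon> * (real n)\<^sup>2 + (\<gamma>\<^sup>2 / (8 * real r)) * (real n)\<^sup>2 = C"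
      using r by (simp add: C_def \<epsilon> field_simps)
    ultimately have v: "9 * \<epsilon> * (real n)\<^sup>2 + (\<kappa> - 1) * \<mu>\<^sup>2 \<le> C" by linarith
    have "(\<Sum>p | p permutes {..<n}. (real (card {x \<in> X. map p (L x) \<in> Ev}) - \<mu>)\<^sup>2)
        \<le> fact n * (9 * \<epsilon> * (real n)\<^sup>2 + (\<kappa> - 1) * \<mu>\<^sup>2)"
      unfolding \<mu>_def \<kappa>_def by (rule variance_over_permutations[OF that(1,2) s that(5)])
    also have "\<dots> \<le> fact n * C" using v by (intro mult_left_mono) auto
    finally show ?thesis by (simp add: \<mu>_def)
  qed
  define M where "M = (\<lambda>(i, t) p. if t then real (card {e \<in> ?E. map p (L1 e) \<in> {ys. c (set ys) = i}})
    else real (card {j \<in> J. map p (L2 j) \<in> good_lists c k i}))"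
  define \<mu> where "\<mu> = (\<lambda>(i, t). if t then card ?E * (card ({ys. c (set ys) = i} \<inter> dist_lists n 2) / card (dist_lists n 2))
    else card J * (card (good_lists c k i \<inter> dist_lists n (2 + 2 * k)) / card (dist_lists n (2 + 2 * k))))"
  have "\<exists>p. p permutes {..<n} \<and> (\<forall>a\<in>{1..r} \<times> (UNIV :: bool set). \<bar>M a p - \<mu> a\<bar> < \<gamma> * n)"
  proof (rule simultaneous_concentration)
    show "finite ({1..r} \<times> (UNIV :: bool set))" by simp
    show "0 \<le> \<gamma> * real n" using \<gamma> by simp
    have "real (card ({1..r} \<times> (UNIV :: bool set))) * C = (7 / 10) * (\<gamma> * n)\<^sup>2"
      using r by (simp add: card_cartesian_product C_def power_mult_distrib field_simps)
    also have "\<dots> < (\<gamma> * n)\<^sup>2" using \<gamma> n by simp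
    finally show "real (card ({1..r} \<times> (UNIV :: bool set))) * C < (\<gamma> * n)\<^sup>2" .
    fix a assume "a \<in> {1..r} \<times> (UNIV :: bool set)"
    obtain i t where a: "a = (i, t)" by fastforce
    show "(\<Sum>p | p permutes {..<n}. (M a p - \<mu> a)\<^sup>2) \<le> fact n * C"
    proof (cases t)
      case True
      show ?thesis using var[OF finE L1 _ E K1, of "{ys. c (set ys) = i}"] by (simp add: a M_def \<mu>_def True)
    next
      case False
      have "2 + 2 * k \<in> {2, 4, 6}" using k by auto
      from var[OF J(3) L2 this J(4) K2, of "good_lists c k i"] show ?thesis by (simp add: a M_def \<mu>_def False)
    qed
  qed
  then obtain p where p: "p permutes {..<n}"
    and dev: "\<And>i t. i \<in> {1..r} \<Longrightarrow> \<bar>M (i, t) p - \<mu> (i, t)\<bar> < \<gamma> * n" by blast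
  define \<phi> where "\<phi> = p \<circ> b"
  have bij: "bij_betw \<phi> ?V {..<n}"
    unfolding \<phi>_def using b permutes_imp_bij[OF p] by (rule bij_betw_trans)
  have e1: "{e \<in> ?E. map p (L1 e) \<in> {ys. c (set ys) = i}} = {e \<in> ?E. c (\<phi> ` e) = i}" for i
  proof -
    have "set (map p (L1 e)) = \<phi> ` e" if "e \<in> ?E" for e
    proof -
      have "finite e" using edge[OF that] finV finite_subset by blast
      then show ?thesis by (simp add: L1_def \<phi>_def image_comp)
    qed
    then show ?thesis by auto
  qed
  have e2: "map p (L2 j) = map \<phi> (switch_list ?E j)" for j by (simp add: L2_def \<phi>_def)
  show ?thesis
  proof (rule that[OF bij])
    fix i assume i: "i \<in> {1..r}"
    show "\<bar>real (card {e \<in> uedges T. c (\<phi> ` e) = i})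
      - card (uedges T) * (card ({ys. c (set ys) = i} \<inter> dist_lists n 2) / card (dist_lists n 2))\<bar> < \<gamma> * n"
      using dev[OF i, of True] by (simp only: M_def \<mu>_def e1 prod.case if_True)
    show "\<bar>real (card {j \<in> J. map \<phi> (switch_list (uedges T) j) \<in> good_lists c k i})
      - card J * (card (good_lists c k i \<inter> dist_lists n (2 + 2 * k)) / card (dist_lists n (2 + 2 * k)))\<bar> < \<gamma> * n"
      using dev[OF i, of False] by (simp only: M_def \<mu>_def e2 prod.case if_False)
  qed
qed

section \<open>The biased copy\<close>

lemma card_dist_lists_le: "card (dist_lists n s) \<le> n ^ s"
proof -
  have "card (dist_lists n s) \<le> card {ys. set ys \<subseteq> {..<n} \<and> length ys = s}"
    by (rule card_mono) (auto simp: dist_lists_def finite_lists_length_eq)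
  also have "\<dots> = n ^ s" by (simp add: card_lists_length_eq)
  finally show ?thesis .
qed

lemma good_lists_density:
  assumes \<rho>: "0 < \<rho>" "\<rho> \<le> 1" and n: "8 \<le> \<rho>\<^sup>2 * n" "n \<ge> 6" and k: "k \<in> {1, 2}"
    and P: "\<rho> * real n ^ 4 \<le> card {(a, d, z, z'). a < n \<and> d < n \<and> z < n \<and> z' < n
    \<and> distinct [a, d, z, z'] \<and> alternating (colour_diff c i) a d z z' \<ge> 1}"
  shows "\<rho>\<^sup>2 / 2 \<le> card (good_lists c k i \<inter> dist_lists n (2 + 2 * k)) / card (dist_lists n (2 + 2 * k))"
proof -
  have "\<rho>\<^sup>2 / 2 * real n ^ (2 + 2 * k) \<le> card (good_lists c k i \<inter> dist_lists n (2 + 2 * k))"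
  proof (cases "k = 1")
    case True
    have "\<rho>\<^sup>2 / 2 \<le> \<rho>" using \<rho> by (simp add: power2_eq_square mult_le_cancel_left1)
    then have "\<rho>\<^sup>2 / 2 * real n ^ 4 \<le> \<rho> * real n ^ 4" by (intro mult_right_mono) auto
    also have "\<dots> \<le> card (good_lists c 1 i \<inter> dist_lists n 4)" by (rule card_good_lists_1[OF P])
    finally show ?thesis by (simp add: True)
  next
    case False
    then have "k = 2" using k by auto
    then show ?thesis using card_good_lists_2[OF \<rho>(1) n(1) P] by simp
  qed
  moreover have "\<rho>\<^sup>2 / 2 * card (dist_lists n (2 + 2 * k)) \<le> \<rho>\<^sup>2 / 2 * real n ^ (2 + 2 * k)"
    using of_nat_mono[OF card_dist_lists_le[of n "2 + 2 * k"], where 'a = real]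
    by (intro mult_left_mono) auto
  moreover have "card (dist_lists n (2 + 2 * k)) > 0"
    using k n(2) by (intro card_dist_lists_pos) auto
  ultimately show ?thesis by (simp add: pos_le_divide_eq)
qed

lemma abs_list_gain_le:
  assumes "k \<le> 2"
  shows "\<bar>list_gain c k i ys\<bar> \<le> 8"
proof -
  have cd: "-1 \<le> colour_diff c i x y \<and> colour_diff c i x y \<le> 1" for x y by (simp add: colour_diff_def)
  have "\<bar>alternating (colour_diff c i) a d z z'\<bar> \<le> 4" for a d z z'
    using cd[of d z] cd[of a z] cd[of a z'] cd[of d z']
    unfolding alternating_def abs_le_iff by linarith
  then have "\<bar>list_gain c k i ys\<bar> \<le> (\<Sum>l<k. 4)"
    unfolding list_gain_def by (intro order.trans[OF sum_abs] sum_mono)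
  then show ?thesis using assms by simp
qed

lemma weighted_list_gain:
  fixes w :: "nat \<Rightarrow> real" and W :: real
  assumes ys: "ys \<in> dist_lists n (2 + 2 * k)" "ys \<in> good_lists c k j" and k: "k \<ge> 1" and W: "W \<ge> 0"
    and j: "\<And>a d z z'. a < n \<Longrightarrow> d < n \<Longrightarrow> z < n \<Longrightarrow> z' < n \<Longrightarrow> distinct [a, d, z, z'] \<Longrightarrow>
      alternating (colour_diff c j) a d z z' \<ge> 1 \<Longrightarrow>
      W / 5 \<le> (\<Sum>i\<in>I. w i * alternating (colour_diff c i) a d z z')"
  shows "W / 5 \<le> (\<Sum>i\<in>I. w i * list_gain c k i ys)"
proof -
  have len: "length ys = 2 + 2 * k" and dis: "distinct ys" and sub: "set ys \<subseteq> {..<n}"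
    using ys(1) by (auto simp: dist_lists_def)
  have lt: "ys ! m < n" if "m < 2 + 2 * k" for m
    using nth_mem[of m ys] that len sub by (metis lessThan_iff subsetD)
  have ne: "ys ! m = ys ! m' \<longleftrightarrow> m = m'" if "m < 2 + 2 * k" "m' < 2 + 2 * k" for m m'
    using dis len that by (simp add: nth_eq_iff_index_eq)
  have "W / 5 \<le> real k * (W / 5)" using k W by (simp add: mult_le_cancel_right1)
  also have "\<dots> = (\<Sum>l<k. W / 5)" by simp
  also have "\<dots> \<le> (\<Sum>l<k. \<Sum>i\<in>I. w i * alternating (colour_diff c i) (ys ! 0) (ys ! 1) (ys ! (2 + l)) (ys ! (2 + k + l)))"
  proof (rule sum_mono)
    fix l assume "l \<in> {..<k}"
    then have l: "l < k" by simp
    show "W / 5 \<le> (\<Sum>i\<in>I. w i * alternating (colour_diff c i) (ys ! 0) (ys ! 1) (ys ! (2 + l)) (ys ! (2 + k + l)))"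
    proof (rule j)
      show "ys ! 0 < n" "ys ! 1 < n" "ys ! (2 + l) < n" "ys ! (2 + k + l) < n" using l by (auto intro!: lt)
      show "distinct [ys ! 0, ys ! 1, ys ! (2 + l), ys ! (2 + k + l)]"
        using l ne[of 0 1] ne[of 0 "2 + l"] ne[of 0 "2 + k + l"] ne[of 1 "2 + l"] ne[of 1 "2 + k + l"]
          ne[of "2 + l" "2 + k + l"] by simp
      show "1 \<le> alternating (colour_diff c j) (ys ! 0) (ys ! 1) (ys ! (2 + l)) (ys ! (2 + k + l))"
        using ys(2) l by (simp add: good_lists_def)
    qed
  qed
  also have "\<dots> = (\<Sum>i\<in>I. w i * list_gain c k i ys)"
    by (simp add: list_gain_def sum_distrib_left sum.swap[of _ "{..<k}" I])
  finally show ?thesis .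
qed

lemma biased_embedding:
  fixes T :: "nat ugraph" and c :: "nat set \<Rightarrow> nat" and \<eta> \<epsilon> \<gamma> \<delta> :: real
  assumes r: "r \<ge> 3" and eta: "0 < \<eta>" "\<eta> \<le> 1 / (100 * (real r)\<^sup>2)"
    and \<gamma>: "\<gamma> = \<eta>\<^sup>2 / 10 ^ 8" and \<epsilon>: "\<epsilon> = \<gamma>\<^sup>2 / (40 * real r)" and \<delta>: "\<delta> = \<eta>\<^sup>2 / (10 ^ 6 * real r ^ 3)"
    and T: "tree_ugraph T" "card (uverts T) = n" "real (max_graph_degree T) \<le> \<epsilon> * n"
    and col: "edge_colouring r (complete_ugraph {..<n}) c"
    and bal: "balanced_colouring \<epsilon> r (complete_ugraph {..<n}) c"
    and std: "standard_colouring \<eta> r (complete_ugraph {..<n}) c"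
    and n: "n \<ge> 200" "6000 \<le> \<eta> * n" "8 \<le> (\<eta> / 100)\<^sup>2 * n" "128 * real r < \<delta>\<^sup>2 * n"
    and ratio: "\<And>s. s \<in> {2, 4, 6} \<Longrightarrow>
      real (card (dist_lists n s)) ^ 2 / card (dist_lists n (2 * s)) \<le> 1 + \<gamma>\<^sup>2 / (8 * real r)"
  shows "\<exists>\<psi>. bij_betw \<psi> (uverts T) {..<n} \<and> (\<forall>i\<in>{2..r}.
    \<delta> * n \<le> real_of_int (\<Sum>e\<in>uedges T. of_bool (c (\<psi> ` e) = 1) - of_bool (c (\<psi> ` e) = i)))"
proof -
  let ?E = "uedges T" let ?N = "neighbours ?E"
  have G: "simple_graph T" using T(1) by (simp add: tree_ugraph_def)
  have finV: "finite (uverts T)" using G by (simp add: simple_graph_def)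
  have finE: "finite ?E" by (rule neighbours_simple(4)[OF G])
  have E: "card ?E \<le> n" using acyclic_card_edges_le[OF G] T(1,2) by (simp add: tree_ugraph_def)
  have r9: "(real r)\<^sup>2 \<ge> 9" "real r ^ 3 \<ge> 27"
    using r power_mono[of 3 "real r" 2] power_mono[of 3 "real r" 3] by simp_all
  have "1 / (100 * (real r)\<^sup>2) \<le> 1 / 900" using r9 r by (intro divide_left_mono) auto
  then have eta1: "\<eta> \<le> 1 / 900" using eta by simp
  then have eta2: "\<eta>\<^sup>2 \<le> \<eta> / 900" using eta(1) by (simp add: power2_eq_square)
  have \<gamma>1: "0 < \<gamma>" "\<gamma> \<le> \<eta> / 1000" "\<gamma> \<le> 1" using eta(1) eta1 eta2 by (auto simp: \<gamma>)
  have \<epsilon>1: "0 < \<epsilon>" "\<epsilon> \<le> \<gamma>"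
  proof -
    show "0 < \<epsilon>" using \<gamma>1 r by (simp add: \<epsilon>)
    have "\<gamma>\<^sup>2 / (40 * real r) \<le> \<gamma> / 1"
      using \<gamma>1 r by (intro frac_le) (auto simp: power2_eq_square mult_left_le)
    then show "\<epsilon> \<le> \<gamma>" by (simp add: \<epsilon>)
  qed
  define \<Delta> where "\<Delta> = max_graph_degree T"
  have \<Delta>: "card (?N v) \<le> \<Delta>" for v
  proof (cases "v \<in> uverts T")
    case True
    then have "graph_degree T v \<le> \<Delta>" unfolding \<Delta>_def max_graph_degree_def using finV by (intro Max_ge) auto
    then show ?thesis by (simp add: graph_degree_eq_card_neighbours[OF G])
  next
    case False
    then have "?N v = {}" using G by (auto simp: neighbours_def simple_graph_def)
    then show ?thesis by simp
  qed
  obtain v where "v \<in> uverts T" using T(2) n(1) by (metis card.empty ex_in_conv not_numeral_le_zero)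
  then have \<Delta>1: "\<Delta> \<ge> 1"
    using connected_neighbours_nonempty[OF G _ _ \<open>v \<in> uverts T\<close>] T(1,2) n(1) \<Delta>[of v] by (simp add: tree_ugraph_def)
  have \<Delta>n: "real \<Delta> \<le> \<epsilon> * n" using T(3) by (simp add: \<Delta>_def)
  have "100 * real \<Delta> \<le> n"
  proof -
    have "\<epsilon> * n \<le> 1 / 100 * n" using \<epsilon>1 \<gamma>1 eta1 by (intro mult_right_mono) auto
    then show ?thesis using \<Delta>n by simp
  qed
  then have "100 * \<Delta> \<le> n" by linarith
  from tree_switching_family[OF T(1,2) n(1) \<Delta> this] obtain k J where
    k: "k \<in> {1, 2}" and J: "J \<subseteq> uverts T \<times> uverts T" "finite J" "n \<le> 40 * card J" "card J \<le> n"
    "switching_family ?E k J" by blast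
  obtain \<phi> where \<phi>: "bij_betw \<phi> (uverts T) {..<n}"
    and dev1: "\<And>i. i \<in> {1..r} \<Longrightarrow> \<bar>real (card {e \<in> ?E. c (\<phi> ` e) = i})
      - card ?E * (card ({ys. c (set ys) = i} \<inter> dist_lists n 2) / card (dist_lists n 2))\<bar> < \<gamma> * n"
    and dev2: "\<And>i. i \<in> {1..r} \<Longrightarrow> \<bar>real (card {j \<in> J. map \<phi> (switch_list ?E j) \<in> good_lists c k i})
      - card J * (card (good_lists c k i \<inter> dist_lists n (2 + 2 * k)) / card (dist_lists n (2 + 2 * k)))\<bar> < \<gamma> * n"
  proof (rule typical_embedding[OF G T(2) E J(5,1,2,4) k \<Delta> \<Delta>1 \<Delta>n \<gamma>1(1) _ \<epsilon> _ ratio])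
    show "1 \<le> r" "12 \<le> n" using r n by auto
  qed (assumption | rule that)+
  define X0 where "X0 i = real_of_int (\<Sum>e\<in>?E. of_bool (c (\<phi> ` e) = 1) - of_bool (c (\<phi> ` e) = i))" for i
  define g where "g j i = real_of_int (list_gain c k i (map \<phi> (switch_list ?E j)))" for j i
  \<comment> \<open>Balance puts the densities of colours 1 and \<open>i\<close> within
    \<open>2 * \<epsilon>\<close> of each other; the two deviations of the embedding add
    \<open>2 * \<gamma>\<close>.\<close>
  have X0: "X0 i \<ge> - (2 * \<epsilon> + 2 * \<gamma>) * n" if "i \<in> {2..r}" for i
  proof -
    define N where "N i = real (card {e \<in> ?E. c (\<phi> ` e) = i})" for i
    define q where "q i = real (card ({ys. c (set ys) = i} \<inter> dist_lists n 2)) / card (dist_lists n 2)" for i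
    have cnt: "(\<Sum>e\<in>?E. of_bool (c (\<phi> ` e) = i)) = int (card {e \<in> ?E. c (\<phi> ` e) = i})" for i
      using finE by (simp add: of_bool_def sum.If_cases Int_def)
    have "X0 i = N 1 - N i" by (simp add: X0_def N_def sum_subtractf cnt)
    moreover have "\<bar>N 1 - card ?E * q 1\<bar> < \<gamma> * n" "\<bar>N i - card ?E * q i\<bar> < \<gamma> * n"
      using dev1[of 1] dev1[of i] that r unfolding N_def q_def by auto
    moreover have "q 1 - q i \<ge> - (2 * \<epsilon>)"
      using colour_density[OF bal, of 1] colour_density[OF bal, of i] that r n(1) unfolding q_def by simp
    then have "real (card ?E) * (- (2 * \<epsilon>)) \<le> real (card ?E) * (q 1 - q i)" by (intro mult_left_mono) auto
    moreover have "real (card ?E) * (2 * \<epsilon>) \<le> real n * (2 * \<epsilon>)" using E \<epsilon>1 by (intro mult_right_mono) auto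
    ultimately have "X0 i \<ge> - (real n * (2 * \<epsilon>)) - 2 * (\<gamma> * n)"
      by (simp add: right_diff_distrib)
    then show ?thesis by (simp add: algebra_simps)
  qed
  \<comment> \<open>The constant is \<open>40 * 2 * 100\<^sup>2\<close>: at least
    \<open>n / 40\<close> pairs, of which a proportion \<open>(\<eta> / 100)\<^sup>2 / 2\<close> is
    profitable on average.\<close>
  have M: "real (card {j \<in> J. map \<phi> (switch_list ?E j) \<in> good_lists c k i}) \<ge> (\<eta>\<^sup>2 / 800000 - \<gamma>) * n"
    if i: "i \<in> {1..r}" for i
  proof -
    define \<theta> where "\<theta> = real (card (good_lists c k i \<inter> dist_lists n (2 + 2 * k))) / card (dist_lists n (2 + 2 * k))"
    have "\<epsilon> \<le> \<eta> / 1000" using \<epsilon>1 \<gamma>1 by simp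
    from many_positive_quadruples[OF r i eta \<epsilon>1(1) this n(2) bal std]
    have "(\<eta> / 100)\<^sup>2 / 2 \<le> \<theta>"
      unfolding \<theta>_def using eta(1) eta1 n k by (intro good_lists_density) auto
    moreover have "real n / 40 \<le> real (card J)" using J(3) by linarith
    ultimately have "real n / 40 * ((\<eta> / 100)\<^sup>2 / 2) \<le> card J * \<theta>" by (intro mult_mono) auto
    then have "\<eta>\<^sup>2 / 800000 * n \<le> card J * \<theta>" by (simp add: power_divide mult.commute)
    moreover have "\<bar>real (card {j \<in> J. map \<phi> (switch_list ?E j) \<in> good_lists c k i}) - card J * \<theta>\<bar> < \<gamma> * n"
      using dev2[OF i] unfolding \<theta>_def .
    ultimately show ?thesis by (simp add: left_diff_distrib)
  qed
  have \<delta>0: "0 < \<delta>" using eta r by (simp add: \<delta>)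
  \<comment> \<open>The exchanges are worth \<open>\<eta>\<^sup>2 / (4 * 10 ^ 6)\<close> up to
    \<open>\<gamma> / 5\<close>, whereas \<open>r \<ge> 3\<close> makes \<open>2 * \<delta>\<close>
    at most \<open>2 * \<eta>\<^sup>2 / (27 * 10 ^ 6)\<close>. The difference covers the losses in
    \<open>\<epsilon>\<close> and \<open>\<gamma>\<close>.\<close>
  have num: "2 * (\<delta> * n) \<le> - (2 * \<epsilon> + 2 * \<gamma>) * n + (\<eta>\<^sup>2 / 800000 - \<gamma>) * n / 5"
  proof -
    have "\<delta> \<le> \<eta>\<^sup>2 / (10 ^ 6 * 27)" unfolding \<delta> using r9 r eta(1) by (intro divide_left_mono mult_left_mono) auto
    then have "\<delta> * 27000000 \<le> \<eta>\<^sup>2" by simp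
    moreover have "\<epsilon> * 100000000 \<le> \<eta>\<^sup>2" "\<gamma> * 100000000 = \<eta>\<^sup>2" "0 \<le> \<eta>\<^sup>2"
      using \<epsilon>1(2) by (simp_all add: \<gamma>)
    ultimately have "2 * \<delta> \<le> - (2 * \<epsilon> + 2 * \<gamma>) + (\<eta>\<^sup>2 / 800000 - \<gamma>) / 5"
      by argo
    from mult_right_mono[OF this, of "real n"] show ?thesis by (simp add: algebra_simps)
  qed
  have inK: "map \<phi> (switch_list ?E j) \<in> dist_lists n (2 + 2 * k)" if "j \<in> J" for j
  proof -
    obtain x y where xy: "j = (x, y)" by fastforce
    have sub: "set (switch_list ?E (x, y)) \<subseteq> uverts T"
      using that J(1) neighbours_simple(1)[OF G] unfolding xy set_switch_list[OF G] by blast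
    have "inj_on \<phi> (set (switch_list ?E (x, y)))" using \<phi> sub by (auto simp: bij_betw_def intro: inj_on_subset)
    moreover have "\<phi> ` set (switch_list ?E (x, y)) \<subseteq> {..<n}" using \<phi> sub by (auto simp: bij_betw_def)
    ultimately show ?thesis
      using switch_list_distinct[OF G J(5) that[unfolded xy]] by (simp add: dist_lists_def distinct_map xy)
  qed
  have colr: "c {x, y} \<in> {1..r}" if "x < n" "y < n" "x \<noteq> y" for x y
    using col that unfolding edge_colouring_def complete_ugraph_def by auto
  have "\<exists>S\<subseteq>J. \<forall>i\<in>{2..r}. X0 i + (\<Sum>j\<in>S. g j i) \<ge> \<delta> * n"
  proof (rule switching_all_coordinates)
    show "0 < \<delta> * real n" using \<delta>0 n(1) by simp
    show "\<bar>g j i\<bar> \<le> 8" for j i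
      using of_int_le_iff[THEN iffD2, OF abs_list_gain_le[of k c i "map \<phi> (switch_list ?E j)"], where 'a1 = real] k
      by (auto simp: g_def)
    have "2 * real (card J) * real (card {2..r}) * 8\<^sup>2 \<le> 2 * real n * real r * 8\<^sup>2"
      using J(4) by (intro mult_mono) auto
    also have "\<dots> = 128 * real r * n" by simp
    also have "\<dots> < (\<delta>\<^sup>2 * n) * n" using n(1,4) by (intro mult_strict_right_mono) auto
    also have "\<dots> = (\<delta> * n)\<^sup>2" by (simp add: power2_eq_square)
    finally show "2 * real (card J) * real (card {2..r}) * 8\<^sup>2 < (\<delta> * real n)\<^sup>2" .
    fix w :: "nat \<Rightarrow> real" assume w: "\<And>i. i \<in> {2..r} \<Longrightarrow> w i \<ge> 0"
    define W where "W = (\<Sum>i\<in>{2..r}. w i)"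
    have W0: "W \<ge> 0" unfolding W_def using w by (intro sum_nonneg) auto
    have r1: "1 \<le> r" using r by simp
    obtain j0 where j0: "j0 \<in> {1..r}"
      and j0': "\<And>a d z z'. a < n \<Longrightarrow> d < n \<Longrightarrow> z < n \<Longrightarrow> z' < n \<Longrightarrow> distinct [a, d, z, z'] \<Longrightarrow>
        alternating (colour_diff c j0) a d z z' \<ge> 1 \<Longrightarrow>
        W / 5 \<le> (\<Sum>i\<in>{2..r}. w i * alternating (colour_diff c i) a d z z')"
      using weighted_gain[where w = w and c = c and r = r and n = n, OF w colr r1] unfolding W_def by blast
    \<comment> \<open>Only exchanges profitable for \<open>j0\<close> are counted; by the
      \<open>max 0\<close> all others contribute nonnegatively.\<close>
    let ?J0 = "{j \<in> J. map \<phi> (switch_list ?E j) \<in> good_lists c k j0}"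
    have "(\<eta>\<^sup>2 / 800000 - \<gamma>) * n * (W / 5) \<le> card ?J0 * (W / 5)"
      using M[OF j0] W0 by (intro mult_right_mono) auto
    also have "\<dots> = (\<Sum>j\<in>?J0. W / 5)" by simp
    also have "\<dots> \<le> (\<Sum>j\<in>?J0. max 0 (\<Sum>i\<in>{2..r}. w i * g j i))"
    proof (rule sum_mono)
      fix j assume j: "j \<in> ?J0"
      have k1: "1 \<le> k" using k by auto
      have "W / 5 \<le> (\<Sum>i\<in>{2..r}. w i * g j i)"
        unfolding g_def by (rule weighted_list_gain[OF inK _ k1 W0 j0']) (use j in auto)
      then show "W / 5 \<le> max 0 (\<Sum>i\<in>{2..r}. w i * g j i)" by simp
    qed
    also have "\<dots> \<le> (\<Sum>j\<in>J. max 0 (\<Sum>i\<in>{2..r}. w i * g j i))"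
      using J(2) by (intro sum_mono2) auto
    finally have gain: "(\<eta>\<^sup>2 / 800000 - \<gamma>) * n * (W / 5) \<le> (\<Sum>j\<in>J. max 0 (\<Sum>i\<in>{2..r}. w i * g j i))" .
    have "(- (2 * \<epsilon> + 2 * \<gamma>) * n) * W = (\<Sum>i\<in>{2..r}. w i * (- (2 * \<epsilon> + 2 * \<gamma>) * n))"
      by (simp add: W_def sum_distrib_left sum_distrib_right mult.commute)
    also have "\<dots> \<le> (\<Sum>i\<in>{2..r}. w i * X0 i)"
      using X0 w by (intro sum_mono mult_left_mono) auto
    finally have base: "(- (2 * \<epsilon> + 2 * \<gamma>) * n) * W \<le> (\<Sum>i\<in>{2..r}. w i * X0 i)" .
    have "2 * (\<delta> * n) * W \<le> (- (2 * \<epsilon> + 2 * \<gamma>) * n + (\<eta>\<^sup>2 / 800000 - \<gamma>) * n / 5) * W"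
      by (rule mult_right_mono[OF num W0])
    also have "\<dots> = (- (2 * \<epsilon> + 2 * \<gamma>) * n) * W + (\<eta>\<^sup>2 / 800000 - \<gamma>) * n * (W / 5)"
      by (simp add: distrib_right)
    finally show "2 * (\<delta> * real n) * (\<Sum>i\<in>{2..r}. w i)
        \<le> (\<Sum>i\<in>{2..r}. w i * X0 i) + (\<Sum>j\<in>J. max 0 (\<Sum>i\<in>{2..r}. w i * g j i))"
      using gain base unfolding W_def by linarith
  qed (use J(2) in auto)
  then obtain S where S: "S \<subseteq> J" "\<And>i. i \<in> {2..r} \<Longrightarrow> X0 i + (\<Sum>j\<in>S. g j i) \<ge> \<delta> * n" by blast
  have finS: "finite S" using S(1) J(2) finite_subset by blast
  obtain \<psi> where \<psi>: "bij_betw \<psi> (uverts T) {..<n}"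
    "\<And>D. (\<Sum>e\<in>?E. D (\<psi> ` e)) = (\<Sum>e\<in>?E. D (\<phi> ` e)) + (\<Sum>(x, y)\<in>S. swap_gain D ?E \<phi> x y)"
    using switch_family_subset[OF G J(5) J(1) finS S(1) \<phi>] by blast
  have "\<delta> * n \<le> real_of_int (\<Sum>e\<in>?E. of_bool (c (\<psi> ` e) = 1) - of_bool (c (\<psi> ` e) = i))"
    if i: "i \<in> {2..r}" for i
  proof -
    let ?D = "\<lambda>s. of_bool (c s = 1) - of_bool (c s = i) :: int"
    have "swap_gain ?D ?E \<phi> x y = list_gain c k i (map \<phi> (switch_list ?E (x, y)))" if "(x, y) \<in> S" for x y
      using switching_familyD(1)[OF J(5), of x y] that S(1) i by (intro swap_gain_eq_list_gain[OF G]) auto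
    then have "(\<Sum>(x, y)\<in>S. swap_gain ?D ?E \<phi> x y) = (\<Sum>j\<in>S. list_gain c k i (map \<phi> (switch_list ?E j)))"
      by (intro sum.cong refl) auto
    then have "real_of_int (\<Sum>e\<in>?E. ?D (\<psi> ` e)) = X0 i + (\<Sum>j\<in>S. g j i)"
      using \<psi>(2)[of ?D] by (simp add: X0_def g_def)
    then show ?thesis using S(2)[OF i] by simp
  qed
  then show ?thesis using \<psi>(1) by blast
qed

lemma image_graph_copy:
  fixes T :: "nat ugraph"
  assumes G: "simple_graph T" and \<psi>: "bij_betw \<psi> (uverts T) V" and V: "finite V"
  defines "H \<equiv> \<lparr>uverts = V, uedges = (\<lambda>e. \<psi> ` e) ` uedges T\<rparr>"
  shows "copy_in T (complete_ugraph V) H"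
    and "int (colour_count H c 1) - int (colour_count H c i)
      = (\<Sum>e\<in>uedges T. of_bool (c (\<psi> ` e) = 1) - of_bool (c (\<psi> ` e) = i))"
proof -
  have inj: "inj_on \<psi> (uverts T)" and im: "\<psi> ` uverts T = V" using \<psi> by (auto simp: bij_betw_def)
  have edge: "e \<subseteq> uverts T \<and> card e = 2" if "e \<in> uedges T" for e using G that by (auto simp: simple_graph_def)
  have injE: "inj_on (\<lambda>e. \<psi> ` e) (uedges T)"
    using edge inj by (intro inj_onI) (metis inj_on_image_eq_iff)
  have img: "\<psi> ` e \<subseteq> V \<and> card (\<psi> ` e) = 2" if "e \<in> uedges T" for e
    using edge[OF that] im inj by (auto simp: card_image inj_on_subset)
  have "simple_graph H" using V img by (auto simp: simple_graph_def H_def)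
  moreover have "uedges H \<subseteq> uedges (complete_ugraph V)" using img by (auto simp: H_def complete_ugraph_def)
  moreover have "isomorphic_ugraph T H"
    unfolding isomorphic_ugraph_def
  proof (intro exI[of _ \<psi>] conjI ballI)
    show "bij_betw \<psi> (uverts T) (uverts H)" using \<psi> by (simp add: H_def)
    fix u v assume uv: "u \<in> uverts T" "v \<in> uverts T"
    have "{\<psi> u, \<psi> v} \<in> uedges H \<longleftrightarrow> (\<exists>e\<in>uedges T. \<psi> ` {u, v} = \<psi> ` e)" by (auto simp: H_def)
    also have "\<dots> \<longleftrightarrow> (\<exists>e\<in>uedges T. {u, v} = e)"
      using edge uv inj_on_image_eq_iff[OF inj, of "{u, v}"] by auto
    finally show "{u, v} \<in> uedges T \<longleftrightarrow> {\<psi> u, \<psi> v} \<in> uedges H" by simp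
  qed
  ultimately show "copy_in T (complete_ugraph V) H"
    by (simp add: copy_in_def subgraph_of_def) (simp add: H_def complete_ugraph_def)
  have fin: "finite (uedges T)" by (rule neighbours_simple(4)[OF G])
  have cnt: "int (colour_count H c j) = (\<Sum>e\<in>uedges T. of_bool (c (\<psi> ` e) = j))" for j
  proof -
    have "{e \<in> uedges H. c e = j} = (\<lambda>e. \<psi> ` e) ` {e \<in> uedges T. c (\<psi> ` e) = j}" by (auto simp: H_def)
    moreover have "inj_on (\<lambda>e. \<psi> ` e) {e \<in> uedges T. c (\<psi> ` e) = j}"
      by (rule inj_on_subset[OF injE]) auto
    ultimately have "colour_count H c j = card {e \<in> uedges T. c (\<psi> ` e) = j}"
      by (simp add: colour_count_def card_image)
    then show ?thesis using fin by (simp add: of_bool_def sum.If_cases Int_def)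
  qed
  show "int (colour_count H c 1) - int (colour_count H c i)
      = (\<Sum>e\<in>uedges T. of_bool (c (\<psi> ` e) = 1) - of_bool (c (\<psi> ` e) = i))"
    unfolding cnt by (simp add: sum_subtractf)
qed

theorem theorem1p7:
  fixes r :: nat
  assumes "r \<ge> 3"
  shows "\<exists>\<eta>0::real. \<eta>0 > 0 \<and> (\<forall>\<eta>::real. 0 < \<eta> \<and> \<eta> < \<eta>0 \<longrightarrow>
    (\<exists>\<epsilon>::real. \<epsilon> > 0 \<and> (\<exists>n0::nat. \<forall>n\<ge>n0. \<forall>T :: nat ugraph.
      tree_ugraph T \<and> card (uverts T) = n \<and> real (max_graph_degree T) \<le> \<epsilon> * real n \<longrightarrow>
      (\<forall>c :: nat set \<Rightarrow> nat.
        edge_colouring r (complete_ugraph {..<n}) c \<and>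
        balanced_colouring \<epsilon> r (complete_ugraph {..<n}) c \<and>
        standard_colouring \<eta> r (complete_ugraph {..<n}) c \<longrightarrow>
        (\<exists>H :: nat ugraph. copy_in T (complete_ugraph {..<n}) H \<and>
          (\<forall>i\<in>{2..r}. real (colour_count H c 1) \<ge>
             real (colour_count H c i) + \<eta>\<^sup>2 / (10 ^ 6 * real r ^ 3) * real n))))))"
proof (rule exI[of _ "1 / (100 * (real r)\<^sup>2)"], intro conjI allI impI, goal_cases)
  case 1
  show ?case using assms by simp
next
  case (2 \<eta>)
  then have eta: "0 < \<eta>" "\<eta> \<le> 1 / (100 * (real r)\<^sup>2)" by auto
  define \<gamma> where "\<gamma> = \<eta>\<^sup>2 / 10 ^ 8"
  define \<epsilon> where "\<epsilon> = \<gamma>\<^sup>2 / (40 * real r)"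
  define \<delta> where "\<delta> = \<eta>\<^sup>2 / (10 ^ 6 * real r ^ 3)"
  have pos: "\<gamma> > 0" "\<epsilon> > 0" "\<delta> > 0" using eta assms by (auto simp: \<gamma>_def \<epsilon>_def \<delta>_def)
  have large: "eventually (\<lambda>n. K \<le> real n) sequentially" for K
    using filterlim_real_sequentially unfolding filterlim_at_top by blast
  have ratio: "eventually (\<lambda>n. real (card (dist_lists n s)) ^ 2 / card (dist_lists n (2 * s)) < 1 + \<gamma>\<^sup>2 / (8 * real r)) sequentially" for s
    using pos assms by (intro order_tendstoD(2)[OF dist_lists_ratio_tendsto]) simp
  \<comment> \<open>The summand 1 in the fourth condition turns a non-strict bound into the strict
    one that the quadratic penalty needs.\<close>
  have "eventually (\<lambda>n. 200 \<le> real n \<and> 6000 / \<eta> \<le> real n \<and> 8 / (\<eta> / 100)\<^sup>2 \<le> real n \<and> 128 * real r / \<delta>\<^sup>2 + 1 \<le> real n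
    \<and> real (card (dist_lists n 2)) ^ 2 / card (dist_lists n (2 * 2)) < 1 + \<gamma>\<^sup>2 / (8 * real r)
    \<and> real (card (dist_lists n 4)) ^ 2 / card (dist_lists n (2 * 4)) < 1 + \<gamma>\<^sup>2 / (8 * real r)
    \<and> real (card (dist_lists n 6)) ^ 2 / card (dist_lists n (2 * 6)) < 1 + \<gamma>\<^sup>2 / (8 * real r)) sequentially"
    by (intro eventually_conj large ratio)
  then obtain n0 where n0: "\<And>n. n \<ge> n0 \<Longrightarrow>
    200 \<le> real n \<and> 6000 / \<eta> \<le> real n \<and> 8 / (\<eta> / 100)\<^sup>2 \<le> real n \<and> 128 * real r / \<delta>\<^sup>2 + 1 \<le> real n
    \<and> real (card (dist_lists n 2)) ^ 2 / card (dist_lists n (2 * 2)) < 1 + \<gamma>\<^sup>2 / (8 * real r)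
    \<and> real (card (dist_lists n 4)) ^ 2 / card (dist_lists n (2 * 4)) < 1 + \<gamma>\<^sup>2 / (8 * real r)
    \<and> real (card (dist_lists n 6)) ^ 2 / card (dist_lists n (2 * 6)) < 1 + \<gamma>\<^sup>2 / (8 * real r)"
    unfolding eventually_sequentially by blast
  show ?case
  proof (rule exI[of _ \<epsilon>], rule conjI, rule pos(2), rule exI[of _ n0], intro allI impI, elim conjE)
    fix n and T :: "nat ugraph" and c :: "nat set \<Rightarrow> nat"
    assume "n \<ge> n0" and T: "tree_ugraph T" "card (uverts T) = n" "real (max_graph_degree T) \<le> \<epsilon> * real n"
      and c: "edge_colouring r (complete_ugraph {..<n}) c" "balanced_colouring \<epsilon> r (complete_ugraph {..<n}) c"
        "standard_colouring \<eta> r (complete_ugraph {..<n}) c"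
    note N = n0[OF \<open>n \<ge> n0\<close>]
    have \<delta>2: "\<delta>\<^sup>2 > 0" and e2: "(\<eta> / 100)\<^sup>2 > 0" using pos eta by auto
    have n: "n \<ge> 200" "6000 \<le> \<eta> * n" "8 \<le> (\<eta> / 100)\<^sup>2 * n"
      using N eta(1) e2 by (auto simp: pos_divide_le_eq mult.commute)
    have "128 * real r / \<delta>\<^sup>2 < real n" using N by linarith
    then have n4: "128 * real r < \<delta>\<^sup>2 * n" using \<delta>2 by (simp add: pos_divide_less_eq mult.commute)
    have rat: "real (card (dist_lists n s)) ^ 2 / card (dist_lists n (2 * s)) \<le> 1 + \<gamma>\<^sup>2 / (8 * real r)"
      if "s \<in> {2, 4, 6}" for s using that N by (auto simp: less_imp_le)
    obtain \<psi> where \<psi>: "bij_betw \<psi> (uverts T) {..<n}" "\<And>i. i \<in> {2..r} \<Longrightarrow>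
      \<delta> * n \<le> real_of_int (\<Sum>e\<in>uedges T. of_bool (c (\<psi> ` e) = 1) - of_bool (c (\<psi> ` e) = i))"
      using biased_embedding[OF assms eta \<gamma>_def \<epsilon>_def \<delta>_def T c n n4 rat] by blast
    define H where "H = \<lparr>uverts = {..<n}, uedges = (\<lambda>e. \<psi> ` e) ` uedges T\<rparr>"
    have G: "simple_graph T" using T(1) by (simp add: tree_ugraph_def)
    note copy = image_graph_copy[OF G \<psi>(1) finite_lessThan, folded H_def]
    have "real (colour_count H c i) + \<eta>\<^sup>2 / (10 ^ 6 * real r ^ 3) * real n \<le> real (colour_count H c 1)"
      if "i \<in> {2..r}" for i
      using \<psi>(2)[OF that] unfolding copy(2)[of c i, symmetric] by (simp add: \<delta>_def)
    then show "\<exists>H. copy_in T (complete_ugraph {..<n}) H \<and> (\<forall>i\<in>{2..r}. real (colour_count H c i)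
        + \<eta>\<^sup>2 / (10 ^ 6 * real r ^ 3) * real n \<le> real (colour_count H c 1))"
      using copy(1) by blast
  qed
qed

end
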